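(* Fix $t\geq 0$ and let $Y_t$ be the splitting tessellation of $\mathbb{S}^2$ at time $t$. Define $$L_{\mathbf E}:=\mathbb{E}\Big[2\pi\sum_{e\in\mathbf E(Y_t)}\sigma_1(e)\Big],\qquad L_{\mathbf M}:=\mathbb{E}\Big[2\pi\sum_{m\in\mathbf M(Y_t)}\sigma_1(m)\Big],\qquad L_{\mathbf S}:=\mathbb{E}\Big[2\pi\sum_{p\in\mathbf Z(Y_t)}\sigma_1(\partial p)\Big].$$ Then $$L_{\mathbf E}=2\pi(1+t-e^{-2t}),\qquad L_{\mathbf M}=2\pi t,\qquad L_{\mathbf S}=4\pi(t+1).$$
   Context: $\mathbb{S}^2\subset\mathbb{R}^3$ is the unit sphere; $\sigma_2$ is the spherical Lebesgue measure normalized so that $\sigma_2(\mathbb{S}^2)=1$; $\sigma_1$ is the spherical length measure normalized so that every great circle has $\sigma_1$-measure $1$ (so $2\pi\sigma_1$ is arc length). $\tau$ is the rotation-invariant probability measure on the set $\mathscr G$ of great circles, namely the image of $\sigma_2$ under $u\mapsto \mathbb{S}^2\cap u^\perp$. For $B\subseteq\mathbb{S}^2$ let $[B]:=\{g\in\mathscr G: g\cap B\neq\emptyset\}$. A spherically convex polygon is a finite intersection of closed hemispheres (the whole sphere is also allowed). A tessellation of $\mathbb{S}^2$ is a finite set of spherically convex polygons (its cells) with pairwise disjoint interiors whose union is $\mathbb{S}^2$; it is identified with the union of the boundaries of its cells. For a tessellation $T$, a cell $p$ of $T$ and $g\in[p]$, $\oslash_{p,g}(T)$ denotes the tessellation obtained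 by replacing $p$ by the two cells $p\cap g^+$, $p\cap g^-$, where $g^\pm$ are the closed hemispheres bounded by $g$. Let $A=\mathbb{S}^2\cap\{z=0\}$ be the equator and $\mathbb{S}^2_\pm=\mathbb{S}^2\cap\{\pm z\ge 0\}$. The splitting tessellation process $(Y_t)_{t\ge0}$ is the continuous-time Markov process on tessellations with $Y_0=A$ (cells $\mathbb{S}^2_+,\mathbb{S}^2_-$) and generator $\mathbb L f(T)=\sum_{p\text{ cell of }T}\int_{[p]}[f(\oslash_{p,g}(T))-f(T)]\,\tau(\mathrm dg)$; equivalently, each cell $p$ waits an independent exponential time with parameter $\tau([p])$ and is then split by a great circle with law $\tau(\cdot\cap[p])/\tau([p])$, the two daughter cells then evolving independently by the same rule. For a tessellation $Y_t$: $\mathbf Z(Y_t)$ is its set of cells; a vertex is a non-empty intersection of three different cells, $\mathbf V(Y_t)$ the set of vertices; an edge is a spherical line segment contained in the boundary of some cell, bounded by two different vertices and with no vertex in its relative interior, $\mathbf E(Y_t)$ the set of edges; a maximal segment is a maximal union of connected edges lying on a common great circle and having different endpoints (equivalently, the spherical segments created by the splits up to time $t$, the equator $A$ not being one), $\mathbf M(Y_t)$ the set of maximal segments; $\partial p$ is the boundary of a cell $p$. *)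

theory Defs
  imports "HOL-Analysis.Analysis"
begin

type_synonym pt = "real^3"
type_synonym tess = "pt set set"   (* a tessellation = its finite set of cells *)

definition S2 :: "pt set" where "S2 = sphere 0 1"

definition gcirc :: "pt \<Rightarrow> pt set" where "gcirc u = {x \<in> S2. u \<bullet> x = 0}"
definition hemi :: "pt \<Rightarrow> pt set" where "hemi u = {x \<in> S2. u \<bullet> x \<ge> 0}"

definition north :: pt where "north = axis 3 1"
definition equator :: "pt set" where "equator = gcirc north"
definition Y0 :: tess where "Y0 = {hemi north, hemi (- north)}"

text \<open>sigma_2: normalized spherical Lebesgue measure (radial projection of the
  normalized Lebesgue measure of the unit ball).\<close>
definition sigma2 :: "pt measure" where
  "sigma2 = distr (uniform_measure lborel (cball 0 1)) borel sgn"

text \<open>[p] pulled back to unit normals; tau([p]) = sigma2 of it.\<close>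
definition hits :: "pt set \<Rightarrow> pt set" where "hits p = {u. gcirc u \<inter> p \<noteq> {}}"
definition tau_hit :: "pt set \<Rightarrow> real" where "tau_hit p = measure sigma2 (hits p)"

definition split_cell :: "tess \<Rightarrow> pt set \<Rightarrow> pt \<Rightarrow> tess" where
  "split_cell T p u = (T - {p}) \<union> {p \<inter> hemi u, p \<inter> hemi (- u)}"

definition rate :: "tess \<Rightarrow> real" where "rate T = (\<Sum>p\<in>T. tau_hit p)"

text \<open>Law of Y_t from the jump description (minimal jump process / Dyson series):
  jumpP f n T t = E_T[f(Y_t); exactly n splits in [0,t]].\<close>
primrec jumpP :: "(tess \<Rightarrow> ennreal) \<Rightarrow> nat \<Rightarrow> tess \<Rightarrow> real \<Rightarrow> ennreal" where
  "jumpP f 0 T t = ennreal (exp (- rate T * t)) * f T"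
| "jumpP f (Suc n) T t =
     (\<integral>\<^sup>+ s. indicator {0..t} s * ennreal (exp (- rate T * s)) *
        (\<Sum>p\<in>T. \<integral>\<^sup>+ u. indicator (hits p) u * jumpP f n (split_cell T p u) (t - s) \<partial>sigma2)
      \<partial>lborel)"

definition Exp_Y :: "real \<Rightarrow> (tess \<Rightarrow> ennreal) \<Rightarrow> ennreal" where
  "Exp_Y t f = (\<Sum>n. jumpP f n Y0 t)"

definition circ_pt :: "pt \<Rightarrow> pt \<Rightarrow> real \<Rightarrow> pt" where
  "circ_pt a b \<theta> = cos \<theta> *\<^sub>R a + sin \<theta> *\<^sub>R b"

definition orthonormal2 :: "pt \<Rightarrow> pt \<Rightarrow> bool" where
  "orthonormal2 a b \<longleftrightarrow> norm a = 1 \<and> norm b = 1 \<and> a \<bullet> b = 0"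

text \<open>spherical segment from a of angle alpha in direction b (distinct endpoints since 0<alpha<2pi)\<close>
definition sph_arc :: "pt \<Rightarrow> pt \<Rightarrow> real \<Rightarrow> pt set" where
  "sph_arc a b \<alpha> = circ_pt a b ` {0..\<alpha>}"

definition is_segment :: "pt set \<Rightarrow> bool" where
  "is_segment S \<longleftrightarrow> (\<exists>a b \<alpha>. orthonormal2 a b \<and> 0 < \<alpha> \<and> \<alpha> < 2*pi \<and> S = sph_arc a b \<alpha>)"

definition great_circles :: "pt set set" where
  "great_circles = {gcirc u | u. norm u = 1}"

text \<open>1-dimensional measure of B on a great circle C (arc length / 2pi), and sigma_1 for sets
  contained in finitely (countably) many great circles: sum over great circles.\<close>
definition circ_len :: "pt set \<Rightarrow> pt set \<Rightarrow> ennreal" where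
  "circ_len C B = (let (a, b) = (SOME (a, b). orthonormal2 a b \<and> C = circ_pt a b ` {0..<2*pi})
                   in emeasure lborel {\<theta> \<in> {0..<2*pi}. circ_pt a b \<theta> \<in> B} / ennreal (2*pi))"

definition sigma1 :: "pt set \<Rightarrow> ennreal" where
  "sigma1 B = (\<Sum>\<^sub>\<infinity>C\<in>great_circles. circ_len C B)"

definition sph_boundary :: "pt set \<Rightarrow> pt set" where
  "sph_boundary p = {x \<in> p. \<forall>e>0. \<exists>y \<in> S2 - p. dist x y < e}"

definition vertices :: "tess \<Rightarrow> pt set" where
  "vertices T = {x. \<exists>p1 p2 p3. p1 \<in> T \<and> p2 \<in> T \<and> p3 \<in> T \<and>
       p1 \<noteq> p2 \<and> p1 \<noteq> p3 \<and> p2 \<noteq> p3 \<and> x \<in> p1 \<inter> p2 \<inter> p3}"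

definition edges :: "tess \<Rightarrow> pt set set" where
  "edges T = {e. (\<exists>p\<in>T. e \<subseteq> sph_boundary p) \<and>
       (\<exists>a b \<alpha>. orthonormal2 a b \<and> 0 < \<alpha> \<and> \<alpha> < 2*pi \<and> e = sph_arc a b \<alpha> \<and>
          a \<in> vertices T \<and> circ_pt a b \<alpha> \<in> vertices T \<and>
          (\<forall>\<theta>\<in>{0<..<\<alpha>}. circ_pt a b \<theta> \<notin> vertices T))}"

definition edge_chain :: "tess \<Rightarrow> pt set set \<Rightarrow> bool" where
  "edge_chain T E \<longleftrightarrow> E \<noteq> {} \<and> E \<subseteq> edges T \<and> connected (\<Union>E) \<and>
       (\<exists>u. norm u = 1 \<and> \<Union>E \<subseteq> gcirc u)"

definition max_segments :: "tess \<Rightarrow> pt set set" where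
  "max_segments T = {m. (\<exists>E. edge_chain T E \<and> m = \<Union>E \<and>
        (\<forall>E'. edge_chain T E' \<and> \<Union>E \<subseteq> \<Union>E' \<longrightarrow> \<Union>E' = \<Union>E)) \<and> is_segment m}"

end

theory Submission
  imports Defs
begin

text \<open>
  A state of the process reached by finitely many splits is, almost surely, in general position: any
  three of the normals of the splitting circles are linearly independent. For such a tessellation,
  write \<open>L\<close> for the total length of the maximal segments (in units of a great circle). Every point
  of the skeleton outside a finite set lies in exactly two cell boundaries and, once a split has
  happened, in exactly one edge, so the boundaries have total length \<open>2 (1 + L)\<close> and the edges
  \<open>1 + L\<close>; before the first split there are no vertices and hence no edges.

  The cells cover almost every great circle exactly once, so a new great circle adds, summed over the
  cells that it may split, length exactly one: \<open>L\<close> has unit drift. Therefore \<open>L + \<gamma> + t\<close> solves the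
  backward equation of the process, and it agrees with the Dyson series because the remainder after
  \<open>n\<close> splits decays geometrically, the rate of a tessellation being at most its number of cells.
  The correction \<open>exp (- 2 t)\<close> for the edges is the probability that no split has occurred.
  Measurability is obtained by coding a tessellation by its sequence of normals and a finite set of
  sign patterns, one for each cell.
\<close>

section \<open>Great circles and arc length\<close>

text \<open>Two obstacles shape the argument. All quantities live in \<open>ennreal\<close>, where
  the Dyson series is the minimal solution of the backward equation; a guessed solution only bounds
  it from above until its iterates under \<open>step\<close> are shown to vanish. Rates are
  unbounded, but each cell splits at rate at most 1, which suggests comparison with a Yule process:
  \<open>v = 1 / damp eps\<close> solves \<open>v' = (1 + eps) v^2 - v\<close>, the backward
  equation of a Yule process in which every split carries the weight \<open>1 + eps\<close>. As long
  as this solution is finite, the term with n splits is of order \<open>(1 + eps)^(- n)\<close>. The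
  second obstacle: additivity of the nonnegative integral needs measurable integrands, while states
  are sets of sets and \<open>circ_len\<close> picks its frame by \<open>SOME\<close>; hence the
  codes, and frames that are explicit functions of the normal. General position enters only as
  nonvanishing of \<open>triple\<close>: at most two circles pass through a point of the sphere, and
  the point can be perturbed with prescribed inner products with both their normals and a new
  one.\<close>

definition frame :: "pt \<Rightarrow> pt \<Rightarrow> pt \<Rightarrow> bool" where
  "frame u a b \<longleftrightarrow> norm u = 1 \<and> orthonormal2 a b \<and> u \<bullet> a = 0 \<and> u \<bullet> b = 0"

definition triple :: "pt \<Rightarrow> pt \<Rightarrow> pt \<Rightarrow> real" where
  "triple u v w = u \<bullet> cross3 v w"

text \<open>Cramer's rule in the reciprocal basis. It stands in for all rank arguments: if
  \<open>triple u v w\<close> is nonzero, only 0 is orthogonal to the three vectors, and their inner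
  products with a vector can be prescribed at will.\<close>

lemma triple_dual: "triple u v w *\<^sub>R x =
    (u \<bullet> x) *\<^sub>R cross3 v w + (v \<bullet> x) *\<^sub>R cross3 w u + (w \<bullet> x) *\<^sub>R cross3 u v"
  by (simp add: triple_def cross3_simps forall_3)

lemma orthogonal_triple_eq_0:
  assumes "triple u v w \<noteq> 0" "u \<bullet> x = 0" "v \<bullet> x = 0" "w \<bullet> x = 0"
  shows "x = 0"
  using triple_dual[of u v w x] assms by simp

lemma triple_inner_surj:
  assumes "triple u v w \<noteq> 0"
  obtains d where "u \<bullet> d = \<alpha>" "v \<bullet> d = \<beta>" "w \<bullet> d = \<gamma>"
proof
  define d where "d = (1 / triple u v w) *\<^sub>R
    (\<alpha> *\<^sub>R cross3 v w + \<beta> *\<^sub>R cross3 w u + \<gamma> *\<^sub>R cross3 u v)"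
  have cyc: "v \<bullet> cross3 w u = triple u v w" "w \<bullet> cross3 u v = triple u v w"
    by (simp_all add: triple_def cross3_simps)
  show "u \<bullet> d = \<alpha>" "v \<bullet> d = \<beta>" "w \<bullet> d = \<gamma>"
    using assms by (simp_all add: d_def inner_add_right dot_cross_self cyc) (simp add: triple_def)
qed

lemma triple_swap: "triple v u w = - triple u v w" "triple u w v = - triple u v w"
  by (simp_all add: triple_def cross3_simps)

lemma triple_cyc: "triple v w u = triple u v w"
  by (simp add: triple_def cross3_simps)

lemma triple_axes: "triple (axis 1 1) (axis 2 1) (axis 3 1) = 1"
  by (simp add: triple_def cross_basis inner_axis_axis)

lemma triple_orthogonal:
  assumes "u \<bullet> v = 0" "u \<bullet> w = 0" "v \<bullet> w = 0"
  shows "(triple u v w)\<^sup>2 = (u \<bullet> u) * (v \<bullet> v) * (w \<bullet> w)"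
proof -
  have "cross3 u (cross3 v w) = 0" using assms by (simp add: Lagrange)
  then have "(triple u v w)\<^sup>2 = (norm u * norm (cross3 v w))\<^sup>2"
    using norm_cross_dot[of u "cross3 v w"] by (simp add: triple_def)
  moreover have "(norm (cross3 v w))\<^sup>2 = (norm v * norm w)\<^sup>2"
    using norm_cross_dot[of v w] assms by simp
  ultimately show ?thesis by (simp add: power_mult_distrib power2_norm_eq_inner)
qed

lemma frame_triple: "frame u a b \<Longrightarrow> triple u a b \<noteq> 0"
  using triple_orthogonal[of u a b] by (auto simp: frame_def orthonormal2_def norm_eq_1)

lemma inner_circ_pt: "u \<bullet> circ_pt a b \<theta> = cos \<theta> * (u \<bullet> a) + sin \<theta> * (u \<bullet> b)"
  by (simp add: circ_pt_def inner_add_right)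

lemma circ_pt_inner:
  assumes "orthonormal2 a b"
  shows "a \<bullet> circ_pt a b \<theta> = cos \<theta>" "b \<bullet> circ_pt a b \<theta> = sin \<theta>"
  using assms by (auto simp: inner_circ_pt orthonormal2_def norm_eq_1 inner_commute)

lemma norm_circ_pt: "orthonormal2 a b \<Longrightarrow> norm (circ_pt a b \<theta>) = 1"
  unfolding norm_eq_1
  by (simp add: circ_pt_def inner_add_left inner_add_right orthonormal2_def norm_eq_1 inner_commute
      power2_eq_square[symmetric])

lemma circ_pt_eq_iff:
  assumes "orthonormal2 a b"
  shows "circ_pt a b \<theta> = circ_pt a b \<phi> \<longleftrightarrow> cos \<theta> = cos \<phi> \<and> sin \<theta> = sin \<phi>"
  using circ_pt_inner[OF assms] by (metis circ_pt_def)

lemma inj_on_circ_pt: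
  assumes "orthonormal2 a b" "\<And>x y. x \<in> X \<Longrightarrow> y \<in> X \<Longrightarrow> \<bar>x - y\<bar> < 2 * pi"
  shows "inj_on (circ_pt a b) X"
proof (rule inj_onI)
  fix x y assume xy: "x \<in> X" "y \<in> X" "circ_pt a b x = circ_pt a b y"
  then have "sin x = sin y \<and> cos x = cos y" using circ_pt_eq_iff[OF assms(1)] by auto
  then obtain n :: int where n: "x = y + 2 * pi * n" by (auto simp: sin_cos_eq_iff)
  with assms(2)[OF xy(1,2)] have "\<bar>2 * pi * n\<bar> < 2 * pi * 1" by simp
  then have "\<bar>real_of_int n\<bar> < 1" by (simp add: abs_mult)
  then have "n = 0" by linarith
  with n show "x = y" by simp
qed

lemma circ_pt_periodic: "circ_pt a b (\<theta> + 2 * pi) = circ_pt a b \<theta>"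
  "circ_pt a b (\<theta> - 2 * pi) = circ_pt a b \<theta>"
  by (simp_all add: circ_pt_def cos_add sin_add cos_diff sin_diff)

lemma frame_expand:
  assumes "frame u a b" "u \<bullet> x = 0"
  shows "x = (a \<bullet> x) *\<^sub>R a + (b \<bullet> x) *\<^sub>R b"
proof -
  have "x - ((a \<bullet> x) *\<^sub>R a + (b \<bullet> x) *\<^sub>R b) = 0"
    using assms by (intro orthogonal_triple_eq_0[OF frame_triple[OF assms(1)]])
      (auto simp: frame_def orthonormal2_def inner_diff_right inner_add_right norm_eq_1 inner_commute)
  then show ?thesis by simp
qed

lemma frame_circ_pt_obtain:
  assumes "frame u a b" "u \<bullet> x = 0" "norm x = 1"
  obtains \<theta> where "0 \<le> \<theta>" "\<theta> < 2 * pi" "x = circ_pt a b \<theta>"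
proof -
  have e: "x = (a \<bullet> x) *\<^sub>R a + (b \<bullet> x) *\<^sub>R b" by (rule frame_expand[OF assms(1,2)])
  have "x \<bullet> x = x \<bullet> ((a \<bullet> x) *\<^sub>R a + (b \<bullet> x) *\<^sub>R b)"
    using e by simp
  then have "(a \<bullet> x)\<^sup>2 + (b \<bullet> x)\<^sup>2 = 1"
    using assms(3) by (simp add: inner_add_right norm_eq_1 power2_eq_square inner_commute)
  then obtain t where "0 \<le> t" "t < 2 * pi" "a \<bullet> x = cos t" "b \<bullet> x = sin t"
    using sincos_total_2pi by metis
  with e that[of t] show thesis by (simp add: circ_pt_def)
qed

lemma gcirc_frame: "frame u a b \<Longrightarrow> gcirc u = circ_pt a b ` {0..<2 * pi}"
proof
  assume f: "frame u a b"
  show "gcirc u \<subseteq> circ_pt a b ` {0..<2 * pi}"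
  proof
    fix x assume "x \<in> gcirc u"
    then obtain \<theta> where "0 \<le> \<theta>" "\<theta> < 2 * pi" "x = circ_pt a b \<theta>"
      using frame_circ_pt_obtain[OF f, of x] by (auto simp: gcirc_def S2_def)
    then show "x \<in> circ_pt a b ` {0..<2 * pi}" by auto
  qed
  show "circ_pt a b ` {0..<2 * pi} \<subseteq> gcirc u"
    using f by (auto simp: gcirc_def S2_def norm_circ_pt inner_circ_pt frame_def)
qed

lemma gcirc_frame_range: "frame u a b \<Longrightarrow> gcirc u = range (circ_pt a b)"
proof
  assume f: "frame u a b"
  show "gcirc u \<subseteq> range (circ_pt a b)" using gcirc_frame[OF f] by auto
  show "range (circ_pt a b) \<subseteq> gcirc u"
    using f by (auto simp: gcirc_def S2_def norm_circ_pt inner_circ_pt frame_def)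
qed

lemma frame_of_image:
  assumes "orthonormal2 a b" "circ_pt a b ` {0..<2 * pi} \<subseteq> gcirc u" "norm u = 1"
  shows "frame u a b"
proof -
  have "circ_pt a b 0 \<in> gcirc u" "circ_pt a b (pi/2) \<in> gcirc u"
    using pi_gt_zero assms(2) by (auto simp: image_subset_iff)
  then show ?thesis using assms by (auto simp: frame_def gcirc_def circ_pt_def)
qed

lemma frame_cross:
  assumes "norm u = 1" "norm a = 1" "u \<bullet> a = 0"
  shows "frame u a (cross3 u a)"
  using assms norm_cross_dot[of u a]
  by (auto simp: frame_def orthonormal2_def dot_cross_self power2_eq_1_iff)
    (metis norm_ge_zero not_one_le_zero neg_0_le_iff_le)

text \<open>An explicit base point, so that the frame depends measurably on \<open>u\<close>. It
  degenerates only for \<open>u\<close> parallel to \<open>axis 1 1\<close>, which general position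
  excludes because this axis is among the normals.\<close>

definition circ_base :: "pt \<Rightarrow> pt" where "circ_base u = sgn (cross3 u (axis 1 1))"

lemma frame_circ_base:
  assumes "norm u = 1" "cross3 u (axis 1 1) \<noteq> 0"
  shows "frame u (circ_base u) (cross3 u (circ_base u))"
  using assms by (intro frame_cross) (auto simp: circ_base_def norm_sgn sgn_div_norm dot_cross_self)

lemma frame_exists:
  assumes "norm u = 1"
  obtains a b where "frame u a b"
proof (cases "cross3 u (axis 1 1) = 0")
  case False
  with that frame_circ_base[OF assms] show thesis by blast
next
  case True
  have "cross3 u (axis 2 1) \<noteq> 0"
  proof
    assume "cross3 u (axis 2 1) = 0"
    with True have "u = 0"
      by (simp add: cross3_simps forall_3 axis_def)
    with assms show False by simp
  qed
  with assms have "frame u (sgn (cross3 u (axis 2 1))) (cross3 u (sgn (cross3 u (axis 2 1))))"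
    by (intro frame_cross) (auto simp: norm_sgn sgn_div_norm dot_cross_self)
  with that show thesis by blast
qed

lemma frame_extend:
  assumes "norm u = 1" "norm x = 1" "u \<bullet> x = 0"
  obtains y where "frame u x y"
  using frame_cross[OF assms] by blast

lemma circ_pt_rotate:
  "circ_pt (circ_pt a b \<phi>) (circ_pt a b (\<phi> + pi/2)) \<theta> = circ_pt a b (\<phi> + \<theta>)"
  by (simp add: circ_pt_def cos_add sin_add algebra_simps)

lemma circ_pt_reflect:
  "circ_pt (circ_pt a b \<phi>) (- circ_pt a b (\<phi> + pi/2)) \<theta> = circ_pt a b (\<phi> - \<theta>)"
  by (simp add: circ_pt_def cos_add sin_add cos_diff sin_diff algebra_simps)

lemma orthonormal2_circ_pt:
  assumes "orthonormal2 a b"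
  shows "orthonormal2 (circ_pt a b \<phi>) (circ_pt a b (\<phi> + pi/2))"
proof -
  have "circ_pt a b \<phi> \<bullet> circ_pt a b (\<phi> + pi/2) = 0"
    unfolding inner_circ_pt[of "circ_pt a b \<phi>"] inner_commute[of "circ_pt a b \<phi>" a]
      inner_commute[of "circ_pt a b \<phi>" b] circ_pt_inner[OF assms]
    by (simp add: cos_add sin_add)
  then show ?thesis using norm_circ_pt[OF assms] by (simp add: orthonormal2_def)
qed

text \<open>\<open>b'\<close> is a unit vector orthogonal to \<open>u\<close> and \<open>a'\<close>,
  hence plus or minus the quarter turn of \<open>a'\<close>: two frames of a circle differ by a
  rotation or a reflection.\<close>

lemma frame_reparam:
  assumes "frame u a b" "frame u a' b'" "a' = circ_pt a b \<phi>"
  shows "(\<forall>\<theta>. circ_pt a' b' \<theta> = circ_pt a b (\<phi> + \<theta>)) \<or>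
         (\<forall>\<theta>. circ_pt a' b' \<theta> = circ_pt a b (\<phi> - \<theta>))"
proof -
  let ?c = "circ_pt a b (\<phi> + pi/2)"
  have o: "orthonormal2 a' ?c" using orthonormal2_circ_pt assms by (auto simp: frame_def)
  have f: "frame u a' ?c" using assms o by (auto simp: frame_def inner_circ_pt)
  have e: "b' = (?c \<bullet> b') *\<^sub>R ?c"
    using frame_expand[OF f, of b'] assms by (auto simp: frame_def orthonormal2_def)
  then have "norm b' = \<bar>?c \<bullet> b'\<bar> * norm ?c" by (metis norm_scaleR)
  then have "\<bar>?c \<bullet> b'\<bar> = 1" using assms o by (auto simp: frame_def orthonormal2_def)
  then have "b' = ?c \<or> b' = - ?c" using e by (smt (verit) scaleR_minus_left scaleR_one)
  then show ?thesis using circ_pt_rotate circ_pt_reflect assms(3) by blast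
qed

lemma continuous_on_circ_pt [continuous_intros]: "continuous_on X (circ_pt a b)"
  unfolding circ_pt_def by (intro continuous_intros)

lemma measurable_circ_pt [measurable]: "circ_pt a b \<in> borel_measurable borel"
  by (intro borel_measurable_continuous_onI continuous_on_circ_pt)

section \<open>Arc length on a great circle does not depend on the frame\<close>

definition period_len :: "real set \<Rightarrow> real \<Rightarrow> ennreal" where
  "period_len P \<phi> = emeasure lborel (P \<inter> {\<phi>..<\<phi> + 2 * pi})"

lemma emeasure_lborel_shift:
  assumes "A \<in> sets borel"
  shows "emeasure lborel ((\<lambda>x::real. c + x) -` A) = emeasure lborel A"
  using assms by (subst (2) lborel_distr_plus[of c, symmetric], subst emeasure_distr) auto

lemma emeasure_lborel_reflect:
  assumes "A \<in> sets borel"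
  shows "emeasure lborel ((\<lambda>x::real. - x) -` A) = emeasure lborel A"
  using assms by (subst (2) lborel_distr_uminus[symmetric], subst emeasure_distr) auto

text \<open>The window starting at \<phi> is cut at \<open>2 * pi\<close>; its overhang, moved back
  by a period, is the piece of \<open>{0..<2*pi}\<close> lying before \<phi>.\<close>

lemma period_len_shift_invariant:
  assumes P: "P \<in> sets borel" and per: "\<And>x. x + 2 * pi \<in> P \<longleftrightarrow> x \<in> P"
    and "0 \<le> \<phi>" "\<phi> \<le> 2 * pi"
  shows "period_len P \<phi> = period_len P 0"
proof -
  let ?A = "P \<inter> {0..<\<phi>}" and ?B = "P \<inter> {\<phi>..<2*pi}" and ?C = "P \<inter> {2*pi..<\<phi> + 2*pi}"
  have m [measurable]: "P \<in> sets borel" by (rule P)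
  have "?A = (\<lambda>x. 2 * pi + x) -` ?C" using per by (auto simp: add.commute)
  then have AC: "emeasure lborel ?A = emeasure lborel ?C"
    by (simp only:) (rule emeasure_lborel_shift, measurable)
  have "period_len P \<phi> = emeasure lborel (?B \<union> ?C)"
    unfolding period_len_def by (rule arg_cong[where f = "emeasure lborel"]) (use assms in auto)
  also have "\<dots> = emeasure lborel ?B + emeasure lborel ?C"
    by (subst plus_emeasure) auto
  also have "\<dots> = emeasure lborel (?A \<union> ?B)"
    by (subst plus_emeasure[symmetric]) (auto simp: AC add.commute)
  also have "\<dots> = period_len P 0"
    unfolding period_len_def by (rule arg_cong[where f = "emeasure lborel"]) (use assms in auto)
  finally show ?thesis .
qed

definition frame_len :: "pt \<Rightarrow> pt \<Rightarrow> pt set \<Rightarrow> ennreal" where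
  "frame_len a b B = emeasure lborel {\<theta> \<in> {0..<2*pi}. circ_pt a b \<theta> \<in> B} / ennreal (2*pi)"

text \<open>The frame inside \<open>circ_len\<close> comes from \<open>SOME\<close>, so its value is
  accessible only once every frame of the circle is known to give the same length.\<close>

lemma frame_len_unique:
  assumes f: "frame u a b" "frame u a' b'" and B [measurable]: "B \<in> sets borel"
  shows "frame_len a' b' B = frame_len a b B"
proof -
  obtain \<phi> where \<phi>: "0 \<le> \<phi>" "\<phi> < 2 * pi" "a' = circ_pt a b \<phi>"
    using f frame_circ_pt_obtain[OF f(1), of a'] by (auto simp: frame_def orthonormal2_def)
  let ?P = "circ_pt a b -` B"
  have P: "?P \<in> sets borel" using measurable_sets[OF measurable_circ_pt B, of a b] by simp
  have per: "x + 2 * pi \<in> ?P \<longleftrightarrow> x \<in> ?P" for x by (simp add: circ_pt_periodic)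
  have shift: "period_len ?P \<phi> = period_len ?P 0"
    by (rule period_len_shift_invariant[OF P per]) (use \<phi> in auto)
  have base: "emeasure lborel {\<theta> \<in> {0..<2*pi}. circ_pt a b \<theta> \<in> B} = period_len ?P 0"
    unfolding period_len_def by (rule arg_cong[where f = "emeasure lborel"]) auto
  from frame_reparam[OF f \<phi>(3)]
  have "emeasure lborel {\<theta> \<in> {0..<2*pi}. circ_pt a' b' \<theta> \<in> B} = period_len ?P 0"
  proof
    assume r: "\<forall>\<theta>. circ_pt a' b' \<theta> = circ_pt a b (\<phi> + \<theta>)"
    have "{\<theta> \<in> {0..<2*pi}. circ_pt a' b' \<theta> \<in> B} = (\<lambda>x. \<phi> + x) -` (?P \<inter> {\<phi>..<\<phi> + 2*pi})"
      using r by auto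
    then have "emeasure lborel {\<theta> \<in> {0..<2*pi}. circ_pt a' b' \<theta> \<in> B} = period_len ?P \<phi>"
      unfolding period_len_def using P by (simp only:) (rule emeasure_lborel_shift, auto)
    then show ?thesis using shift by simp
  next
    assume r: "\<forall>\<theta>. circ_pt a' b' \<theta> = circ_pt a b (\<phi> - \<theta>)"
    \<comment> \<open>A reflection turns the half-open window round: it becomes closed on the right.
      A shift by one period moves it to \<open>{\<phi><..\<phi> + 2 * pi}\<close>, which differs
      from the wanted window in two points only.\<close>
    let ?Q = "?P \<inter> {\<phi> - 2 * pi<..\<phi>}"
    have "{\<theta> \<in> {0..<2*pi}. circ_pt a' b' \<theta> \<in> B} = (\<lambda>x. - x) -` ((\<lambda>x. \<phi> + x) -` ?Q)"
      using r by auto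
    then have "emeasure lborel {\<theta> \<in> {0..<2*pi}. circ_pt a' b' \<theta> \<in> B}
        = emeasure lborel ((\<lambda>x. - x) -` ((\<lambda>x. \<phi> + x) -` ?Q))" by simp
    also have "\<dots> = emeasure lborel ((\<lambda>x. \<phi> + x) -` ?Q)"
      using P by (intro emeasure_lborel_reflect measurable_sets_borel[of "\<lambda>x. \<phi> + x" borel]) simp_all
    also have "\<dots> = emeasure lborel ?Q" using P by (intro emeasure_lborel_shift) auto
    also have "\<dots> = emeasure lborel ((\<lambda>x. - (2*pi) + x) -` ?Q)"
      using P by (intro emeasure_lborel_shift[symmetric]) auto
    also have "(\<lambda>x. - (2*pi) + x) -` ?Q = ?P \<inter> {\<phi><..\<phi> + 2 * pi}"
      using circ_pt_periodic(2)[of a b] by auto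
    also have "emeasure lborel \<dots> = period_len ?P \<phi>"
      unfolding period_len_def
    proof (rule emeasure_eq_AE)
      have "AE x in lborel. x \<noteq> \<phi> \<and> x \<noteq> \<phi> + 2 * pi"
        using AE_lborel_singleton[of \<phi>] AE_lborel_singleton[of "\<phi> + 2*pi"] by eventually_elim auto
      then show "AE x in lborel. (x \<in> ?P \<inter> {\<phi><..\<phi> + 2 * pi}) = (x \<in> ?P \<inter> {\<phi>..<\<phi> + 2 * pi})"
        by eventually_elim auto
    qed (use P in auto)
    also have "\<dots> = period_len ?P 0" by (rule shift)
    finally show ?thesis .
  qed
  then show ?thesis using base by (simp add: frame_len_def)
qed

lemma circ_len_eq_frame_len:
  assumes f: "frame u a b" and B: "B \<in> sets borel"
  shows "circ_len (gcirc u) B = frame_len a b B"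
proof -
  let ?P = "\<lambda>p. case p of (a, b) \<Rightarrow> orthonormal2 a b \<and> gcirc u = circ_pt a b ` {0..<2*pi}"
  obtain a' b' where ab: "(SOME p. ?P p) = (a', b')" by (meson surj_pair)
  have "?P (SOME p. ?P p)"
    by (rule someI[of _ "(a, b)"]) (use f gcirc_frame[OF f] in \<open>auto simp: frame_def\<close>)
  then have f': "frame u a' b'"
    using ab f by (intro frame_of_image) (auto simp: frame_def)
  have "circ_len (gcirc u) B = frame_len a' b' B"
    unfolding circ_len_def frame_len_def using ab by simp
  also have "\<dots> = frame_len a b B" by (rule frame_len_unique[OF f f' B])
  finally show ?thesis .
qed

text \<open>Normalised length as a probability measure: statements that hold off finitely many
  points become AE statements, and counting arguments become integrals.\<close>

definition circ_measure :: "pt \<Rightarrow> pt measure" where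
  "circ_measure u = (let (a, b) = (SOME (a, b). frame u a b)
     in distr (uniform_measure lborel {0..<2*pi}) borel (circ_pt a b))"

lemma circ_measure_frame:
  assumes "norm u = 1"
  obtains a b where "frame u a b"
    "circ_measure u = distr (uniform_measure lborel {0..<2*pi}) borel (circ_pt a b)"
proof -
  obtain a b where f: "frame u a b" using frame_exists[OF assms] .
  obtain a' b' where ab: "(SOME (a, b). frame u a b) = (a', b')" by (meson surj_pair)
  have "case (SOME (a, b). frame u a b) of (a, b) \<Rightarrow> frame u a b"
    by (rule someI[of _ "(a, b)"]) (use f in simp)
  with ab that[of a' b'] show thesis by (simp add: circ_measure_def)
qed

lemma sets_circ_measure [measurable_cong, simp]: "norm u = 1 \<Longrightarrow> sets (circ_measure u) = sets borel"
  using circ_measure_frame by (metis sets_distr)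

lemma space_circ_measure [simp]: "norm u = 1 \<Longrightarrow> space (circ_measure u) = UNIV"
  using circ_measure_frame by (metis space_distr space_borel)

lemma circ_len_eq_emeasure:
  assumes u: "norm u = 1" and B [measurable]: "B \<in> sets borel"
  shows "circ_len (gcirc u) B = emeasure (circ_measure u) B"
proof -
  obtain a b where f: "frame u a b"
    "circ_measure u = distr (uniform_measure lborel {0..<2*pi}) borel (circ_pt a b)"
    using circ_measure_frame[OF u] .
  have "circ_pt a b -` B \<in> sets borel" using measurable_sets[OF measurable_circ_pt B, of a b] by simp
  moreover have "{\<theta> \<in> {0..<2*pi}. circ_pt a b \<theta> \<in> B} = {0..<2*pi} \<inter> circ_pt a b -` B" by auto
  ultimately show ?thesis using f
    by (simp add: circ_len_eq_frame_len[OF f(1) B] frame_len_def emeasure_distr)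
qed

lemma prob_space_circ_measure: "norm u = 1 \<Longrightarrow> emeasure (circ_measure u) UNIV = 1"
proof -
  assume u: "norm u = 1"
  obtain a b where f: "frame u a b" using frame_exists[OF u] .
  have "{\<theta> \<in> {0..<2*pi}. circ_pt a b \<theta> \<in> UNIV} = {0..<2*pi}" by auto
  then have "frame_len a b UNIV = ennreal (2*pi) / ennreal (2*pi)"
    by (simp add: frame_len_def)
  also have "\<dots> = 1" by (subst divide_ennreal) auto
  finally show ?thesis
    using circ_len_eq_emeasure[OF u, of UNIV] circ_len_eq_frame_len[OF f, of UNIV] by simp
qed

lemma AE_circ_measure_iff:
  assumes "frame u a b" "circ_measure u = distr (uniform_measure lborel {0..<2*pi}) borel (circ_pt a b)"
    "{x. P x} \<in> sets borel"
  shows "(AE x in circ_measure u. P x) \<longleftrightarrow> (AE \<theta> in lborel. \<theta> \<in> {0..<2*pi} \<longrightarrow> P (circ_pt a b \<theta>))"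
  unfolding assms(2) using assms(3)
  by (subst AE_distr_iff) (auto simp: AE_uniform_measure)

lemma closed_gcirc: "closed (gcirc u)"
proof -
  have "gcirc u = sphere 0 1 \<inter> {x. u \<bullet> x = 0}" by (auto simp: gcirc_def S2_def)
  then show ?thesis by (auto intro: closed_hyperplane)
qed

lemma AE_circ_measure_gcirc:
  assumes u: "norm u = 1"
  shows "AE x in circ_measure u. x \<in> gcirc u"
proof -
  obtain a b where f: "frame u a b"
    "circ_measure u = distr (uniform_measure lborel {0..<2*pi}) borel (circ_pt a b)"
    using circ_measure_frame[OF u] .
  show ?thesis
    using gcirc_frame_range[OF f(1)] closed_gcirc[of u]
    by (subst AE_circ_measure_iff[OF f]) auto
qed

lemma AE_circ_measure_notin_finite:
  assumes u: "norm u = 1" and F: "finite F"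
  shows "AE x in circ_measure u. x \<notin> F"
proof -
  obtain a b where f: "frame u a b"
    "circ_measure u = distr (uniform_measure lborel {0..<2*pi}) borel (circ_pt a b)"
    using circ_measure_frame[OF u] .
  have "inj_on (circ_pt a b) {0..<2*pi}"
    using f(1) by (intro inj_on_circ_pt) (auto simp: frame_def)
  then have fin: "finite ({0..<2*pi} \<inter> circ_pt a b -` F)"
    using F by (metis finite_vimage_IntI Int_commute)
  have "AE \<theta> in lborel. \<theta> \<notin> {0..<2*pi} \<inter> circ_pt a b -` F"
    using fin borel_closed[OF finite_imp_closed[OF fin]]
    by (intro AE_not_in null_setsI emeasure_lborel_countable countable_finite) auto
  then show ?thesis
    using borel_comp[OF borel_closed[OF finite_imp_closed[OF F]]]
    by (subst AE_circ_measure_iff[OF f]) (auto simp: Compl_eq elim!: eventually_mono)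
qed

lemma emeasure_circ_measure_finite:
  assumes "norm u = 1" "finite F"
  shows "emeasure (circ_measure u) F = 0"
  using AE_circ_measure_notin_finite[OF assms] assms borel_closed[OF finite_imp_closed[OF assms(2)]]
  by (subst AE_iff_measurable[where N = F, symmetric]) auto

lemma gcirc_Int_finite:
  assumes "norm u = 1" "\<forall>x. u \<bullet> x = 0 \<longrightarrow> v \<bullet> x = 0 \<longrightarrow> x \<in> span {w}"
  shows "finite (gcirc u \<inter> gcirc v)"
proof -
  have "gcirc u \<inter> gcirc v \<subseteq> {sgn w, - sgn w}"
  proof
    fix x assume "x \<in> gcirc u \<inter> gcirc v"
    then have "norm x = 1" "x \<in> span {w}" using assms by (auto simp: gcirc_def S2_def)
    then obtain c where "x = c *\<^sub>R w" by (auto simp: span_singleton)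
    with \<open>norm x = 1\<close> have c: "x = c *\<^sub>R w" "\<bar>c\<bar> * norm w = 1" by auto
    then have "w \<noteq> 0" by auto
    then have "c = 1 / norm w \<or> c = - (1 / norm w)" using c(2) by (auto simp: field_simps abs_if split: if_splits)
    then show "x \<in> {sgn w, - sgn w}" using c(1) by (auto simp: sgn_div_norm divide_inverse)
  qed
  then show ?thesis by (rule finite_subset) auto
qed

text \<open>Parallel unit normals agree up to sign; otherwise every common point lies on the line
  spanned by the cross product, which meets the sphere in an antipodal pair.\<close>

lemma gcirc_eq_or_finite:
  assumes u: "norm u = 1" and v: "norm v = 1"
  shows "gcirc u = gcirc v \<or> finite (gcirc u \<inter> gcirc v)"
proof (cases "cross3 u v = 0")
  case True
  then have "cross3 v (cross3 u v) = 0" by simp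
  then have "u = (v \<bullet> u) *\<^sub>R v" using v by (simp add: Lagrange norm_eq_1)
  moreover then have "\<bar>v \<bullet> u\<bar> = 1" using u v by (metis mult.right_neutral norm_scaleR)
  ultimately have "u = v \<or> u = - v" by (smt (verit) scaleR_minus_left scaleR_one)
  then show ?thesis by (auto simp: gcirc_def)
next
  case False
  let ?w = "cross3 u v"
  have "x \<in> span {?w}" if "u \<bullet> x = 0" "v \<bullet> x = 0" for x
  proof -
    have "triple u v ?w = ?w \<bullet> ?w"
      using triple_cyc[of u v ?w] triple_cyc[of v ?w u] by (simp add: triple_def)
    then have "triple u v ?w \<noteq> 0" using False by simp
    from triple_dual[of u v ?w x] that have "triple u v ?w *\<^sub>R x = (?w \<bullet> x) *\<^sub>R ?w" by simp
    then have "x = ((?w \<bullet> x) / triple u v ?w) *\<^sub>R ?w"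
      using \<open>triple u v ?w \<noteq> 0\<close> by (simp add: eq_vector_fraction_iff)
    then show ?thesis by (metis span_base insertI1 span_scale)
  qed
  then show ?thesis using gcirc_Int_finite[OF u, of v ?w] by blast
qed

text \<open>Double counting: integrating the number of sets that cover a point turns an almost-sure
  multiplicity into a length identity. The multiplicity will be 2 for boundaries and 1 for edges and
  for cells.\<close>

lemma sum_emeasure_AE_indicator:
  assumes "finite I" "\<And>i. i \<in> I \<Longrightarrow> A i \<in> sets M" "B \<in> sets M"
    "AE x in M. (\<Sum>i\<in>I. indicator (A i) x) = (c::ennreal) * indicator B x"
  shows "(\<Sum>i\<in>I. emeasure M (A i)) = c * emeasure M B"
proof -
  have "(\<Sum>i\<in>I. emeasure M (A i)) = (\<Sum>i\<in>I. \<integral>\<^sup>+x. indicator (A i) x \<partial>M)"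
    using assms by (intro sum.cong) auto
  also have "\<dots> = (\<integral>\<^sup>+x. (\<Sum>i\<in>I. indicator (A i) x) \<partial>M)"
    using assms by (subst nn_integral_sum) auto
  also have "\<dots> = (\<integral>\<^sup>+x. c * indicator B x \<partial>M)" by (rule nn_integral_cong_AE[OF assms(4)])
  also have "\<dots> = c * emeasure M B" using assms(3) by (simp add: nn_integral_cmult_indicator)
  finally show ?thesis .
qed

text \<open>Any great circle outside the family meets \<open>B\<close> in finitely many points and
  so contributes 0 to the infinite sum. Injectivity keeps a circle from being counted twice.\<close>

lemma sigma1_finite_circles:
  assumes I: "finite I" and n: "\<And>i. i \<in> I \<Longrightarrow> norm (v i) = 1"
    and inj: "inj_on (\<lambda>i. gcirc (v i)) I"
    and B: "B \<in> sets borel" "B \<subseteq> (\<Union>i\<in>I. gcirc (v i))"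
  shows "sigma1 B = (\<Sum>i\<in>I. emeasure (circ_measure (v i)) B)"
proof -
  let ?G = "(\<lambda>i. gcirc (v i)) ` I"
  have zero: "circ_len C B = 0" if "C \<in> great_circles - ?G" for C
  proof -
    have C: "C \<in> great_circles" "C \<notin> ?G" using DiffD1[OF that] DiffD2[OF that] by auto
    from C(1) obtain u where u: "norm u = 1" "C = gcirc u" unfolding great_circles_def by auto
    have "finite (gcirc u \<inter> gcirc (v i))" if "i \<in> I" for i
      using gcirc_eq_or_finite[OF u(1) n[OF that]] u C(2) that by (metis image_eqI)
    then have "finite (\<Union>i\<in>I. gcirc u \<inter> gcirc (v i))" using I by (intro finite_UN_I)
    then have fin: "finite (gcirc u \<inter> B)" by (rule rev_finite_subset) (use B in auto)
    have "emeasure (circ_measure u) B = emeasure (circ_measure u) (gcirc u \<inter> B)"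
      using u B closed_gcirc[of u] AE_circ_measure_gcirc[OF u(1)]
      by (intro emeasure_eq_AE) (auto elim!: eventually_mono)
    then show ?thesis using emeasure_circ_measure_finite[OF u(1) fin] u B
      by (simp add: circ_len_eq_emeasure)
  qed
  have "sigma1 B = (\<Sum>\<^sub>\<infinity>C\<in>?G. circ_len C B)"
    unfolding sigma1_def using zero n by (intro infsum_cong_neutral) (auto simp: great_circles_def)
  also have "\<dots> = (\<Sum>C\<in>?G. circ_len C B)" using I by simp
  also have "\<dots> = (\<Sum>i\<in>I. circ_len (gcirc (v i)) B)" by (subst sum.reindex[OF inj]) simp
  also have "\<dots> = (\<Sum>i\<in>I. emeasure (circ_measure (v i)) B)"
    using n B by (intro sum.cong) (auto simp: circ_len_eq_emeasure)
  finally show ?thesis .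
qed

section \<open>The uniform distribution of the normals\<close>

lemma sets_sigma2 [measurable_cong, simp]: "sets sigma2 = sets borel"
  by (simp add: sigma2_def)

lemma space_sigma2 [simp]: "space sigma2 = UNIV"
  by (simp add: sigma2_def)

lemma measurable_sgn_pt [measurable]: "(sgn :: pt \<Rightarrow> pt) \<in> borel_measurable borel"
  unfolding sgn_div_norm[abs_def] by measurable

lemma emeasure_cball_pt: "emeasure lborel (cball 0 1 :: pt set) \<noteq> 0" "emeasure lborel (cball 0 1 :: pt set) \<noteq> \<infinity>"
  using emeasure_lborel_cball_finite[of "0::pt" 1] content_cball_pos[of 1 "0::pt"]
  by (auto simp: measure_def)

lemma prob_space_sigma2: "emeasure sigma2 UNIV = 1"
  using emeasure_cball_pt by (simp add: sigma2_def emeasure_distr ennreal_divide_self less_top)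

lemma AE_sigma2_iff:
  assumes "{u. P u} \<in> sets borel"
  shows "(AE u in sigma2. P u) \<longleftrightarrow> (AE x in lborel. x \<in> cball 0 1 \<longrightarrow> P (sgn x))"
proof -
  have "emeasure lborel (cball 0 1 :: pt set) < \<infinity>" by (rule emeasure_lborel_cball_finite)
  from AE_uniform_measure[OF emeasure_cball_pt(1) this] show ?thesis
    unfolding sigma2_def using assms by (subst AE_distr_iff) auto
qed

lemma AE_sigma2_norm: "AE u in sigma2. norm u = 1"
proof (subst AE_sigma2_iff)
  show "AE x in lborel. x \<in> cball 0 1 \<longrightarrow> norm (sgn x :: pt) = 1"
    using AE_lborel_singleton[of "0::pt"] by eventually_elim (auto simp: norm_sgn)
qed measurable

text \<open>\<open>sigma2\<close> is a radial projection, and the plane orthogonal to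
  \<open>m\<close> is a Lebesgue null set invariant under scaling. With \<open>m\<close> the cross
  product of two normals, this makes a random circle miss the crossing points of their
  circles.\<close>

lemma AE_sigma2_inner_nonzero:
  assumes "m \<noteq> 0"
  shows "AE u in sigma2. u \<bullet> m \<noteq> 0"
proof (subst AE_sigma2_iff)
  have "{x. m \<bullet> x = 0} \<in> null_sets lborel"
    using negligible_hyperplane[of m 0] assms
    by (simp add: negligible_iff_null_sets null_sets_completion_iff closed_hyperplane borel_closed)
  then have "AE x in lborel. x \<notin> {x. m \<bullet> x = 0}" by (rule AE_not_in)
  then show "AE x in lborel. x \<in> cball 0 1 \<longrightarrow> sgn x \<bullet> m \<noteq> 0"
    by eventually_elim (auto simp: sgn_div_norm inner_commute)
qed measurable

section \<open>Tessellations in general position\<close>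

text \<open>Along the circle each linear form is a positive multiple of a shifted cosine, hence
  nonnegative exactly on a half-circle around its peak. All these half-circles contain the angle 0
  in their interior, so they intersect in one arc, from the largest left end to the smallest right
  end.\<close>

lemma arc_of_halfspaces:
  assumes fin: "finite A" and ne: "A \<noteq> {}" and pos: "\<And>a. a \<in> A \<Longrightarrow> 0 < n a \<bullet> x"
  obtains al be where "- pi < al" "al < 0" "0 < be" "be < pi"
    "\<forall>\<theta>\<in>{-pi..pi}. (\<forall>a\<in>A. 0 \<le> n a \<bullet> circ_pt x y \<theta>) \<longleftrightarrow> al \<le> \<theta> \<and> \<theta> \<le> be"
    "\<exists>a\<in>A. n a \<bullet> circ_pt x y al = 0" "\<exists>a\<in>A. n a \<bullet> circ_pt x y be = 0"
proof -
  \<comment> \<open>The angle at which the form peaks; positivity at \<open>x\<close> is what puts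
    the peak within \<open>pi/2\<close> of 0.\<close>
  define \<phi> where "\<phi> a = arctan ((n a \<bullet> y) / (n a \<bullet> x))" for a
  have b: "- (pi/2) < \<phi> a" "\<phi> a < pi/2" for a using arctan_bounded by (auto simp: \<phi>_def)
  have R: "n a \<bullet> circ_pt x y \<theta> = (n a \<bullet> x) / cos (\<phi> a) * cos (\<theta> - \<phi> a)" if "a \<in> A" for a \<theta>
  proof -
    have "cos (\<phi> a) > 0" using b by (intro cos_gt_zero_pi) auto
    moreover have "tan (\<phi> a) = (n a \<bullet> y) / (n a \<bullet> x)" by (simp add: \<phi>_def tan_arctan)
    ultimately have "(n a \<bullet> y) * cos (\<phi> a) = (n a \<bullet> x) * sin (\<phi> a)"
      using pos[OF that] by (simp add: tan_def field_simps)
    then show ?thesis using \<open>cos (\<phi> a) > 0\<close>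
      by (simp add: inner_circ_pt cos_diff field_simps)
  qed
  have Rpos: "(n a \<bullet> x) / cos (\<phi> a) > 0" if "a \<in> A" for a
    using pos[OF that] b[of a] by (intro divide_pos_pos cos_gt_zero_pi) auto
  have sgn_iff: "0 \<le> n a \<bullet> circ_pt x y \<theta> \<longleftrightarrow> \<phi> a - pi/2 \<le> \<theta> \<and> \<theta> \<le> \<phi> a + pi/2"
    if "a \<in> A" "\<theta> \<in> {-pi..pi}" for a \<theta>
  proof -
    have "0 \<le> n a \<bullet> circ_pt x y \<theta> \<longleftrightarrow> 0 \<le> cos (\<theta> - \<phi> a)"
      using Rpos[OF that(1)] unfolding R[OF that(1)] by (simp only: zero_le_mult_iff) auto
    also have "\<dots> \<longleftrightarrow> \<phi> a - pi/2 \<le> \<theta> \<and> \<theta> \<le> \<phi> a + pi/2"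
    proof
      assume l: "0 \<le> cos (\<theta> - \<phi> a)"
      show "\<phi> a - pi/2 \<le> \<theta> \<and> \<theta> \<le> \<phi> a + pi/2"
      proof (rule ccontr)
        assume "\<not> ?thesis"
        \<comment> \<open>Outside the half-circle the distance to the peak lies between
          \<open>pi/2\<close> and \<open>3 * pi/2\<close>; subtracting \<open>pi\<close> brings it
          into the range where the cosine is positive.\<close>
        then have "cos (\<bar>\<theta> - \<phi> a\<bar> - pi) > 0"
          using b[of a] that(2) by (intro cos_gt_zero_pi) auto
        then have "cos \<bar>\<theta> - \<phi> a\<bar> < 0" by (simp add: cos_diff)
        with l show False by simp
      qed
    qed (intro cos_ge_zero, auto)
    finally show ?thesis .
  qed
  define al where "al = Max ((\<lambda>a. \<phi> a - pi/2) ` A)"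
  define be where "be = Min ((\<lambda>a. \<phi> a + pi/2) ` A)"
  have "al \<in> (\<lambda>a. \<phi> a - pi/2) ` A" unfolding al_def using fin ne by (intro Max_in) auto
  then obtain a1 where a1: "a1 \<in> A" "al = \<phi> a1 - pi/2" by auto
  have "be \<in> (\<lambda>a. \<phi> a + pi/2) ` A" unfolding be_def using fin ne by (intro Min_in) auto
  then obtain a2 where a2: "a2 \<in> A" "be = \<phi> a2 + pi/2" by auto
  show thesis
  proof
    show "- pi < al" "al < 0" "0 < be" "be < pi" using a1 a2 b[of a1] b[of a2] by auto
    show "\<forall>\<theta>\<in>{-pi..pi}. (\<forall>a\<in>A. 0 \<le> n a \<bullet> circ_pt x y \<theta>) \<longleftrightarrow> al \<le> \<theta> \<and> \<theta> \<le> be"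
    proof
      fix \<theta> :: real assume "\<theta> \<in> {-pi..pi}"
      from sgn_iff[OF _ this] fin ne show "(\<forall>a\<in>A. 0 \<le> n a \<bullet> circ_pt x y \<theta>) \<longleftrightarrow> al \<le> \<theta> \<and> \<theta> \<le> be"
        by (simp add: al_def be_def) blast
    qed
    show "\<exists>a\<in>A. n a \<bullet> circ_pt x y al = 0" "\<exists>a\<in>A. n a \<bullet> circ_pt x y be = 0"
      using a1 a2 R by force+
  qed
qed

section \<open>Codes for cells and the invariants of a reachable state\<close>

definition normal :: "(nat \<Rightarrow> pt) \<Rightarrow> nat \<times> bool \<Rightarrow> pt" where
  "normal w a = (if snd a then w (fst a) else - w (fst a))"

text \<open>A cone rather than a spherical set, so that points may be perturbed along straight lines
  without renormalising.\<close>

definition hcone :: "(nat \<Rightarrow> pt) \<Rightarrow> (nat \<times> bool) set \<Rightarrow> pt set" where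
  "hcone w c = {x. \<forall>a\<in>c. 0 \<le> normal w a \<bullet> x}"

definition cell :: "(nat \<Rightarrow> pt) \<Rightarrow> (nat \<times> bool) set \<Rightarrow> pt set" where
  "cell w c = S2 \<inter> hcone w c"

definition tess :: "(nat \<Rightarrow> pt) \<Rightarrow> (nat \<times> bool) set set \<Rightarrow> tess" where
  "tess w D = cell w ` D"

definition flip :: "nat \<times> bool \<Rightarrow> nat \<times> bool" where "flip a = (fst a, \<not> snd a)"

text \<open>In a reachable state with \<open>i\<close> at least 3 this is the segment drawn by the
  split that introduced \<open>w i\<close>; a later split of an adjacent cell does not change it,
  because both halves keep the index \<open>i\<close> in their codes. For \<open>i = 2\<close> it is
  the equator.\<close>

definition chord :: "(nat \<Rightarrow> pt) \<Rightarrow> (nat \<times> bool) set set \<Rightarrow> nat \<Rightarrow> pt set" where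
  "chord w D i = (\<Union>c\<in>{c\<in>D. i \<in> fst ` c}. cell w c \<inter> gcirc (w i))"

lemma normal_flip [simp]: "normal w (flip a) = - normal w a"
  by (simp add: normal_def flip_def)

lemma normal_eq_0_iff [simp]: "normal w a \<bullet> x = 0 \<longleftrightarrow> w (fst a) \<bullet> x = 0"
  by (simp add: normal_def)

lemma eq_or_eq_flip: "fst a = fst b \<Longrightarrow> a = b \<or> a = flip b"
  by (cases a; cases b) (auto simp: flip_def)

lemma flip_simps [simp]: "flip (flip a) = a" "fst (flip a) = fst a" "flip a \<noteq> a"
  by (auto simp: flip_def prod_eq_iff)

lemma closed_hcone: "closed (hcone w c)"
proof -
  have "hcone w c = (\<Inter>a\<in>c. {x. 0 \<le> normal w a \<bullet> x})" by (auto simp: hcone_def)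
  then show ?thesis by (auto intro!: closed_INT simp: closed_halfspace_ge)
qed

lemma compact_cell: "compact (cell w c)"
  by (simp add: cell_def S2_def closed_hcone compact_Int_closed)

lemma borel_cell [measurable]: "cell w c \<in> sets borel"
  by (simp add: compact_cell borel_compact)

lemma borel_gcirc [measurable]: "gcirc u \<in> sets borel"
  by (simp add: closed_gcirc borel_closed)

text \<open>A cell is coded by a set of pairs of the index of a normal and the side of its circle. The
  normals 0 and 1 bound no cell; they ensure that there are always three independent normals.\<close>

locale good =
  fixes w :: "nat \<Rightarrow> pt" and k :: nat and D :: "(nat \<times> bool) set set"
  assumes k_ge: "3 \<le> k"
    and base: "w 0 = axis 1 1" "w 1 = axis 2 1" "w 2 = north"
    and nrm: "\<And>i. i < k \<Longrightarrow> norm (w i) = 1"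
    and gp: "\<And>i j l. i < k \<Longrightarrow> j < k \<Longrightarrow> l < k \<Longrightarrow> i \<noteq> j \<Longrightarrow> i \<noteq> l \<Longrightarrow> j \<noteq> l \<Longrightarrow>
               triple (w i) (w j) (w l) \<noteq> 0"
    and fin: "finite D"
    and codes: "\<And>c. c \<in> D \<Longrightarrow> fst ` c \<subseteq> {2..<k}"
    and eq_code: "\<And>c. c \<in> D \<Longrightarrow> 2 \<in> fst ` c"
    and strict: "\<And>c. c \<in> D \<Longrightarrow> \<exists>q. \<forall>a\<in>c. 0 < normal w a \<bullet> q"
    and cover: "\<And>x. \<exists>c\<in>D. x \<in> hcone w c"
    and sep: "\<And>c c'. c \<in> D \<Longrightarrow> c' \<in> D \<Longrightarrow> c \<noteq> c' \<Longrightarrow> \<exists>a\<in>c. flip a \<in> c'"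
    and seg: "\<And>i. 3 \<le> i \<Longrightarrow> i < k \<Longrightarrow> is_segment (chord w D i)"
    and card_D: "card D = k - 1"
begin

lemma third_index:
  assumes "i < k" "j < k"
  obtains l where "l < k" "l \<noteq> i" "l \<noteq> j"
proof -
  have "card {i, j} < card {..<k}" using k_ge by (simp add: card_insert_if)
  then have "\<not> {..<k} \<subseteq> {i, j}" by (meson card_mono finite.emptyI finite.insertI not_le)
  with that show thesis by auto
qed

lemma three_zero:
  assumes "i < k" "j < k" "l < k" "i \<noteq> j" "i \<noteq> l" "j \<noteq> l"
    "w i \<bullet> x = 0" "w j \<bullet> x = 0" "w l \<bullet> x = 0"
  shows "x = 0"
  using orthogonal_triple_eq_0[OF gp] assms by blast

lemma dual2:
  assumes "i < k" "j < k" "i \<noteq> j"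
  obtains d where "w i \<bullet> d = \<alpha>" "w j \<bullet> d = \<beta>"
proof -
  obtain l where l: "l < k" "l \<noteq> i" "l \<noteq> j" using third_index[OF assms(1,2)] .
  have "triple (w i) (w j) (w l) \<noteq> 0" using assms l by (intro gp) auto
  from triple_inner_surj[OF this] that show thesis by metis
qed

lemma gcirc_ne:
  assumes "i < k" "j < k" "i \<noteq> j"
  shows "gcirc (w i) \<noteq> gcirc (w j)"
proof -
  obtain d where d: "w i \<bullet> d = 0" "w j \<bullet> d = 1" using dual2[OF assms] .
  then have "d \<noteq> 0" by auto
  with d have "sgn d \<in> gcirc (w i) - gcirc (w j)"
    by (auto simp: gcirc_def S2_def norm_sgn sgn_div_norm)
  then show ?thesis by blast
qed

lemma gcirc_inter_finite:
  assumes "i < k" "j < k" "i \<noteq> j"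
  shows "finite (gcirc (w i) \<inter> gcirc (w j))"
  using gcirc_eq_or_finite[OF nrm nrm] gcirc_ne assms by blast

definition crossings :: "pt set" where
  "crossings = (\<Union>i\<in>{..<k}. \<Union>j\<in>{..<k} - {i}. gcirc (w i) \<inter> gcirc (w j))"

lemma finite_crossings: "finite crossings"
  unfolding crossings_def using gcirc_inter_finite by (intro finite_UN_I) auto

lemma crossingsI:
  assumes "i < k" "j < k" "i \<noteq> j" "w i \<bullet> x = 0" "w j \<bullet> x = 0" "norm x = 1"
  shows "x \<in> crossings"
  using assms unfolding crossings_def gcirc_def S2_def by auto

lemma finite_code: "c \<in> D \<Longrightarrow> finite c"
  using codes finite_subset[of c "{2..<k} \<times> UNIV"] by force

lemma index_lt: "c \<in> D \<Longrightarrow> a \<in> c \<Longrightarrow> fst a < k \<and> 2 \<le> fst a"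
  using codes by force

lemma norm_normal: "c \<in> D \<Longrightarrow> a \<in> c \<Longrightarrow> norm (normal w a) = 1"
  using nrm index_lt by (auto simp: normal_def)

lemma not_flip: "c \<in> D \<Longrightarrow> a \<in> c \<Longrightarrow> flip a \<notin> c"
  using strict[of c] normal_flip[of w a] by (metis inner_minus_left less_asym neg_0_less_iff_less)

lemma code_index_unique: "c \<in> D \<Longrightarrow> a \<in> c \<Longrightarrow> b \<in> c \<Longrightarrow> fst a = fst b \<Longrightarrow> a = b"
  using not_flip eq_or_eq_flip by blast

lemma strict_cell:
  assumes "c \<in> D"
  obtains q where "q \<in> S2" "\<And>a. a \<in> c \<Longrightarrow> 0 < normal w a \<bullet> q"
proof -
  obtain q where q: "\<forall>a\<in>c. 0 < normal w a \<bullet> q" using strict[OF assms] by blast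
  have "q \<noteq> 0" using q eq_code[OF assms] by fastforce
  with q that[of "sgn q"] show thesis
    by (auto simp: S2_def norm_sgn sgn_div_norm)
qed

text \<open>A strict point of \<open>c\<close> would lie in the cell of \<open>c'\<close>, on the
  wrong side of a separating circle. Injectivity allows sums over cells to be taken over
  codes.\<close>

lemma inj_cell: "inj_on (cell w) D"
proof (rule inj_onI, rule ccontr)
  fix c c' assume c: "c \<in> D" "c' \<in> D" "cell w c = cell w c'" "c \<noteq> c'"
  obtain a where a: "a \<in> c" "flip a \<in> c'" using sep c by blast
  obtain q where q: "q \<in> S2" "\<And>a. a \<in> c \<Longrightarrow> 0 < normal w a \<bullet> q" using strict_cell[OF c(1)] by blast
  then have "q \<in> cell w c" by (auto simp: cell_def hcone_def less_imp_le)
  then have "q \<in> cell w c'" using c(3) by simp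
  then have "0 \<le> normal w (flip a) \<bullet> q" using a(2) unfolding cell_def hcone_def by blast
  with q(2)[OF a(1)] show False by simp
qed

text \<open>Of the \<open>k\<close> normals two are auxiliary axes, one is that of the equator and
  the other \<open>k - 3\<close> stem from splits, each of which adds one cell to the initial
  two.\<close>

lemma card_tess: "card (tess w D) = k - 1"
  by (simp add: tess_def card_image[OF inj_cell] card_D)

text \<open>The separation \<open>sep\<close> is purely combinatorial; a point common to both cones
  satisfies two opposite weak inequalities, hence an equality.\<close>

lemma sep_zero:
  assumes "c \<in> D" "c' \<in> D" "c \<noteq> c'" "x \<in> hcone w c" "x \<in> hcone w c'"
  obtains a where "a \<in> c" "flip a \<in> c'" "w (fst a) \<bullet> x = 0"
proof -
  obtain a where a: "a \<in> c" "flip a \<in> c'" using sep assms by blast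
  then have "0 \<le> normal w a \<bullet> x" "0 \<le> normal w (flip a) \<bullet> x" using assms by (auto simp: hcone_def)
  then have "normal w a \<bullet> x = 0" by simp
  with a that show thesis by simp
qed

text \<open>Finitely many cones cover the ray from \<open>x\<close> in direction \<open>d\<close>,
  so one of them contains points of it arbitrarily close to \<open>x\<close> and, being closed,
  \<open>x\<close> as well. This selects a cell at \<open>x\<close> lying in a prescribed
  direction.\<close>

lemma local_cell:
  obtains c where "c \<in> D" "x \<in> hcone w c" "\<forall>e>0. \<exists>t. 0 < t \<and> t < e \<and> x + t *\<^sub>R d \<in> hcone w c"
proof -
  have "\<exists>c\<in>D. \<forall>e>0. \<exists>t. 0 < t \<and> t < e \<and> x + t *\<^sub>R d \<in> hcone w c"
  proof (rule ccontr)
    assume "\<not> ?thesis"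
    then have "\<forall>c\<in>D. \<exists>e>0. \<forall>t. 0 < t \<and> t < e \<longrightarrow> x + t *\<^sub>R d \<notin> hcone w c" by blast
    then obtain E where E: "\<And>c. c \<in> D \<Longrightarrow> E c > 0"
      "\<And>c t. c \<in> D \<Longrightarrow> 0 < t \<Longrightarrow> t < E c \<Longrightarrow> x + t *\<^sub>R d \<notin> hcone w c" by metis
    have ne: "D \<noteq> {}" using cover by blast
    define e where "e = Min (E ` D)"
    have "e > 0" "\<And>c. c \<in> D \<Longrightarrow> e \<le> E c" using fin ne E(1) by (auto simp: e_def)
    moreover obtain c where "c \<in> D" "x + (e/2) *\<^sub>R d \<in> hcone w c" using cover by blast
    ultimately show False using E(2)[of c "e/2"] by force
  qed
  then obtain c where c: "c \<in> D" "\<forall>e>0. \<exists>t. 0 < t \<and> t < e \<and> x + t *\<^sub>R d \<in> hcone w c" by blast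
  have "x \<in> closure (hcone w c)"
  proof (unfold closure_approachable, intro allI impI)
    fix e :: real assume "e > 0"
    then have "e / (norm d + 1) > 0" by (auto intro!: divide_pos_pos add_nonneg_pos)
    with c(2) obtain t where t: "0 < t" "t < e / (norm d + 1)" "x + t *\<^sub>R d \<in> hcone w c" by blast
    have "t * norm d \<le> t * (norm d + 1)" using t by simp
    also have "\<dots> < e" using t by (simp add: pos_less_divide_eq add_nonneg_pos)
    finally have "dist (x + t *\<^sub>R d) x < e" using t by (simp add: dist_norm)
    with t show "\<exists>y\<in>hcone w c. dist y x < e" by blast
  qed
  then have "x \<in> hcone w c" by (simp add: closed_hcone)
  with c that show thesis by blast
qed

text \<open>Two further cells are found by leaving \<open>x\<close> in the directions
  \<open>d\<close> and \<open>- d\<close>, where \<open>d\<close> points inward for \<open>a\<close>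
  and outward for \<open>b\<close>; neither is \<open>c\<close>. Were they the same cell, a circle
  separating it from \<open>c\<close> would pass through \<open>x\<close>, hence by general position
  be that of \<open>a\<close> or of \<open>b\<close>; but the cell along \<open>d\<close> omits
  \<open>flip a\<close> and the cell along \<open>- d\<close> omits \<open>flip b\<close>.\<close>

lemma corner_vertex:
  assumes c: "c \<in> D" and x: "x \<in> cell w c" and ab: "a \<in> c" "b \<in> c" "fst a \<noteq> fst b"
    and z: "w (fst a) \<bullet> x = 0" "w (fst b) \<bullet> x = 0"
  shows "x \<in> vertices (tess w D)"
proof -
  have xc: "x \<in> hcone w c" "norm x = 1" using x by (auto simp: cell_def S2_def)
  have lt: "fst a < k" "fst b < k" using index_lt c ab by auto
  obtain d where d: "w (fst a) \<bullet> d = (if snd a then 1 else -1)" "w (fst b) \<bullet> d = (if snd b then -1 else 1)"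
    using dual2[OF lt ab(3)] .
  have na: "normal w a \<bullet> d = 1" "normal w b \<bullet> d = -1" using d by (auto simp: normal_def)
  have nx: "normal w a \<bullet> x = 0" "normal w b \<bullet> x = 0" using z by auto
  obtain c1 where c1: "c1 \<in> D" "x \<in> hcone w c1" "\<forall>e>0. \<exists>t. 0 < t \<and> t < e \<and> x + t *\<^sub>R d \<in> hcone w c1"
    using local_cell[where x = x and d = d] .
  obtain c2 where c2: "c2 \<in> D" "x \<in> hcone w c2" "\<forall>e>0. \<exists>t. 0 < t \<and> t < e \<and> x + t *\<^sub>R (-d) \<in> hcone w c2"
    using local_cell[where x = x and d = "- d"] .
  obtain t1 where t1: "0 < t1" "x + t1 *\<^sub>R d \<in> hcone w c1" using spec[OF c1(3), of 1] by auto
  obtain t2 where t2: "0 < t2" "x + t2 *\<^sub>R (-d) \<in> hcone w c2" using spec[OF c2(3), of 1] by auto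
  have i1: "e \<in> c1 \<Longrightarrow> 0 \<le> normal w e \<bullet> x + t1 * (normal w e \<bullet> d)" for e
    using t1(2) by (simp add: hcone_def inner_add_right)
  have i2: "e \<in> c2 \<Longrightarrow> 0 \<le> normal w e \<bullet> x - t2 * (normal w e \<bullet> d)" for e
    using t2(2) by (auto simp: hcone_def inner_diff_right)
  have nb: "b \<notin> c1" "flip a \<notin> c1" using i1[of b] i1[of "flip a"] na nx t1 by auto
  have nb2: "a \<notin> c2" "flip b \<notin> c2" using i2[of a] i2[of "flip b"] na nx t2 by auto
  have "c1 \<noteq> c" "c2 \<noteq> c" using nb nb2 ab by auto
  moreover have "c1 \<noteq> c2"
  proof
    assume eq: "c1 = c2"
    obtain e where e: "e \<in> c" "flip e \<in> c1" "w (fst e) \<bullet> x = 0"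
      using sep_zero[OF c c1(1) _ xc(1) c1(2)] \<open>c1 \<noteq> c\<close> by blast
    have "fst e = fst a \<or> fst e = fst b"
      using three_zero[OF lt(1) lt(2), of "fst e" x] index_lt[OF c e(1)] ab(3) z e(3) xc(2) by fastforce
    then have "e = a \<or> e = b" using code_index_unique[OF c e(1)] ab by blast
    then show False using e(2) nb(2) nb2(2) eq by auto
  qed
  ultimately have "cell w c \<noteq> cell w c1" "cell w c \<noteq> cell w c2" "cell w c1 \<noteq> cell w c2"
    using inj_cell c c1(1) c2(1) by (auto dest: inj_onD)
  moreover have "x \<in> cell w c \<inter> cell w c1 \<inter> cell w c2" using x c1(2) c2(2) by (auto simp: cell_def)
  ultimately show ?thesis unfolding vertices_def tess_def using c c1(1) c2(1) by blast
qed

text \<open>Three cells at \<open>x\<close> are separated pairwise by circles through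
  \<open>x\<close>. A single circle cannot do this, since it has only two sides.\<close>

lemma vertices_crossings: "vertices (tess w D) \<subseteq> crossings"
proof
  fix x assume "x \<in> vertices (tess w D)"
  then obtain c1 c2 c3 where c: "c1 \<in> D" "c2 \<in> D" "c3 \<in> D" "c1 \<noteq> c2" "c1 \<noteq> c3" "c2 \<noteq> c3"
    "x \<in> cell w c1" "x \<in> cell w c2" "x \<in> cell w c3"
    unfolding vertices_def tess_def by blast
  then have x: "x \<in> hcone w c1" "x \<in> hcone w c2" "x \<in> hcone w c3" "norm x = 1" by (auto simp: cell_def S2_def)
  obtain a where a: "a \<in> c1" "flip a \<in> c2" "w (fst a) \<bullet> x = 0" using sep_zero[OF c(1,2,4) x(1,2)] .
  obtain b where b: "b \<in> c1" "flip b \<in> c3" "w (fst b) \<bullet> x = 0" using sep_zero[OF c(1,3,5) x(1,3)] .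
  obtain e where e: "e \<in> c2" "flip e \<in> c3" "w (fst e) \<bullet> x = 0" using sep_zero[OF c(2,3,6) x(2,3)] .
  show "x \<in> crossings"
  proof (cases "fst a = fst b \<and> fst a = fst e")
    case True
    then have "b = a" "e = flip a"
      using code_index_unique[OF c(1) a(1) b(1)] code_index_unique[OF c(2) a(2) e(1)] by auto
    then show ?thesis using b(2) e(2) not_flip[OF c(3), of a] by simp
  next
    case False
    then show ?thesis using crossingsI x(4) a b e index_lt c by metis
  qed
qed

lemma finite_vertices: "finite (vertices (tess w D))"
  using vertices_crossings finite_crossings finite_subset by blast

lemma sph_boundary_cell:
  assumes c: "c \<in> D"
  shows "sph_boundary (cell w c) = {x \<in> cell w c. \<exists>a\<in>c. w (fst a) \<bullet> x = 0}"
proof (intro equalityI subsetI)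
  fix x assume x: "x \<in> sph_boundary (cell w c)"
  then have xc: "x \<in> cell w c" by (auto simp: sph_boundary_def)
  show "x \<in> {x \<in> cell w c. \<exists>a\<in>c. w (fst a) \<bullet> x = 0}"
  proof (rule ccontr)
    assume "\<not> ?thesis"
    then have "\<forall>a\<in>c. normal w a \<bullet> x \<noteq> 0" using xc by auto
    then have pos: "\<forall>a\<in>c. 0 < normal w a \<bullet> x" using xc unfolding cell_def hcone_def by (simp add: order.order_iff_strict)
    let ?U = "\<Inter>a\<in>c. {y. 0 < normal w a \<bullet> y}"
    have "open ?U" using finite_code[OF c] by (intro open_INT) (auto simp: open_halfspace_gt)
    moreover have "x \<in> ?U" using pos by auto
    ultimately obtain e where e: "e > 0" "ball x e \<subseteq> ?U" by (meson open_contains_ball)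
    from x e(1) obtain y where y: "y \<in> S2" "y \<notin> cell w c" "dist x y < e" by (auto simp: sph_boundary_def)
    then have "y \<in> ?U" using e(2) by auto
    with y show False by (auto simp: cell_def hcone_def less_imp_le)
  qed
next
  fix x assume "x \<in> {x \<in> cell w c. \<exists>a\<in>c. w (fst a) \<bullet> x = 0}"
  then obtain a where a: "x \<in> cell w c" "a \<in> c" "normal w a \<bullet> x = 0" by auto
  let ?n = "normal w a"
  \<comment> \<open>Leaving \<open>x\<close> along the great circle towards \<open>- ?n\<close>
    exits the cell at once, since \<open>?n \<bullet> circ_pt x ?n (- t) = - sin t\<close>.\<close>
  have o: "orthonormal2 x ?n" using a norm_normal[OF c] by (auto simp: orthonormal2_def cell_def S2_def inner_commute)
  show "x \<in> sph_boundary (cell w c)"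
    unfolding sph_boundary_def
  proof (intro CollectI conjI allI impI a(1))
    fix e :: real assume e: "e > 0"
    have "isCont (circ_pt x ?n) 0" unfolding circ_pt_def by (intro continuous_intros)
    then obtain \<delta> where \<delta>: "\<delta> > 0" "\<And>t. dist t 0 < \<delta> \<Longrightarrow> dist (circ_pt x ?n t) (circ_pt x ?n 0) < e"
      using e unfolding continuous_at_eps_delta by (auto simp: dist_norm)
    define t where "t = min (\<delta>/2) 1"
    have t: "0 < t" "t < pi" "dist (-t) 0 < \<delta>" using \<delta>(1) pi_gt3 by (auto simp: t_def)
    have "dist x (circ_pt x ?n (-t)) < e" using \<delta>(2)[OF t(3)] by (simp add: circ_pt_def dist_commute)
    moreover have "circ_pt x ?n (-t) \<in> S2" using norm_circ_pt[OF o] by (simp add: S2_def)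
    moreover have "?n \<bullet> circ_pt x ?n (-t) < 0"
      using circ_pt_inner(2)[OF o, of "-t"] sin_gt_zero[OF t(1,2)] by simp
    then have "circ_pt x ?n (-t) \<notin> cell w c" using a(2) by (force simp: cell_def hcone_def)
    ultimately show "\<exists>y\<in>S2 - cell w c. dist x y < e" by blast
  qed
qed

lemma closed_boundary: "closed (sph_boundary (cell w c))" if "c \<in> D"
proof -
  have "sph_boundary (cell w c) = (\<Union>a\<in>c. cell w c \<inter> gcirc (w (fst a)))"
    unfolding sph_boundary_cell[OF that] by (auto simp: cell_def gcirc_def)
  then show ?thesis using finite_code[OF that]
    by (auto intro!: closed_UN closed_Int simp: closed_gcirc compact_cell compact_imp_closed)
qed

lemma generic_cells:
  assumes i: "i < k" and x: "x \<in> gcirc (w i)" "x \<notin> crossings"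
  shows "j < k \<Longrightarrow> w j \<bullet> x = 0 \<Longrightarrow> j = i"
  using crossingsI[of i j x] assms by (auto simp: gcirc_def S2_def)

text \<open>A step from \<open>x\<close> across the circle lands in a cell other than
  \<open>c\<close>; as no other circle passes through \<open>x\<close>, only circle \<open>i\<close>
  can separate the two.\<close>

lemma opposite_cell:
  assumes i: "i < k" and x: "x \<in> gcirc (w i)" "x \<notin> crossings"
    and c: "c \<in> D" "x \<in> cell w c" "a \<in> c" "fst a = i"
  obtains c' where "c' \<in> D" "x \<in> cell w c'" "flip a \<in> c'"
proof -
  obtain c' where c': "c' \<in> D" "x \<in> hcone w c'" "\<forall>e>0. \<exists>t. 0 < t \<and> t < e \<and> x + t *\<^sub>R (- normal w a) \<in> hcone w c'"
    using local_cell[where x = x and d = "- normal w a"] .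
  obtain t where t: "0 < t" "x + t *\<^sub>R (- normal w a) \<in> hcone w c'" using spec[OF c'(3), of 1] by auto
  have z: "normal w a \<bullet> x = 0" using x c by (auto simp: gcirc_def)
  have "normal w a \<bullet> (x + t *\<^sub>R (- normal w a)) = - t"
    using norm_normal[OF c(1,3)] unfolding norm_eq_1 by (simp only: z inner_add_right inner_scaleR_right inner_minus_right)
  then have "a \<notin> c'" using t unfolding hcone_def by force
  then have "c \<noteq> c'" using c by auto
  then obtain e where e: "e \<in> c" "flip e \<in> c'" "w (fst e) \<bullet> x = 0"
    using sep_zero[OF c(1) c'(1) _ _ c'(2)] c(2) by (auto simp: cell_def)
  then have "fst e = i" using generic_cells[OF i x] index_lt[OF c(1)] by blast
  then have "e = a" using code_index_unique[OF c(1)] e c by blast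
  with e c' c(2) that show thesis by (auto simp: cell_def)
qed

text \<open>At a generic point the side of circle \<open>i\<close> determines the cell, and both
  sides occur. This is the factor 2 in the boundary length.\<close>

lemma two_cells_at_generic:
  assumes i: "i < k" and x: "x \<in> gcirc (w i)" "x \<notin> crossings" "x \<in> chord w D i"
  shows "card {c \<in> D. x \<in> cell w c \<and> i \<in> fst ` c} = 2"
proof -
  obtain c a where c: "c \<in> D" "x \<in> cell w c" "a \<in> c" "fst a = i"
    using x(3) by (auto simp: chord_def)
  obtain c' where c': "c' \<in> D" "x \<in> cell w c'" "flip a \<in> c'" using opposite_cell[OF i x(1,2) c] .
  have uni: "e = e'" if h: "e \<in> D" "e' \<in> D" "x \<in> cell w e" "x \<in> cell w e'" "b \<in> e" "b \<in> e'" "fst b = i" for e e' b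
  proof (rule ccontr)
    assume "e \<noteq> e'"
    then obtain f where f: "f \<in> e" "flip f \<in> e'" "w (fst f) \<bullet> x = 0"
      using sep_zero[OF h(1,2), of x] h(3,4) unfolding cell_def by blast
    then have "fst f = i" using generic_cells[OF i x(1,2)] index_lt[OF h(1)] by blast
    then have "f = b" using code_index_unique[OF h(1)] f h by blast
    then show False using f h not_flip by blast
  qed
  have "{c \<in> D. x \<in> cell w c \<and> i \<in> fst ` c} = {c, c'}"
  proof (intro equalityI subsetI)
    fix e assume "e \<in> {c \<in> D. x \<in> cell w c \<and> i \<in> fst ` c}"
    then obtain b where b: "e \<in> D" "x \<in> cell w e" "b \<in> e" "fst b = i" by auto
    then have "b = a \<or> b = flip a" using eq_or_eq_flip c(4) by auto
    then show "e \<in> {c, c'}" using uni b c c' by blast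
  next
    fix e assume "e \<in> {c, c'}"
    then show "e \<in> {c \<in> D. x \<in> cell w c \<and> i \<in> fst ` c}"
      using c c' image_eqI[of i fst "flip a" c'] by auto
  qed
  moreover have "c \<noteq> c'" using c c' not_flip by blast
  ultimately show ?thesis by simp
qed

abbreviation "clen i \<equiv> emeasure (circ_measure (w i))"

lemma AE_generic:
  assumes "i < k"
  shows "AE x in circ_measure (w i). x \<in> gcirc (w i) \<and> x \<notin> crossings"
  using AE_circ_measure_gcirc[OF nrm[OF assms]] AE_circ_measure_notin_finite[OF nrm[OF assms] finite_crossings]
  by eventually_elim auto

lemma closed_chord: "closed (chord w D i)"
  unfolding chord_def using fin
  by (intro closed_UN) (auto intro!: closed_Int closed_gcirc compact_imp_closed[OF compact_cell])

lemma boundary_sum_on_circle: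
  assumes i: "i \<in> {2..<k}"
  shows "(\<Sum>c\<in>D. clen i (sph_boundary (cell w c))) = 2 * clen i (chord w D i)"
proof (rule sum_emeasure_AE_indicator[OF fin])
  show "\<And>c. c \<in> D \<Longrightarrow> sph_boundary (cell w c) \<in> sets (circ_measure (w i))"
    "chord w D i \<in> sets (circ_measure (w i))"
    using i nrm closed_boundary closed_chord borel_closed by auto
  have ik: "i < k" using i by auto
  show "AE x in circ_measure (w i). (\<Sum>c\<in>D. indicator (sph_boundary (cell w c)) x)
          = 2 * (indicator (chord w D i) x :: ennreal)"
    using AE_generic[OF ik]
  proof eventually_elim
    case x: (elim x)
    have "x \<in> sph_boundary (cell w c) \<longleftrightarrow> x \<in> cell w c \<and> i \<in> fst ` c" if c: "c \<in> D" for c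
    proof
      assume "x \<in> sph_boundary (cell w c)"
      then obtain a where "x \<in> cell w c" "a \<in> c" "w (fst a) \<bullet> x = 0"
        using sph_boundary_cell[OF c] by auto
      then show "x \<in> cell w c \<and> i \<in> fst ` c"
        using generic_cells[OF ik] x index_lt[OF c] by blast
    next
      assume "x \<in> cell w c \<and> i \<in> fst ` c"
      then show "x \<in> sph_boundary (cell w c)"
        using sph_boundary_cell[OF c] x by (auto simp: gcirc_def)
    qed
    then have "(\<Sum>c\<in>D. indicator (sph_boundary (cell w c)) x)
        = (\<Sum>c\<in>D. if x \<in> cell w c \<and> i \<in> fst ` c then 1 else (0::ennreal))"
      by (intro sum.cong) (auto simp: indicator_def)
    also have "\<dots> = of_nat (card {c \<in> D. x \<in> cell w c \<and> i \<in> fst ` c})"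
      using fin by (simp add: sum.If_cases Int_def)
    also have "\<dots> = 2 * indicator (chord w D i) x"
    proof (cases "x \<in> chord w D i")
      case True
      then show ?thesis using two_cells_at_generic[OF ik] x by simp
    next
      case False
      then have "{c \<in> D. x \<in> cell w c \<and> i \<in> fst ` c} = {}" using x by (auto simp: chord_def)
      then show ?thesis using False by (simp only: card.empty) simp
    qed
    finally show ?case .
  qed
qed

lemma chord_equator: "chord w D 2 = equator"
proof -
  have "chord w D 2 = (\<Union>c\<in>D. cell w c) \<inter> gcirc (w 2)" using eq_code by (auto simp: chord_def)
  also have "\<dots> = gcirc (w 2)" using cover by (auto simp: cell_def gcirc_def)
  finally show ?thesis by (simp add: base equator_def)
qed

text \<open>Starting the sum at 3 leaves out the auxiliary axes and the equator, which has index
  2.\<close>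

definition len :: ennreal where "len = (\<Sum>i\<in>{3..<k}. clen i (chord w D i))"

lemma clen_gcirc: assumes "i < k" shows "clen i (gcirc (w i)) = 1"
proof -
  have "clen i (gcirc (w i)) = clen i UNIV"
    using AE_circ_measure_gcirc[OF nrm[OF assms]] nrm[OF assms]
    by (intro emeasure_eq_AE) (auto elim: eventually_mono)
  then show ?thesis using prob_space_circ_measure[OF nrm[OF assms]] by simp
qed

lemma sum_chord: "(\<Sum>i\<in>{2..<k}. clen i (chord w D i)) = 1 + len"
proof -
  have "{2..<k} = insert 2 {3..<k}" using k_ge by auto
  then show ?thesis using clen_gcirc[of 2] k_ge
    by (simp add: len_def chord_equator equator_def base)
qed

lemma sigma1_eq:
  assumes "B \<in> sets borel" "B \<subseteq> (\<Union>i\<in>{2..<k}. gcirc (w i))"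
  shows "sigma1 B = (\<Sum>i\<in>{2..<k}. clen i B)"
proof (rule sigma1_finite_circles[OF _ _ _ assms])
  show "inj_on (\<lambda>i. gcirc (w i)) {2..<k}"
    using gcirc_ne by (intro inj_onI) (metis atLeastLessThan_iff)
qed (auto intro: nrm)

lemma sigma1_boundary:
  assumes "c \<in> D"
  shows "sigma1 (sph_boundary (cell w c)) = (\<Sum>i\<in>{2..<k}. clen i (sph_boundary (cell w c)))"
proof (rule sigma1_eq)
  show "sph_boundary (cell w c) \<in> sets borel" using closed_boundary[OF assms] by (rule borel_closed)
  show "sph_boundary (cell w c) \<subseteq> (\<Union>i\<in>{2..<k}. gcirc (w i))"
  proof
    fix x assume "x \<in> sph_boundary (cell w c)"
    then obtain a where "a \<in> c" "w (fst a) \<bullet> x = 0" "x \<in> S2"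
      using sph_boundary_cell[OF assms] by (auto simp: cell_def)
    then show "x \<in> (\<Union>i\<in>{2..<k}. gcirc (w i))"
      using index_lt[OF assms, of a] by (intro UN_I[of "fst a"]) (auto simp: gcirc_def)
  qed
qed

lemma sum_boundary:
  "(\<Sum>\<^sub>\<infinity>p\<in>tess w D. sigma1 (sph_boundary p)) = 2 * (1 + len)"
proof -
  have "(\<Sum>\<^sub>\<infinity>p\<in>tess w D. sigma1 (sph_boundary p)) = (\<Sum>c\<in>D. sigma1 (sph_boundary (cell w c)))"
    using fin by (simp add: tess_def sum.reindex[OF inj_cell])
  also have "\<dots> = (\<Sum>c\<in>D. \<Sum>i\<in>{2..<k}. clen i (sph_boundary (cell w c)))"
    using sigma1_boundary by simp
  also have "\<dots> = (\<Sum>i\<in>{2..<k}. \<Sum>c\<in>D. clen i (sph_boundary (cell w c)))" by (rule sum.swap)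
  also have "\<dots> = (\<Sum>i\<in>{2..<k}. 2 * clen i (chord w D i))" using boundary_sum_on_circle by simp
  also have "\<dots> = 2 * (1 + len)" by (simp add: sum_distrib_left[symmetric] sum_chord)
  finally show ?thesis .
qed

end

section \<open>Edges and maximal segments\<close>

lemma circ_pt_shift:
  assumes "orthonormal2 a b" "circ_pt a b s = circ_pt a b t"
  shows "circ_pt a b (s + r) = circ_pt a b (t + r)"
  using assms by (simp add: circ_pt_eq_iff cos_add sin_add)

lemma circ_pt_image_eq_sph_arc:
  "circ_pt a b ` {\<beta>..\<gamma>} = sph_arc (circ_pt a b \<beta>) (circ_pt a b (\<beta> + pi/2)) (\<gamma> - \<beta>)"
proof -
  have "{\<beta>..\<gamma>} = (+) \<beta> ` {0..\<gamma> - \<beta>}" by simp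
  then show ?thesis unfolding sph_arc_def circ_pt_rotate by (simp only: image_image)
qed

lemma infinite_circ_pt_image:
  assumes "orthonormal2 a b" "s < t"
  shows "infinite (circ_pt a b ` {s..t})"
proof -
  define t' where "t' = min t (s + 1)"
  have "inj_on (circ_pt a b) {s..t'}"
    using pi_gt3 by (intro inj_on_circ_pt[OF assms(1)]) (auto simp: t'_def)
  moreover have "infinite {s..t'}" using assms(2) by (simp add: infinite_Icc t'_def)
  ultimately have "infinite (circ_pt a b ` {s..t'})" by (simp add: finite_image_iff)
  moreover have "circ_pt a b ` {s..t'} \<subseteq> circ_pt a b ` {s..t}" by (auto simp: t'_def)
  ultimately show ?thesis by (meson infinite_super)
qed

text \<open>A finite set contains no arc, so finitely many exceptional points are recovered by
  closure.\<close>

lemma circ_pt_image_subset_closed: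
  assumes "orthonormal2 a b" "s < t" "closed K" "finite F" "circ_pt a b ` {s..t} - F \<subseteq> K"
  shows "circ_pt a b ` {s..t} \<subseteq> K"
proof (rule ccontr)
  assume "\<not> ?thesis"
  then obtain \<theta> where \<theta>: "s \<le> \<theta>" "\<theta> \<le> t" "circ_pt a b \<theta> \<notin> K"
    unfolding image_subset_iff by (meson atLeastAtMost_iff)
  have "open (circ_pt a b -` (- K))"
    using assms(3) by (intro open_vimage) (auto intro: continuous_on_circ_pt)
  then obtain e where e: "e > 0" "ball \<theta> e \<subseteq> circ_pt a b -` (- K)"
    using \<theta> by (meson ComplI open_contains_ball vimageI)
  define l r where "l = max s (\<theta> - e/2)" and "r = min t (\<theta> + e/2)"
  have "l < r" using assms(2) \<theta> e by (auto simp: l_def r_def)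
  have "{l..r} \<subseteq> ball \<theta> e" using e(1) by (auto simp: l_def r_def dist_real_def)
  then have "circ_pt a b ` {l..r} \<inter> K = {}" using e(2) by auto
  moreover have "circ_pt a b ` {l..r} \<subseteq> circ_pt a b ` {s..t}" by (auto simp: l_def r_def)
  ultimately have "circ_pt a b ` {l..r} \<subseteq> F" using assms(5) by blast
  then show False using infinite_circ_pt_image[OF assms(1) \<open>l < r\<close>] assms(4) finite_subset by blast
qed

definition edge_arc :: "pt set \<Rightarrow> pt \<Rightarrow> pt \<Rightarrow> real \<Rightarrow> bool" where
  "edge_arc W a b \<alpha> \<longleftrightarrow> 0 < \<alpha> \<and> a \<in> W \<and> circ_pt a b \<alpha> \<in> W \<and> (\<forall>\<theta>\<in>{0<..<\<alpha>}. circ_pt a b \<theta> \<notin> W)"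

text \<open>\<open>edge_arc\<close> describes a gap of \<open>W\<close> with both ends in
  \<open>W\<close>, and the gap around a given angle is unique. The work lies in measuring both arcs
  by the same angle.\<close>

lemma arc_determined_by_point:
  assumes f: "frame u a b" "frame u a' b'" and e: "edge_arc W a b \<alpha>" "edge_arc W a' b' \<alpha>'"
    and x: "x \<notin> W" "x \<in> sph_arc a b \<alpha>" "x \<in> sph_arc a' b' \<alpha>'"
  shows "sph_arc a b \<alpha> = sph_arc a' b' \<alpha>'"
proof -
  have W: "a \<in> W" "circ_pt a b \<alpha> \<in> W" "\<And>\<theta>. 0 < \<theta> \<Longrightarrow> \<theta> < \<alpha> \<Longrightarrow> circ_pt a b \<theta> \<notin> W"
    using e(1) by (auto simp: edge_arc_def)
  have W': "a' \<in> W" "circ_pt a' b' \<alpha>' \<in> W" "\<And>\<theta>. 0 < \<theta> \<Longrightarrow> \<theta> < \<alpha>' \<Longrightarrow> circ_pt a' b' \<theta> \<notin> W"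
    using e(2) by (auto simp: edge_arc_def)
  have o: "orthonormal2 a b" using f by (auto simp: frame_def)
  have zero: "circ_pt a b 0 = a" "circ_pt a' b' 0 = a'" by (simp_all add: circ_pt_def)
  obtain s where s: "0 \<le> s" "s \<le> \<alpha>" "x = circ_pt a b s" using x(2) by (auto simp: sph_arc_def)
  obtain r where r: "0 \<le> r" "r \<le> \<alpha>'" "x = circ_pt a' b' r" using x(3) by (auto simp: sph_arc_def)
  have s': "0 < s" "s < \<alpha>" using s x(1) W zero by (auto simp: order.order_iff_strict)
  have r': "0 < r" "r < \<alpha>'" using r x(1) W' zero by (auto simp: order.order_iff_strict)
  \<comment> \<open>Uniqueness of the gap around \<open>s\<close>: if an end differed, it or the
    corresponding end of the other gap would be a point of \<open>W\<close> inside a gap.\<close>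
  have main: "\<beta> = 0 \<and> \<gamma> = \<alpha>"
    if "\<beta> < s" "s < \<gamma>" "circ_pt a b \<beta> \<in> W" "circ_pt a b \<gamma> \<in> W"
      "\<And>\<theta>. \<beta> < \<theta> \<Longrightarrow> \<theta> < \<gamma> \<Longrightarrow> circ_pt a b \<theta> \<notin> W" for \<beta> \<gamma>
  proof -
    have "\<not> \<beta> < 0" using that(5)[of 0] W(1) zero that(2) s' by auto
    moreover have "\<not> 0 < \<beta>" using W(3)[of \<beta>] that(1,3) s' by auto
    moreover have "\<not> \<alpha> < \<gamma>" using that(5)[of \<alpha>] W(2) that(1) s' by auto
    moreover have "\<not> \<gamma> < \<alpha>" using W(3)[of \<gamma>] that(2,4) s' by auto
    ultimately show ?thesis by linarith
  qed
  obtain \<phi> where \<phi>: "a' = circ_pt a b \<phi>"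
    using frame_circ_pt_obtain[OF f(1), of a'] f(2) by (auto simp: frame_def orthonormal2_def)
  from frame_reparam[OF f \<phi>] show ?thesis
  proof
    assume p: "\<forall>\<theta>. circ_pt a' b' \<theta> = circ_pt a b (\<phi> + \<theta>)"
    \<comment> \<open>The offset \<phi> matters only modulo a full turn; replacing it by
      \<open>s - r\<close> makes both parametrisations assign the angle \<open>s\<close> to
      \<open>x\<close>.\<close>
    have p': "circ_pt a' b' \<theta> = circ_pt a b (s - r + \<theta>)" for \<theta>
      using circ_pt_shift[OF o, of "\<phi> + r" s "\<theta> - r"] p s r by (simp add: algebra_simps)
    have e: "circ_pt a b (s - r) = a'" "circ_pt a b (s - r + \<alpha>') = circ_pt a' b' \<alpha>'"
      using p'[of 0] p'[of \<alpha>'] zero by auto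
    have "s - r = 0 \<and> s - r + \<alpha>' = \<alpha>"
    proof (rule main)
      show "circ_pt a b \<theta> \<notin> W" if "s - r < \<theta>" "\<theta> < s - r + \<alpha>'" for \<theta>
        using W'(3)[of "\<theta> - (s - r)"] p'[of "\<theta> - (s - r)"] that by auto
    qed (use e r' W' in auto)
    then have "s = r" "\<alpha>' = \<alpha>" by auto
    then show ?thesis using p' by (simp add: sph_arc_def)
  next
    assume p: "\<forall>\<theta>. circ_pt a' b' \<theta> = circ_pt a b (\<phi> - \<theta>)"
    have p': "circ_pt a' b' \<theta> = circ_pt a b (s + r - \<theta>)" for \<theta>
      using circ_pt_shift[OF o, of "\<phi> - r" s "r - \<theta>"] p s r by (simp add: algebra_simps)
    have e: "circ_pt a b (s + r) = a'" "circ_pt a b (s + r - \<alpha>') = circ_pt a' b' \<alpha>'"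
      using p'[of 0] p'[of \<alpha>'] zero by auto
    have m: "s + r - \<alpha>' = 0 \<and> s + r = \<alpha>"
    proof (rule main)
      show "circ_pt a b \<theta> \<notin> W" if "s + r - \<alpha>' < \<theta>" "\<theta> < s + r" for \<theta>
        using W'(3)[of "s + r - \<theta>"] p'[of "s + r - \<theta>"] that by auto
    qed (use e r' W' in auto)
    have "circ_pt a' b' ` {0..\<alpha>'} = circ_pt a b ` ((-) (s + r) ` {0..\<alpha>'})"
      unfolding image_image using p' by simp
    also have "(-) (s + r) ` {0..\<alpha>'} = {0..\<alpha>}" using m by simp
    finally show ?thesis by (simp add: sph_arc_def)
  qed
qed

lemma frame_of_orthonormal2:
  assumes "orthonormal2 a b"
  shows "frame (cross3 a b) a b"
proof -
  have "(norm (cross3 a b))\<^sup>2 = 1" using assms norm_cross_dot[of a b] by (simp add: orthonormal2_def)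
  then have "norm (cross3 a b) = 1" by (simp add: power2_eq_1_iff) (smt (verit) norm_ge_zero)
  moreover have "cross3 a b \<bullet> a = 0" "cross3 a b \<bullet> b = 0"
    by (rule dot_cross_self)+
  ultimately show ?thesis using assms by (simp add: frame_def)
qed

lemma sph_arc_subset_gcirc: "frame u a b \<Longrightarrow> sph_arc a b \<alpha> \<subseteq> gcirc u"
  using gcirc_frame_range[of u a b] by (auto simp: sph_arc_def)

lemma gcirc_eq_of_infinite:
  assumes "norm u = 1" "norm v = 1" "infinite e" "e \<subseteq> gcirc u" "e \<subseteq> gcirc v"
  shows "gcirc u = gcirc v"
proof -
  have "e \<subseteq> gcirc u \<inter> gcirc v" using assms(4,5) by blast
  then show ?thesis using gcirc_eq_or_finite[OF assms(1,2)] assms(3) by (metis finite_subset)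
qed

lemma frame_gcirc_cong:
  assumes "frame u a b" "gcirc u = gcirc v" "norm v = 1"
  shows "frame v a b"
proof (rule frame_of_image)
  show "circ_pt a b ` {0..<2 * pi} \<subseteq> gcirc v" using gcirc_frame[OF assms(1)] assms(2) by simp
qed (use assms in \<open>auto simp: frame_def\<close>)

lemma connected_sph_arc: "connected (sph_arc a b \<alpha>)"
  unfolding sph_arc_def by (intro connected_continuous_image continuous_on_circ_pt connected_Icc)

text \<open>Keeps the equator out of the maximal segments: an arc shorter than a full turn misses
  the angles strictly between \<alpha> and \<open>2 * pi\<close>.\<close>

lemma not_is_segment_gcirc:
  assumes "norm u = 1"
  shows "\<not> is_segment (gcirc u)"
proof
  assume "is_segment (gcirc u)"
  then obtain a b \<alpha> where s: "orthonormal2 a b" "0 < \<alpha>" "\<alpha> < 2 * pi" "gcirc u = sph_arc a b \<alpha>"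
    by (auto simp: is_segment_def)
  have f: "frame (cross3 a b) a b" by (rule frame_of_orthonormal2[OF s(1)])
  have "infinite (gcirc u)" using infinite_circ_pt_image[OF s(1,2)] s(4) by (simp add: sph_arc_def)
  then have "gcirc (cross3 a b) = gcirc u"
    using gcirc_eq_of_infinite[of "cross3 a b" u "gcirc u"] f assms sph_arc_subset_gcirc[OF f] s(4)
    by (auto simp: frame_def)
  then have "circ_pt a b ((\<alpha> + 2 * pi) / 2) \<in> sph_arc a b \<alpha>"
    using gcirc_frame_range[OF f] s(4) by auto
  then obtain \<theta> where "0 \<le> \<theta>" "\<theta> \<le> \<alpha>" "circ_pt a b \<theta> = circ_pt a b ((\<alpha> + 2 * pi) / 2)"
    by (auto simp: sph_arc_def)
  moreover have "inj_on (circ_pt a b) {0..<2*pi}" by (intro inj_on_circ_pt[OF s(1)]) auto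
  ultimately have "\<theta> = (\<alpha> + 2 * pi) / 2" using s(2,3) by (auto dest!: inj_onD[of _ "{0..<2*pi}" \<theta>])
  then show False using \<open>\<theta> \<le> \<alpha>\<close> s(3) by simp
qed

context good
begin

abbreviation "T \<equiv> tess w D"

text \<open>An edge lies in a cell boundary, hence in finitely many of the circles. Being infinite,
  it has infinitely many points on one of them, and great circles with infinitely many common points
  coincide.\<close>

lemma edge_obtain:
  assumes "e \<in> edges T"
  obtains i a b \<alpha> where "i \<in> {2..<k}" "frame (w i) a b" "edge_arc (vertices T) a b \<alpha>" "e = sph_arc a b \<alpha>"
    "e \<subseteq> chord w D i"
proof -
  from assms obtain c a b \<alpha> where c: "c \<in> D" "e \<subseteq> sph_boundary (cell w c)"
    and e: "orthonormal2 a b" "0 < \<alpha>" "edge_arc (vertices T) a b \<alpha>" "e = sph_arc a b \<alpha>"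
    unfolding edges_def tess_def edge_arc_def by blast
  have f: "frame (cross3 a b) a b" by (rule frame_of_orthonormal2[OF e(1)])
  have inf: "infinite e" using infinite_circ_pt_image[OF e(1,2)] e(4) by (simp add: sph_arc_def)
  have sub: "e \<subseteq> (\<Union>d\<in>c. e \<inter> gcirc (w (fst d)))"
    using c(2) sph_boundary_cell[OF c(1)] by (fastforce simp: gcirc_def cell_def)
  obtain d where d: "d \<in> c" "infinite (e \<inter> gcirc (w (fst d)))"
    using sub inf finite_code[OF c(1)] by (meson finite_UN_I finite_subset)
  let ?i = "fst d"
  have i: "?i \<in> {2..<k}" using index_lt[OF c(1) d(1)] by auto
  have eq: "gcirc (cross3 a b) = gcirc (w ?i)"
    using gcirc_eq_of_infinite[OF _ _ d(2)] f nrm i sph_arc_subset_gcirc[OF f, of \<alpha>] e(4)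
    by (auto simp: frame_def)
  have f': "frame (w ?i) a b" using frame_gcirc_cong[OF f eq] nrm i by auto
  have "e \<subseteq> chord w D ?i"
    using c d(1) sph_boundary_cell[OF c(1)] sph_arc_subset_gcirc[OF f', of \<alpha>] e(4)
    unfolding chord_def by fastforce
  with that[OF i f' e(3,4)] show thesis .
qed

lemma edge_unique:
  assumes "e \<in> edges T" "e' \<in> edges T" "x \<in> e" "x \<in> e'" "x \<notin> crossings"
  shows "e = e'"
proof -
  obtain i a b \<alpha> where e: "i \<in> {2..<k}" "frame (w i) a b" "edge_arc (vertices T) a b \<alpha>" "e = sph_arc a b \<alpha>"
    "e \<subseteq> chord w D i"
    using edge_obtain[OF assms(1)] .
  obtain j a' b' \<alpha>' where e': "j \<in> {2..<k}" "frame (w j) a' b'" "edge_arc (vertices T) a' b' \<alpha>'" "e' = sph_arc a' b' \<alpha>'"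
    "e' \<subseteq> chord w D j"
    using edge_obtain[OF assms(2)] .
  have "x \<in> gcirc (w i)" "x \<in> gcirc (w j)" using assms(3,4) e(5) e'(5) by (auto simp: chord_def)
  then have "j = i" using generic_cells[of i x j] assms(5) e(1) e'(1) by (auto simp: gcirc_def)
  moreover have "x \<notin> vertices T" using assms(5) vertices_crossings by blast
  ultimately show ?thesis
    using arc_determined_by_point[OF e(2) _ e(3) e'(3)] e'(2) assms(3,4) e(4) e'(4) by blast
qed

lemma inner_point:
  assumes "orthonormal2 a b" "0 < \<alpha>"
  obtains \<theta> where "0 < \<theta>" "\<theta> < \<alpha>" "circ_pt a b \<theta> \<notin> crossings"
proof (rule ccontr)
  assume "\<not> thesis"
  with that have "circ_pt a b ` {\<alpha>/3..\<alpha>/2} \<subseteq> crossings" using assms(2) by force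
  with infinite_circ_pt_image[OF assms(1), of "\<alpha>/3" "\<alpha>/2"] assms(2) finite_crossings finite_subset
  show False by auto
qed

text \<open>On each circle a vertex has only two directions, and an edge is fixed by its starting
  vertex and direction: two edges with the same start and direction share a point off the
  crossings.\<close>

lemma finite_edges: "finite (edges T)"
proof -
  define P where "P = (\<lambda>(a, b) e. \<exists>\<alpha>>0. orthonormal2 a b \<and> e = sph_arc a b \<alpha>)"
  let ?Q = "(\<Union>a\<in>vertices T. \<Union>i\<in>{2..<k}. {(a, cross3 (w i) a), (a, - cross3 (w i) a)})"
  have "edges T \<subseteq> (\<Union>q\<in>?Q. {e\<in>edges T. P q e})"
  proof
    fix e assume e: "e \<in> edges T"
    obtain i a b \<alpha> where i: "i \<in> {2..<k}" "frame (w i) a b" "0 < \<alpha>" "e = sph_arc a b \<alpha>" "a \<in> vertices T"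
      by (rule edge_obtain[OF e], unfold edge_arc_def) blast
    have f: "frame (w i) a (cross3 (w i) a)"
      using i(2) by (intro frame_cross) (auto simp: frame_def orthonormal2_def)
    have "b = cross3 (w i) a \<or> b = - cross3 (w i) a"
    proof -
      have "a = circ_pt a (cross3 (w i) a) 0" by (simp add: circ_pt_def)
      from frame_reparam[OF f i(2) this] show ?thesis
      proof
        assume "\<forall>\<theta>. circ_pt a b \<theta> = circ_pt a (cross3 (w i) a) (0 + \<theta>)"
        from this[rule_format, of "pi/2"] show ?thesis by (simp add: circ_pt_def)
      next
        assume "\<forall>\<theta>. circ_pt a b \<theta> = circ_pt a (cross3 (w i) a) (0 - \<theta>)"
        from this[rule_format, of "pi/2"] show ?thesis by (simp add: circ_pt_def)
      qed
    qed
    then have "(a, b) \<in> ?Q" using i by blast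
    moreover have "P (a, b) e" using i by (auto simp: P_def frame_def)
    ultimately show "e \<in> (\<Union>q\<in>?Q. {e\<in>edges T. P q e})" using e by blast
  qed
  moreover have "finite {e\<in>edges T. P q e}" for q
  proof -
    obtain a b where q: "q = (a, b)" by (cases q)
    have "e = e'" if "e \<in> edges T" "e' \<in> edges T" "P q e" "P q e'" for e e'
    proof -
      from that obtain \<alpha> \<alpha>' where al: "\<alpha> > 0" "\<alpha>' > 0" "orthonormal2 a b" "e = sph_arc a b \<alpha>" "e' = sph_arc a b \<alpha>'"
        by (auto simp: P_def q)
      have "0 < min \<alpha> \<alpha>'" using al by simp
      then obtain \<theta> where "0 < \<theta>" "\<theta> < min \<alpha> \<alpha>'" "circ_pt a b \<theta> \<notin> crossings"
        by (rule inner_point[OF al(3)])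
      then show ?thesis using edge_unique[OF that(1,2), of "circ_pt a b \<theta>"] al
        by (auto simp: sph_arc_def)
    qed
    then have "{e\<in>edges T. P q e} \<subseteq> {e0}" if "e0 \<in> edges T" "P q e0" for e0 using that by blast
    then show ?thesis by (metis (no_types, lifting) Collect_empty_eq finite.emptyI finite.insertI finite_subset)
  qed
  moreover have "finite ?Q" using finite_vertices by auto
  ultimately show ?thesis by (metis (no_types, lifting) finite_UN_I finite_subset)
qed

text \<open>Some cell at \<open>x\<close> bounded by circle \<open>i\<close> has another side:
  otherwise the two cells at \<open>x\<close> would be complementary hemispheres and the only cells,
  contrary to \<open>3 < k\<close>. The side of that cell through \<open>x\<close> ends in corners,
  which are vertices; the vertices nearest to \<open>x\<close> in the two directions then bound the
  edge.\<close>

lemma edge_through_generic_point: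
  assumes k: "3 < k" and i: "i \<in> {2..<k}" and x: "x \<in> chord w D i" "x \<notin> crossings"
  shows "\<exists>e\<in>edges T. x \<in> e"
proof -
  have xi: "x \<in> gcirc (w i)" "i < k" using x i by (auto simp: chord_def)
  have "\<exists>c\<in>D. x \<in> cell w c \<and> i \<in> fst ` c \<and> (\<exists>a\<in>c. fst a \<noteq> i)"
  proof (rule ccontr)
    assume "\<not> ?thesis"
    then have no: "\<forall>a\<in>c. fst a = i" if "c \<in> D" "x \<in> cell w c" "i \<in> fst ` c" for c using that by blast
    obtain c a where c: "c \<in> D" "x \<in> cell w c" "a \<in> c" "fst a = i" using x by (auto simp: chord_def)
    obtain c' where c': "c' \<in> D" "x \<in> cell w c'" "flip a \<in> c'"
      using opposite_cell[OF xi(2) xi(1) x(2) c] .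
    have ic: "i \<in> fst ` c" using c by force
    have "b = a" if b: "b \<in> c" for b
    proof -
      have "fst b = i" using no[OF c(1,2) ic] b by (rule bspec)
      then show ?thesis using code_index_unique[OF c(1) b c(3)] c(4) by simp
    qed
    then have "c = {a}" using c(3) by blast
    have "fst (flip a) = i" using c by simp
    then have ic': "i \<in> fst ` c'" using c'(3) by (metis image_eqI)
    have "b = flip a" if b: "b \<in> c'" for b
    proof -
      have "fst b = i" using no[OF c'(1,2) ic'] b by (rule bspec)
      then show ?thesis using code_index_unique[OF c'(1) b c'(3)] \<open>fst (flip a) = i\<close> by simp
    qed
    then have "c' = {flip a}" using c'(3) by blast
    have "D \<subseteq> {c, c'}"
    proof
      fix d assume d: "d \<in> D"
      show "d \<in> {c, c'}"
      proof (rule ccontr)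
        assume "d \<notin> {c, c'}"
        then have "c \<noteq> d" "c' \<noteq> d" by auto
        \<comment> \<open>A third cell would have to lie on both sides of circle
          \<open>i\<close>.\<close>
        from sep[OF c(1) d this(1)] sep[OF c'(1) d this(2)] have "flip a \<in> d" "flip (flip a) \<in> d"
          unfolding \<open>c = {a}\<close> \<open>c' = {flip a}\<close> by blast+
        then show False using not_flip[OF d] by blast
      qed
    qed
    then have "card D \<le> card {c, c'}" by (intro card_mono) auto
    also have "\<dots> \<le> 2" by (simp add: card_insert_if)
    finally show False using card_D k by simp
  qed
  then obtain c where c: "c \<in> D" "x \<in> cell w c" "i \<in> fst ` c" "\<exists>a\<in>c. fst a \<noteq> i" by blast
  have nx: "norm x = 1" "w i \<bullet> x = 0" using xi by (auto simp: gcirc_def S2_def)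
  obtain y where f: "frame (w i) x y" using frame_extend[OF nrm[OF xi(2)] nx] .
  have o: "orthonormal2 x y" using f by (simp add: frame_def)
  \<comment> \<open>Index \<open>i\<close> is left out because its form vanishes on the whole
    circle; the remaining forms are strictly positive at \<open>x\<close>.\<close>
  define A where "A = {a\<in>c. fst a \<noteq> i}"
  have A: "finite A" "A \<noteq> {}" using finite_code[OF c(1)] c(4) by (auto simp: A_def)
  have pos: "0 < normal w a \<bullet> x" if "a \<in> A" for a
  proof -
    have "w (fst a) \<bullet> x \<noteq> 0" using generic_cells[OF xi(2,1) x(2), of "fst a"] that index_lt[OF c(1), of a] by (auto simp: A_def)
    then have "normal w a \<bullet> x \<noteq> 0" by simp
    moreover have "0 \<le> normal w a \<bullet> x" using c(2) that by (simp add: cell_def hcone_def A_def)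
    ultimately show ?thesis by linarith
  qed
  obtain al be where ab: "- pi < al" "al < 0" "0 < be" "be < pi"
    "\<forall>\<theta>\<in>{-pi..pi}. (\<forall>a\<in>A. 0 \<le> normal w a \<bullet> circ_pt x y \<theta>) \<longleftrightarrow> al \<le> \<theta> \<and> \<theta> \<le> be"
    "\<exists>a\<in>A. normal w a \<bullet> circ_pt x y al = 0" "\<exists>a\<in>A. normal w a \<bullet> circ_pt x y be = 0"
    by (rule arc_of_halfspaces[where n = "normal w" and x = x and y = y, OF A pos])
  have on: "w i \<bullet> circ_pt x y \<theta> = 0" for \<theta> using f by (simp add: frame_def inner_circ_pt)
  obtain g where g: "g \<in> c" "fst g = i" using c(3) by auto
  have incell: "circ_pt x y \<theta> \<in> cell w c" if "al \<le> \<theta>" "\<theta> \<le> be" for \<theta>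
  proof -
    have "0 \<le> normal w a \<bullet> circ_pt x y \<theta>" if "a \<in> c" for a
    proof (cases "fst a = i")
      case True
      then have "normal w a \<bullet> circ_pt x y \<theta> = 0" using on by simp
      then show ?thesis by linarith
    next
      case False
      then have "a \<in> A" using that by (simp add: A_def)
      moreover have "\<theta> \<in> {-pi..pi}" using ab(1-4) \<open>al \<le> \<theta>\<close> \<open>\<theta> \<le> be\<close> by simp
      ultimately show ?thesis using ab(5) \<open>al \<le> \<theta>\<close> \<open>\<theta> \<le> be\<close> by blast
    qed
    then show ?thesis using norm_circ_pt[OF o] by (auto simp: cell_def hcone_def S2_def)
  qed
  have vert: "circ_pt x y \<theta> \<in> vertices T" if th: "al \<le> \<theta>" "\<theta> \<le> be" "\<exists>a\<in>A. normal w a \<bullet> circ_pt x y \<theta> = 0" for \<theta>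
  proof -
    obtain a where a: "a \<in> A" "w (fst a) \<bullet> circ_pt x y \<theta> = 0" using th(3) by auto
    show ?thesis using a g on by (intro corner_vertex[OF c(1) incell[OF th(1,2)], of a g]) (auto simp: A_def)
  qed
  define W where "W = {\<theta>\<in>{-pi<..<pi}. circ_pt x y \<theta> \<in> vertices T}"
  have "inj_on (circ_pt x y) {-pi<..<pi}" by (intro inj_on_circ_pt[OF o]) auto
  from finite_vimage_IntI[OF finite_vertices this]
  have finW: "finite W" by (rule rev_finite_subset) (auto simp: W_def)
  have alW: "al \<in> W" "be \<in> W" using vert[OF _ _ ab(6)] vert[OF _ _ ab(7)] ab(1-4) by (auto simp: W_def)
  have W0: "0 \<notin> W" using x(2) vertices_crossings by (auto simp: W_def circ_pt_def)
  \<comment> \<open>The nearest vertices need not be the corners \<open>al\<close> and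
    \<open>be\<close>: a segment on the far side of circle \<open>i\<close> may end in the interior
    of this side.\<close>
  define \<beta> where "\<beta> = Max {\<theta>\<in>W. \<theta> < 0}"
  define \<gamma> where "\<gamma> = Min {\<theta>\<in>W. 0 < \<theta>}"
  have "\<beta> \<in> {\<theta>\<in>W. \<theta> < 0}" unfolding \<beta>_def using finW alW ab by (intro Max_in) auto
  then have be: "\<beta> \<in> W" "\<beta> < 0" by auto
  have "\<gamma> \<in> {\<theta>\<in>W. 0 < \<theta>}" unfolding \<gamma>_def using finW alW ab by (intro Min_in) auto
  then have ga: "\<gamma> \<in> W" "0 < \<gamma>" by auto
  have le: "al \<le> \<beta>" "\<gamma> \<le> be" unfolding \<beta>_def \<gamma>_def using finW alW ab by auto
  have gap: "\<theta> \<notin> W" if "\<beta> < \<theta>" "\<theta> < \<gamma>" for \<theta>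
  proof
    assume "\<theta> \<in> W"
    with W0 have "\<theta> < 0 \<or> 0 < \<theta>" by (metis linorder_neqE_linordered_idom)
    then show False
    proof
      assume "\<theta> < 0"
      then have "\<theta> \<le> \<beta>" unfolding \<beta>_def using finW \<open>\<theta> \<in> W\<close> by auto
      then show False using that by simp
    next
      assume "0 < \<theta>"
      then have "\<gamma> \<le> \<theta>" unfolding \<gamma>_def using finW \<open>\<theta> \<in> W\<close> by auto
      then show False using that by simp
    qed
  qed
  let ?e = "circ_pt x y ` {\<beta>..\<gamma>}"
  have "?e \<in> edges T"
    unfolding edges_def
  proof (intro CollectI conjI)
    show "\<exists>p\<in>T. ?e \<subseteq> sph_boundary p"
    proof
      show "?e \<subseteq> sph_boundary (cell w c)"
        unfolding sph_boundary_cell[OF c(1)] using incell le on g by auto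
    qed (use c in \<open>auto simp: tess_def\<close>)
    show "\<exists>a b \<alpha>. orthonormal2 a b \<and> 0 < \<alpha> \<and> \<alpha> < 2 * pi \<and> ?e = sph_arc a b \<alpha> \<and> a \<in> vertices T
        \<and> circ_pt a b \<alpha> \<in> vertices T \<and> (\<forall>\<theta>\<in>{0<..<\<alpha>}. circ_pt a b \<theta> \<notin> vertices T)"
    proof (intro exI conjI)
      show "orthonormal2 (circ_pt x y \<beta>) (circ_pt x y (\<beta> + pi/2))" by (rule orthonormal2_circ_pt[OF o])
      show "?e = sph_arc (circ_pt x y \<beta>) (circ_pt x y (\<beta> + pi/2)) (\<gamma> - \<beta>)" by (rule circ_pt_image_eq_sph_arc)
      show "\<forall>\<theta>\<in>{0<..<\<gamma> - \<beta>}. circ_pt (circ_pt x y \<beta>) (circ_pt x y (\<beta> + pi/2)) \<theta> \<notin> vertices T"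
      proof
        fix \<theta> assume "\<theta> \<in> {0<..<\<gamma> - \<beta>}"
        then have "\<beta> + \<theta> \<notin> W" "-pi < \<beta> + \<theta>" "\<beta> + \<theta> < pi" using gap[of "\<beta> + \<theta>"] le ab by auto
        then show "circ_pt (circ_pt x y \<beta>) (circ_pt x y (\<beta> + pi/2)) \<theta> \<notin> vertices T"
          unfolding circ_pt_rotate by (auto simp: W_def)
      qed
    qed (use be ga le ab in \<open>auto simp: W_def circ_pt_rotate\<close>)
  qed
  moreover have "x \<in> ?e"
  proof
    show "x = circ_pt x y 0" by (simp add: circ_pt_def)
  qed (use be ga in auto)
  ultimately show ?thesis by blast
qed

lemma closed_edge: "e \<in> edges T \<Longrightarrow> closed e"
  by (erule edge_obtain) (auto simp: sph_arc_def intro!: compact_imp_closed compact_continuous_image continuous_on_circ_pt)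

lemma edge_index_unique:
  assumes "e \<in> edges T" "e \<subseteq> gcirc (w i)" "i < k"
  shows "e \<subseteq> chord w D i"
proof -
  obtain j a b \<alpha> where e: "j \<in> {2..<k}" "frame (w j) a b" "0 < \<alpha>" "e = sph_arc a b \<alpha>"
    "e \<subseteq> chord w D j"
    by (rule edge_obtain[OF assms(1)], unfold edge_arc_def) blast
  have "infinite e" using infinite_circ_pt_image[of a b 0 \<alpha>] e by (simp add: sph_arc_def frame_def)
  moreover have "e \<subseteq> gcirc (w j)" using e(5) by (auto simp: chord_def)
  ultimately have "gcirc (w i) = gcirc (w j)"
    using gcirc_eq_of_infinite[OF nrm nrm] assms(2,3) e(1) by auto
  then have "i = j" using gcirc_ne assms(3) e(1) by force
  then show ?thesis using e by simp
qed

lemma edges_empty: "k = 3 \<Longrightarrow> edges T = {}"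
proof -
  assume "k = 3"
  then have "card T = 2" using card_tess by simp
  have "vertices T = {}"
  proof (rule ccontr)
    assume "vertices T \<noteq> {}"
    then obtain p1 p2 p3 where p: "{p1, p2, p3} \<subseteq> T" "p1 \<noteq> p2" "p1 \<noteq> p3" "p2 \<noteq> p3" by (auto simp: vertices_def)
    have "finite T" using fin by (simp add: tess_def)
    from card_mono[OF this p(1)] p \<open>card T = 2\<close> show False by simp
  qed
  then show ?thesis by (auto simp: edges_def)
qed

lemma clen_edges:
  assumes k: "3 < k" and i: "i \<in> {2..<k}"
  shows "(\<Sum>e\<in>edges T. clen i e) = clen i (chord w D i)"
proof -
  have ik: "i < k" using i by auto
  have "(\<Sum>e\<in>edges T. clen i e) = 1 * clen i (chord w D i)"
  proof (rule sum_emeasure_AE_indicator[OF finite_edges])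
    show "\<And>e. e \<in> edges T \<Longrightarrow> e \<in> sets (circ_measure (w i))" "chord w D i \<in> sets (circ_measure (w i))"
      using nrm ik closed_edge closed_chord borel_closed by auto
    show "AE x in circ_measure (w i). (\<Sum>e\<in>edges T. indicator e x) = 1 * (indicator (chord w D i) x :: ennreal)"
      using AE_generic[OF ik]
    proof eventually_elim
      case x: (elim x)
      show ?case
      proof (cases "x \<in> chord w D i")
        case True
        then obtain e where e: "e \<in> edges T" "x \<in> e" using edge_through_generic_point[OF k i] x by blast
        then have "edges T = insert e (edges T - {e})" by auto
        moreover have "(\<Sum>e\<in>edges T - {e}. indicator e x) = (0::ennreal)"
          using edge_unique[OF e(1)] e(2) x by (intro sum.neutral) (auto simp: indicator_def)
        ultimately show ?thesis using e True finite_edges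
          by (metis (no_types, lifting) add.right_neutral finite_Diff indicator_simps(1) mult_1 sum.remove)
      next
        case False
        have "x \<notin> e" if ed: "e \<in> edges T" for e
        proof
          assume xe: "x \<in> e"
          obtain j where j: "j \<in> {2..<k}" "e \<subseteq> chord w D j"
            by (rule edge_obtain[OF ed]) blast
          then have "x \<in> gcirc (w j)" using xe by (auto simp: chord_def)
          then have "j = i" using generic_cells[OF ik, of x j] x j by (auto simp: gcirc_def)
          then show False using j xe False by auto
        qed
        then show ?thesis using False by (simp add: sum.neutral)
      qed
    qed
  qed
  then show ?thesis by simp
qed

lemma sum_edges:
  "(\<Sum>\<^sub>\<infinity>e\<in>edges T. sigma1 e) = (if k = 3 then 0 else 1 + len)"
proof (cases "k = 3")
  case True
  then show ?thesis using edges_empty by simp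
next
  case False
  then have k: "3 < k" using k_ge by simp
  have "sigma1 e = (\<Sum>i\<in>{2..<k}. clen i e)" if ed: "e \<in> edges T" for e
  proof (rule sigma1_eq)
    show "e \<in> sets borel" using closed_edge[OF ed] by (rule borel_closed)
    obtain j where "j \<in> {2..<k}" "e \<subseteq> chord w D j"
      by (rule edge_obtain[OF ed]) blast
    then show "e \<subseteq> (\<Union>i\<in>{2..<k}. gcirc (w i))" by (auto simp: chord_def)
  qed
  then have "(\<Sum>\<^sub>\<infinity>e\<in>edges T. sigma1 e) = (\<Sum>e\<in>edges T. \<Sum>i\<in>{2..<k}. clen i e)"
    using finite_edges by simp
  also have "\<dots> = (\<Sum>i\<in>{2..<k}. \<Sum>e\<in>edges T. clen i e)" by (rule sum.swap)
  also have "\<dots> = 1 + len" using clen_edges[OF k] by (simp add: sum_chord)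
  finally show ?thesis using False by simp
qed

section \<open>Maximal segments are the chords of the splits\<close>

lemma chord_param:
  assumes "i \<in> {2..<k}"
  obtains a b \<alpha> where "orthonormal2 a b" "0 < \<alpha>" "chord w D i = circ_pt a b ` {0..\<alpha>}"
proof (cases "i = 2")
  case True
  obtain a b where f: "frame (w 2) a b" using frame_exists[OF nrm[of 2]] k_ge by auto
  have "circ_pt a b ` {0..<2*pi} \<subseteq> circ_pt a b ` {0..2*pi}" by (intro image_mono) auto
  then have "gcirc (w 2) = circ_pt a b ` {0..2*pi}"
    using gcirc_frame[OF f] gcirc_frame_range[OF f] by blast
  then have "chord w D i = circ_pt a b ` {0..2*pi}" using True chord_equator
    by (simp add: equator_def base)
  then show thesis using that[of a b "2*pi"] f by (auto simp: frame_def)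
next
  case False
  then have "is_segment (chord w D i)" using seg assms by auto
  then show thesis using that by (auto simp: is_segment_def sph_arc_def)
qed

definition chain :: "nat \<Rightarrow> pt set set" where "chain i = {e \<in> edges T. e \<subseteq> gcirc (w i)}"

text \<open>The edges cover the chord off the finitely many crossings, and a finite union of closed
  edges is closed.\<close>

lemma Union_chain:
  assumes k: "3 < k" and i: "i \<in> {2..<k}"
  shows "\<Union>(chain i) = chord w D i"
proof
  show "\<Union>(chain i) \<subseteq> chord w D i" using edge_index_unique i by (auto simp: chain_def)
  obtain a b \<alpha> where p: "orthonormal2 a b" "0 < \<alpha>" "chord w D i = circ_pt a b ` {0..\<alpha>}"
    using chord_param[OF i] .
  have "chord w D i - crossings \<subseteq> \<Union>(chain i)"
  proof
    fix x assume x: "x \<in> chord w D i - crossings"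
    then obtain e where e: "e \<in> edges T" "x \<in> e" using edge_through_generic_point[OF k i] by blast
    obtain j where j: "j \<in> {2..<k}" "e \<subseteq> chord w D j"
      by (rule edge_obtain[OF e(1)]) blast
    have "x \<in> gcirc (w i)" "x \<in> gcirc (w j)" using x e j by (auto simp: chord_def)
    then have "j = i" using generic_cells[of i x j] x i j by (auto simp: gcirc_def)
    then show "x \<in> \<Union>(chain i)" using e j by (auto simp: chain_def chord_def)
  qed
  moreover have "closed (\<Union>(chain i))"
    using finite_edges closed_edge by (intro closed_Union) (auto simp: chain_def)
  ultimately show "chord w D i \<subseteq> \<Union>(chain i)"
    using circ_pt_image_subset_closed[OF p(1,2) _ finite_crossings] p(3) by simp
qed

lemma infinite_chord: "i \<in> {2..<k} \<Longrightarrow> infinite (chord w D i)"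
  using chord_param infinite_circ_pt_image by metis

lemma edge_chain_chain:
  assumes k: "3 < k" and i: "i \<in> {2..<k}"
  shows "edge_chain T (chain i)"
proof -
  obtain a b \<alpha> where p: "orthonormal2 a b" "0 < \<alpha>" "chord w D i = circ_pt a b ` {0..\<alpha>}"
    using chord_param[OF i] .
  have "connected (chord w D i)" using connected_sph_arc[of a b \<alpha>] p(3) by (simp add: sph_arc_def)
  moreover have "chord w D i \<subseteq> gcirc (w i)" by (auto simp: chord_def)
  moreover have "chain i \<noteq> {}" using Union_chain[OF assms] infinite_chord[OF i] by auto
  ultimately show ?thesis unfolding edge_chain_def Union_chain[OF assms]
    using nrm i by (auto simp: chain_def)
qed

lemma edge_chain_subset:
  assumes "edge_chain T E"
  obtains i where "i \<in> {2..<k}" "E \<subseteq> chain i"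
proof -
  obtain u where u: "norm u = 1" "\<Union>E \<subseteq> gcirc u" and E: "E \<noteq> {}" "E \<subseteq> edges T"
    using assms by (auto simp: edge_chain_def)
  obtain e where e: "e \<in> E" using E by auto
  have "e \<in> edges T" using e E by blast
  then obtain i a b \<alpha> where i: "i \<in> {2..<k}" "frame (w i) a b" "0 < \<alpha>" "e = sph_arc a b \<alpha>"
    by (rule edge_obtain, unfold edge_arc_def) blast
  have "infinite e" using infinite_circ_pt_image[of a b 0 \<alpha>] i by (simp add: sph_arc_def frame_def)
  then have "gcirc u = gcirc (w i)"
    using sph_arc_subset_gcirc[OF i(2), of \<alpha>] i u(2) e
    by (intro gcirc_eq_of_infinite[OF u(1) nrm, of i e]) auto
  then have "E \<subseteq> chain i" using u(2) E by (auto simp: chain_def)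
  with i that show thesis by blast
qed

text \<open>A chain of edges lies on one circle of the tessellation, so after a split the maximal
  unions are exactly the full chords; the equator is one of them too, but it is not a
  segment.\<close>

lemma max_segments_eq: "max_segments T = chord w D ` {3..<k}"
proof (cases "k = 3")
  case True
  then show ?thesis using edges_empty by (auto simp: max_segments_def edge_chain_def)
next
  case False
  then have k: "3 < k" using k_ge by simp
  note U = Union_chain[OF k]
  show ?thesis
  proof (intro equalityI subsetI)
    fix m assume "m \<in> max_segments T"
    then obtain E where E: "edge_chain T E" "m = \<Union>E" "is_segment m"
      "\<And>E'. edge_chain T E' \<Longrightarrow> \<Union>E \<subseteq> \<Union>E' \<Longrightarrow> \<Union>E' = \<Union>E"
      by (auto simp: max_segments_def)
    obtain i where i: "i \<in> {2..<k}" "E \<subseteq> chain i" using edge_chain_subset[OF E(1)] .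
    have "\<Union>E \<subseteq> \<Union>(chain i)" using i(2) by blast
    from E(4)[OF edge_chain_chain[OF k i(1)] this] have m: "m = chord w D i" using U[OF i(1)] E(2) by simp
    have "i \<noteq> 2" using m E(3) not_is_segment_gcirc[of "w 2"] nrm[of 2] k chord_equator by (auto simp: equator_def base)
    then show "m \<in> chord w D ` {3..<k}" using m i by auto
  next
    fix m assume "m \<in> chord w D ` {3..<k}"
    then obtain i where i: "i \<in> {3..<k}" "m = chord w D i" by blast
    then have i2: "i \<in> {2..<k}" by auto
    have "\<Union>E' = \<Union>(chain i)" if E': "edge_chain T E'" "\<Union>(chain i) \<subseteq> \<Union>E'" for E'
    proof -
      obtain j where j: "j \<in> {2..<k}" "E' \<subseteq> chain j" using edge_chain_subset[OF E'(1)] .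
      have "chord w D i \<subseteq> chord w D j" using E'(2) j U[OF i2] U[OF j(1)] by blast
      then have "chord w D i \<subseteq> gcirc (w j)" "chord w D i \<subseteq> gcirc (w i)" by (auto simp: chord_def)
      then have "gcirc (w i) = gcirc (w j)"
        using gcirc_eq_of_infinite[OF nrm nrm infinite_chord[OF i2]] i2 j by auto
      then have "i = j" using gcirc_ne i2 j by force
      then show ?thesis using j E'(2) by blast
    qed
    then have "edge_chain T (chain i) \<and> m = \<Union>(chain i) \<and>
        (\<forall>E'. edge_chain T E' \<and> \<Union>(chain i) \<subseteq> \<Union>E' \<longrightarrow> \<Union>E' = \<Union>(chain i))"
      using edge_chain_chain[OF k i2] U[OF i2] i(2) by blast
    moreover have "is_segment m" using i seg by auto
    ultimately show "m \<in> max_segments T" unfolding max_segments_def by blast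
  qed
qed

lemma clen_chord_other:
  assumes "i \<in> {2..<k}" "j \<in> {2..<k}" "i \<noteq> j"
  shows "clen j (chord w D i) = 0"
proof -
  have "finite (gcirc (w i) \<inter> gcirc (w j))" using gcirc_inter_finite assms by auto
  then have "finite (chord w D i \<inter> gcirc (w j))" by (rule rev_finite_subset) (auto simp: chord_def)
  then have "clen j (chord w D i \<inter> gcirc (w j)) = 0"
    using emeasure_circ_measure_finite nrm assms by auto
  moreover have "clen j (chord w D i \<inter> gcirc (w j)) = clen j (chord w D i)"
    using AE_circ_measure_gcirc[of "w j"] nrm[of j] assms closed_chord[of i]
    by (intro emeasure_eq_AE) (auto elim: eventually_mono)
  ultimately show ?thesis by simp
qed

lemma sum_max_segments: "(\<Sum>\<^sub>\<infinity>m\<in>max_segments T. sigma1 m) = len"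
proof -
  have inj: "inj_on (chord w D) {3..<k}"
  proof (rule inj_onI, rule ccontr)
    fix i j assume ij: "i \<in> {3..<k}" "j \<in> {3..<k}" "chord w D i = chord w D j" "i \<noteq> j"
    have "chord w D i \<subseteq> gcirc (w i) \<inter> gcirc (w j)" using ij(3) by (auto simp: chord_def)
    moreover have "finite (gcirc (w i) \<inter> gcirc (w j))" using gcirc_inter_finite ij by auto
    ultimately have "finite (chord w D i)" by (rule finite_subset)
    then show False using infinite_chord[of i] ij(1) by auto
  qed
  have s: "sigma1 (chord w D i) = clen i (chord w D i)" if i: "i \<in> {3..<k}" for i
  proof -
    have "sigma1 (chord w D i) = (\<Sum>j\<in>{2..<k}. clen j (chord w D i))"
      using i by (intro sigma1_eq borel_closed closed_chord) (fastforce simp: chord_def)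
    also have "\<dots> = (\<Sum>j\<in>{2..<k}. if j = i then clen i (chord w D i) else 0)"
      using i clen_chord_other[of i] by (intro sum.cong) auto
    also have "\<dots> = clen i (chord w D i)" using i by simp
    finally show ?thesis .
  qed
  have "(\<Sum>\<^sub>\<infinity>m\<in>max_segments T. sigma1 m) = (\<Sum>i\<in>{3..<k}. sigma1 (chord w D i))"
    by (simp add: max_segments_eq sum.reindex[OF inj])
  also have "\<dots> = len" using s by (simp add: len_def)
  finally show ?thesis .
qed

end

section \<open>Splitting a cell\<close>

definition split_codes :: "nat \<Rightarrow> (nat \<times> bool) set \<Rightarrow> (nat \<times> bool) set set \<Rightarrow> (nat \<times> bool) set set" where
  "split_codes k c D = insert (insert (k, True) c) (insert (insert (k, False) c) (D - {c}))"

lemma eventually_strict_on_ray: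
  fixes p q :: real
  assumes "0 \<le> p" "p = 0 \<Longrightarrow> 0 < q"
  shows "\<forall>\<^sub>F t in at_right 0. 0 < p + t * q"
proof (cases "p = 0")
  case True
  then show ?thesis using assms eventually_at_right_less[of "0::real"] by (auto elim: eventually_mono)
next
  case False
  have "((\<lambda>t. p + t * q) \<longlongrightarrow> p + 0 * q) (at_right 0)" by (intro tendsto_intros)
  with False assms show ?thesis by (intro order_tendstoD(1)) auto
qed

lemma normal_upd: "fst a \<noteq> k \<Longrightarrow> normal (w(k := u)) a = normal w a"
  by (simp add: normal_def)

lemma hcone_upd: "k \<notin> fst ` c \<Longrightarrow> hcone (w(k := u)) c = hcone w c"
  unfolding hcone_def by (intro Collect_cong ball_cong) (auto simp: normal_def rev_image_eqI)

lemma cell_upd: "k \<notin> fst ` c \<Longrightarrow> cell (w(k := u)) c = cell w c"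
  by (simp add: cell_def hcone_upd)

lemma hcone_insert: "hcone w (insert a c) = hcone w c \<inter> {x. 0 \<le> normal w a \<bullet> x}"
  by (auto simp: hcone_def)

lemma cell_insert_upd:
  assumes "k \<notin> fst ` c"
  shows "cell (w(k := u)) (insert (k, b) c) = cell w c \<inter> hemi (if b then u else - u)"
  unfolding cell_def hcone_insert hcone_upd[OF assms] by (auto simp: normal_def hemi_def)

context good
begin

definition generic :: "pt \<Rightarrow> bool" where
  "generic u \<longleftrightarrow> norm u = 1 \<and> (\<forall>i<k. \<forall>j<k. i \<noteq> j \<longrightarrow> triple u (w i) (w j) \<noteq> 0)"

lemma AE_generic_sigma2: "AE u in sigma2. generic u"
proof -
  have "AE u in sigma2. \<forall>i\<in>{..<k}. \<forall>j\<in>{..<k} - {i}. triple u (w i) (w j) \<noteq> 0"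
  proof (intro AE_finite_allI)
    fix i j assume ij: "i \<in> {..<k}" "j \<in> {..<k} - {i}"
    then have ij': "i < k" "j < k" by auto
    obtain l where "l < k" "l \<noteq> i" "l \<noteq> j" using third_index[OF ij'] .
    then have "triple (w l) (w i) (w j) \<noteq> 0" using gp[of l i j] ij by auto
    then have "cross3 (w i) (w j) \<noteq> 0" by (auto simp: triple_def)
    then show "AE u in sigma2. triple u (w i) (w j) \<noteq> 0"
      unfolding triple_def by (rule AE_sigma2_inner_nonzero)
  qed auto
  with AE_sigma2_norm show ?thesis by eventually_elim (auto simp: generic_def)
qed

lemma generic_finite:
  assumes "generic u" "i < k"
  shows "finite (gcirc u \<inter> gcirc (w i))"
proof -
  obtain j where j: "j < k" "j \<noteq> i" using third_index[OF assms(2,2)] .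
  have "triple u (w i) (w j) \<noteq> 0" using assms j by (auto simp: generic_def)
  then obtain d where d: "u \<bullet> d = 0" "w i \<bullet> d = 1" using triple_inner_surj[of u "w i" "w j" 0 1 0] by blast
  then have "d \<noteq> 0" by auto
  with d have "sgn d \<in> gcirc u - gcirc (w i)"
    by (auto simp: gcirc_def S2_def norm_sgn sgn_div_norm)
  moreover have "norm u = 1" using assms by (simp add: generic_def)
  ultimately show ?thesis using gcirc_eq_or_finite[OF _ nrm[OF assms(2)], of u] by blast
qed

lemma sum_cells_circle:
  assumes u: "generic u"
  shows "(\<Sum>c\<in>D. emeasure (circ_measure u) (cell w c)) = 1"
proof -
  have nu: "norm u = 1" using u by (simp add: generic_def)
  have "(\<Sum>c\<in>D. emeasure (circ_measure u) (cell w c)) = 1 * emeasure (circ_measure u) UNIV"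
  proof (rule sum_emeasure_AE_indicator[OF fin])
    have "finite (\<Union>i\<in>{..<k}. gcirc u \<inter> gcirc (w i))" using generic_finite[OF u] by (intro finite_UN_I) auto
    from AE_circ_measure_notin_finite[OF nu this] AE_circ_measure_gcirc[OF nu]
    show "AE x in circ_measure u. (\<Sum>c\<in>D. indicator (cell w c) x) = 1 * (indicator UNIV x :: ennreal)"
    proof eventually_elim
      case x: (elim x)
      have xs: "x \<in> S2" using x by (simp add: gcirc_def)
      obtain c where c: "c \<in> D" "x \<in> hcone w c" using cover by blast
      have "x \<notin> cell w d" if d: "d \<in> D - {c}" for d
      proof
        assume "x \<in> cell w d"
        then have dd: "d \<in> D" "c \<noteq> d" "x \<in> hcone w d" using d by (auto simp: cell_def)
        obtain a where a: "a \<in> c" "flip a \<in> d" "w (fst a) \<bullet> x = 0"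
          using sep_zero[OF c(1) dd(1,2) c(2) dd(3)] .
        then show False using x xs index_lt[OF c(1) a(1)] by (auto simp: gcirc_def)
      qed
      then have "(\<Sum>d\<in>D - {c}. indicator (cell w d) x) = (0::ennreal)" by (intro sum.neutral) auto
      then show ?case
        using c xs fin by (simp add: sum.remove[of D c] cell_def)
    qed
  qed (auto simp: nu)
  then show ?thesis using prob_space_circ_measure[OF nu] by simp
qed

text \<open>General position allows at most two circles through \<open>x\<close>; fewer are padded
  to two different indices, so that \<open>generic u\<close> applies to the pair.\<close>

lemma active_indices:
  assumes c: "c \<in> D" and x: "x \<noteq> 0"
  obtains i j where "i < k" "j < k" "i \<noteq> j" "\<And>a. a \<in> c \<Longrightarrow> w (fst a) \<bullet> x = 0 \<Longrightarrow> fst a = i \<or> fst a = j"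
proof (cases "\<exists>a\<in>c. w (fst a) \<bullet> x = 0")
  case False
  then show thesis using that[of 0 1] k_ge by auto
next
  case True
  then obtain a where a: "a \<in> c" "w (fst a) \<bullet> x = 0" by blast
  have ak: "fst a < k" using index_lt c a by blast
  show thesis
  proof (cases "\<exists>b\<in>c. w (fst b) \<bullet> x = 0 \<and> fst b \<noteq> fst a")
    case True
    then obtain b where b: "b \<in> c" "w (fst b) \<bullet> x = 0" "fst b \<noteq> fst a" by blast
    have bk: "fst b < k" using index_lt c b by blast
    show thesis
    proof (rule that[OF ak bk])
      fix e assume e: "e \<in> c" "w (fst e) \<bullet> x = 0"
      then have "fst e < k" using index_lt c by blast
      then show "fst e = fst a \<or> fst e = fst b"
        using three_zero[OF ak bk _ _ _ _ a(2) b(2) e(2)] b(3) x by metis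
    qed (use b in auto)
  next
    case False
    obtain j where j: "j < k" "j \<noteq> fst a" using third_index[OF ak ak] .
    show thesis
    proof (rule that[OF ak j(1) j(2)[symmetric]])
      show "fst e = fst a \<or> fst e = j" if "e \<in> c" "w (fst e) \<bullet> x = 0" for e
        using False that by blast
    qed
  qed
qed

text \<open>At the common point \<open>x\<close> the vector \<open>u\<close> and the at most two
  active normals are independent. A direction \<open>d\<close> can therefore enter all active
  half-spaces and at the same time move to either side of the new circle; the sign of
  \<open>s\<close> selects the side.\<close>

lemma strict_side:
  assumes c: "c \<in> D" and u: "generic u" "u \<in> hits (cell w c)" and s: "s \<noteq> 0"
  obtains q where "\<forall>a\<in>c. 0 < normal w a \<bullet> q" "0 < s * (u \<bullet> q)"
proof -
  obtain x where x: "x \<in> cell w c" "u \<bullet> x = 0" using u by (auto simp: hits_def gcirc_def)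
  have x0: "x \<noteq> 0" using x by (auto simp: cell_def S2_def)
  obtain i j where ij: "i < k" "j < k" "i \<noteq> j"
    and act: "\<And>a. a \<in> c \<Longrightarrow> w (fst a) \<bullet> x = 0 \<Longrightarrow> fst a = i \<or> fst a = j"
    by (rule active_indices[OF c x0]) blast
  have "triple u (w i) (w j) \<noteq> 0" using u ij by (auto simp: generic_def)
  \<comment> \<open>The signs follow the code, so that \<open>normal w a \<bullet> d = 1\<close> for
    every active \<open>a\<close>, whichever side of its circle the cell is on.\<close>
  then obtain d where d: "u \<bullet> d = s" "w i \<bullet> d = (if (i, True) \<in> c then 1 else -1)"
    "w j \<bullet> d = (if (j, True) \<in> c then 1 else -1)"
    by (rule triple_inner_surj)
  have pos: "0 < normal w a \<bullet> d" if a: "a \<in> c" "w (fst a) \<bullet> x = 0" for a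
  proof -
    have "(fst a, True) \<in> c \<longleftrightarrow> snd a"
      using a(1) code_index_unique[OF c a(1), of "(fst a, True)"] by (cases a) auto
    then show ?thesis using act[OF a] d by (auto simp: normal_def)
  qed
  have "\<forall>\<^sub>F t in at_right 0. \<forall>a\<in>c. 0 < normal w a \<bullet> x + t * (normal w a \<bullet> d)"
  proof (intro eventually_ball_finite finite_code[OF c] ballI eventually_strict_on_ray)
    fix a assume a: "a \<in> c"
    show "0 \<le> normal w a \<bullet> x" using x a by (auto simp: cell_def hcone_def)
    show "normal w a \<bullet> x = 0 \<Longrightarrow> 0 < normal w a \<bullet> d" using pos[OF a] by simp
  qed
  with eventually_at_right_less[of "0::real"]
  have "\<forall>\<^sub>F t in at_right 0. 0 < t \<and> (\<forall>a\<in>c. 0 < normal w a \<bullet> x + t * (normal w a \<bullet> d))"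
    by eventually_elim auto
  from eventually_happens'[OF _ this] obtain t where t: "0 < t" "\<forall>a\<in>c. 0 < normal w a \<bullet> x + t * (normal w a \<bullet> d)"
    by (auto simp: trivial_limit_at_right_real)
  show thesis
  proof (rule that[of "x + t *\<^sub>R d"])
    show "\<forall>a\<in>c. 0 < normal w a \<bullet> (x + t *\<^sub>R d)" using t by (simp add: inner_add_right)
    have "0 < s * s" using s by (meson not_real_square_gt_zero)
    then have "0 < t * (s * s)" using t(1) by (rule mult_pos_pos[rotated])
    moreover have "u \<bullet> (x + t *\<^sub>R d) = t * s" using x d by (simp add: inner_add_right)
    ultimately show "0 < s * (u \<bullet> (x + t *\<^sub>R d))" by (simp add: mult.left_commute)
  qed
qed

lemma is_segment_cut:
  assumes c: "c \<in> D" and u: "generic u" "u \<in> hits (cell w c)"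
  shows "is_segment (cell w c \<inter> gcirc u)"
proof -
  obtain p where p: "\<forall>a\<in>c. 0 < normal w a \<bullet> p" "0 < u \<bullet> p" by (rule strict_side[OF c u, of 1]) auto
  obtain q where q: "\<forall>a\<in>c. 0 < normal w a \<bullet> q" "u \<bullet> q < 0" by (rule strict_side[OF c u, of "-1"]) auto
  \<comment> \<open>Both weights are positive and cancel the inner product with \<open>u\<close>:
    the result lies on the cutting plane and still satisfies all constraints of the cell
    strictly.\<close>
  define z where "z = (- (u \<bullet> q)) *\<^sub>R p + (u \<bullet> p) *\<^sub>R q"
  have z: "u \<bullet> z = 0" by (simp add: z_def inner_diff_right)
  have zp: "0 < normal w a \<bullet> z" if "a \<in> c" for a
    unfolding z_def inner_add_right inner_scaleR_right
    by (rule add_pos_pos; rule mult_pos_pos) (use p q that in auto)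
  have ne: "c \<noteq> {}" using eq_code[OF c] by auto
  then obtain a0 where "a0 \<in> c" by blast
  from zp[OF this] have "z \<noteq> 0" by auto
  define x where "x = sgn z"
  have x: "norm x = 1" "u \<bullet> x = 0" using \<open>z \<noteq> 0\<close> z by (auto simp: x_def norm_sgn sgn_div_norm)
  have xp: "0 < normal w a \<bullet> x" if "a \<in> c" for a
    using zp[OF that] \<open>z \<noteq> 0\<close> by (simp add: x_def sgn_div_norm)
  have nu: "norm u = 1" using u by (simp add: generic_def)
  obtain y where f: "frame u x y" using frame_extend[OF nu x] .
  have o: "orthonormal2 x y" using f by (simp add: frame_def)
  obtain al be where ab: "- pi < al" "al < 0" "0 < be" "be < pi"
    "\<forall>\<theta>\<in>{-pi..pi}. (\<forall>a\<in>c. 0 \<le> normal w a \<bullet> circ_pt x y \<theta>) \<longleftrightarrow> al \<le> \<theta> \<and> \<theta> \<le> be"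
    "\<exists>a\<in>c. normal w a \<bullet> circ_pt x y al = 0" "\<exists>a\<in>c. normal w a \<bullet> circ_pt x y be = 0"
    by (rule arc_of_halfspaces[where n = "normal w" and x = x and y = y, OF finite_code[OF c] ne xp])
  have "cell w c \<inter> gcirc u = circ_pt x y ` {al..be}"
  proof (intro equalityI subsetI)
    fix v assume v: "v \<in> cell w c \<inter> gcirc u"
    then obtain \<theta> where th: "0 \<le> \<theta>" "\<theta> < 2 * pi" "v = circ_pt x y \<theta>"
      using frame_circ_pt_obtain[OF f, of v] by (auto simp: gcirc_def S2_def)
    define \<theta>' where "\<theta>' = (if \<theta> \<le> pi then \<theta> else \<theta> - 2 * pi)"
    have th': "\<theta>' \<in> {-pi..pi}" "v = circ_pt x y \<theta>'" using th by (auto simp: \<theta>'_def circ_pt_periodic)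
    moreover have "\<forall>a\<in>c. 0 \<le> normal w a \<bullet> v" using v by (auto simp: cell_def hcone_def)
    ultimately have "al \<le> \<theta>' \<and> \<theta>' \<le> be" using ab(5) by blast
    then show "v \<in> circ_pt x y ` {al..be}" using th' by auto
  next
    fix v assume "v \<in> circ_pt x y ` {al..be}"
    then obtain \<theta> where th: "al \<le> \<theta>" "\<theta> \<le> be" "v = circ_pt x y \<theta>" by auto
    moreover have "\<theta> \<in> {-pi..pi}" using th ab(1-4) by auto
    ultimately have "\<forall>a\<in>c. 0 \<le> normal w a \<bullet> v" using ab(5) by blast
    moreover have "v \<in> gcirc u" unfolding gcirc_frame_range[OF f] th(3) by (rule rangeI)
    ultimately show "v \<in> cell w c \<inter> gcirc u" by (simp add: cell_def hcone_def gcirc_def)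
  qed
  then have "cell w c \<inter> gcirc u = sph_arc (circ_pt x y al) (circ_pt x y (al + pi/2)) (be - al)"
    by (simp only: circ_pt_image_eq_sph_arc)
  moreover have "0 < be - al" "be - al < 2 * pi" using ab(1-4) by auto
  ultimately show ?thesis unfolding is_segment_def using orthonormal2_circ_pt[OF o, of al] by blast
qed

lemma k_notin: "c \<in> D \<Longrightarrow> k \<notin> fst ` c"
  using codes by force

lemma insert_notin: "c \<in> D \<Longrightarrow> insert (k, b) c' \<notin> D"
  using k_notin by fastforce

text \<open>Both halves of \<open>c\<close> inherit its sides and together cover it, so a split
  leaves all earlier chords intact. This makes the total length additive.\<close>

lemma chord_split_old:
  assumes c: "c \<in> D" and i: "i < k"
  shows "chord (w(k := u)) (split_codes k c D) i = chord w D i"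
proof -
  have h: "hemi u \<union> hemi (- u) = S2" by (auto simp: hemi_def)
  have cs: "cell w c \<subseteq> S2" by (auto simp: cell_def)
  have D: "{d \<in> split_codes k c D. i \<in> fst ` d} =
      {d \<in> D - {c}. i \<in> fst ` d} \<union> (if i \<in> fst ` c then {insert (k, True) c, insert (k, False) c} else {})"
    using i by (auto simp: split_codes_def)
  have u: "(w(k := u)) i = w i" using i by simp
  have a: "(\<Union>d\<in>{d \<in> D - {c}. i \<in> fst ` d}. cell (w(k := u)) d \<inter> gcirc (w i))
     = (\<Union>d\<in>{d \<in> D - {c}. i \<in> fst ` d}. cell w d \<inter> gcirc (w i))"
    using cell_upd k_notin by (intro SUP_cong) auto
  have b: "(\<Union>d\<in>(if i \<in> fst ` c then {insert (k, True) c, insert (k, False) c} else {}). cell (w(k := u)) d \<inter> gcirc (w i))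
     = (\<Union>d\<in>(if i \<in> fst ` c then {c} else {}). cell w d \<inter> gcirc (w i))"
    using h cs by (auto simp: cell_insert_upd[OF k_notin[OF c]])
  have "chord (w(k := u)) (split_codes k c D) i
     = (\<Union>d\<in>{d \<in> D - {c}. i \<in> fst ` d}. cell w d \<inter> gcirc (w i))
      \<union> (\<Union>d\<in>(if i \<in> fst ` c then {c} else {}). cell w d \<inter> gcirc (w i))"
    unfolding chord_def D u UN_Un a b ..
  also have "\<dots> = (\<Union>d\<in>{d \<in> D - {c}. i \<in> fst ` d} \<union> (if i \<in> fst ` c then {c} else {}). cell w d \<inter> gcirc (w i))"
    by (simp only: UN_Un)
  also have "{d \<in> D - {c}. i \<in> fst ` d} \<union> (if i \<in> fst ` c then {c} else {}) = {d \<in> D. i \<in> fst ` d}"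
    using c by auto
  finally show ?thesis unfolding chord_def .
qed

lemma chord_split_new:
  assumes c: "c \<in> D"
  shows "chord (w(k := u)) (split_codes k c D) k = cell w c \<inter> gcirc u"
proof -
  have h: "hemi u \<union> hemi (- u) = S2" by (auto simp: hemi_def)
  have cs: "cell w c \<subseteq> S2" by (auto simp: cell_def)
  have "{d \<in> split_codes k c D. k \<in> fst ` d} = {insert (k, True) c, insert (k, False) c}"
    using k_notin by (auto simp: split_codes_def)
  then show ?thesis unfolding chord_def using h cs by (auto simp: cell_insert_upd[OF k_notin[OF c]])
qed

lemma tess_split:
  assumes c: "c \<in> D"
  shows "tess (w(k := u)) (split_codes k c D) = split_cell (tess w D) (cell w c) u"
proof -
  have "cell (w(k := u)) ` (D - {c}) = cell w ` (D - {c})"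
    using cell_upd k_notin by (intro image_cong) auto
  also have "\<dots> = cell w ` D - {cell w c}" using inj_cell c by (auto dest: inj_onD)
  finally show ?thesis
    by (auto simp: tess_def split_codes_def split_cell_def cell_insert_upd[OF k_notin[OF c]])
qed

text \<open>The invariant is endangered mainly by a half without interior points, as when the circle
  only touches a corner; \<open>strict_side\<close> excludes this for generic
  \<open>u\<close>.\<close>

theorem good_split:
  assumes c: "c \<in> D" and u: "generic u" "u \<in> hits (cell w c)"
  shows "good (w(k := u)) (Suc k) (split_codes k c D)"
proof
  let ?w = "w(k := u)"
  have cases: "d \<in> D - {c} \<or> (\<exists>b. d = insert (k, b) c)" if "d \<in> split_codes k c D" for d
    using that unfolding split_codes_def by blast
  show "3 \<le> Suc k" using k_ge by simp
  show "?w 0 = axis 1 1" "?w 1 = axis 2 1" "?w 2 = north" using base k_ge by auto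
  show "norm (?w i) = 1" if "i < Suc k" for i using that nrm u by (auto simp: generic_def less_Suc_eq)
  show "triple (?w i) (?w j) (?w l) \<noteq> 0"
    if h: "i < Suc k" "j < Suc k" "l < Suc k" "i \<noteq> j" "i \<noteq> l" "j \<noteq> l" for i j l
  proof -
    have g: "triple u (w i) (w j) \<noteq> 0" if "i < k" "j < k" "i \<noteq> j" for i j using u that by (auto simp: generic_def)
    consider "i = k" "j < k" "l < k" | "j = k" "i < k" "l < k" | "l = k" "i < k" "j < k" | "i < k" "j < k" "l < k"
      using h by (auto simp: less_Suc_eq)
    then show ?thesis
    proof cases
      case 1 then show ?thesis using g h by simp
    next
      case 2
      then have "triple u (w i) (w l) \<noteq> 0" using g h by blast
      then show ?thesis using 2 by (simp add: triple_swap(1)[of "w i" u])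
    next
      case 3
      then have "triple u (w i) (w j) \<noteq> 0" using g h by blast
      then show ?thesis using 3 by (simp add: triple_cyc[of "w i" "w j" u])
    next
      case 4 then show ?thesis using gp h by simp
    qed
  qed
  show "finite (split_codes k c D)" using fin by (simp add: split_codes_def)
  show "fst ` d \<subseteq> {2..<Suc k}" if "d \<in> split_codes k c D" for d
  proof -
    have sub: "fst ` e \<subseteq> {2..<Suc k}" if "e \<in> D" for e using codes[OF that] by auto
    from cases[OF that] show ?thesis
    proof
      assume "\<exists>b. d = insert (k, b) c"
      then show ?thesis using sub[OF c] k_ge by auto
    qed (use sub in blast)
  qed
  show "2 \<in> fst ` d" if "d \<in> split_codes k c D" for d
    using cases[OF that] eq_code[of d] eq_code[OF c] by auto
  have ins: "\<exists>q. \<forall>a\<in>insert (k, b) c. 0 < normal ?w a \<bullet> q" for b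
  proof -
    define s :: real where "s = (if b then 1 else -1)"
    have "s \<noteq> 0" by (simp add: s_def)
    then obtain q where q: "\<forall>a\<in>c. 0 < normal w a \<bullet> q" "0 < s * (u \<bullet> q)" by (rule strict_side[OF c u])
    have "0 < normal ?w a \<bullet> q" if "a \<in> insert (k, b) c" for a
    proof (cases "a = (k, b)")
      case True
      then show ?thesis using q(2) by (auto simp: normal_def s_def split: if_splits)
    next
      case False
      then have "a \<in> c" using that by blast
      moreover then have "fst a \<noteq> k" using index_lt[OF c] by blast
      ultimately show ?thesis using q(1) by (simp add: normal_upd)
    qed
    then show ?thesis by blast
  qed
  show "\<exists>q. \<forall>a\<in>d. 0 < normal ?w a \<bullet> q" if "d \<in> split_codes k c D" for d
  proof -
    from cases[OF that] show ?thesis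
    proof
      assume "d \<in> D - {c}"
      then have 3: "d \<in> D" by blast
      obtain q where q: "\<forall>a\<in>d. 0 < normal w a \<bullet> q" using strict[OF 3] by blast
      have "0 < normal ?w a \<bullet> q" if "a \<in> d" for a
      proof -
        have "fst a \<noteq> k" using index_lt[OF 3 that] by simp
        from normal_upd[OF this, of w u] show ?thesis using bspec[OF q that] by metis
      qed
      then show ?thesis by blast
    next
      assume "\<exists>b. d = insert (k, b) c"
      then show ?thesis using ins by blast
    qed
  qed
  show "\<exists>d\<in>split_codes k c D. x \<in> hcone ?w d" for x
  proof -
    obtain d where d: "d \<in> D" "x \<in> hcone w d" using cover by blast
    show ?thesis
    proof (cases "d = c")
      case False
      then show ?thesis using d hcone_upd[OF k_notin[OF d(1)]]
        by (intro bexI[of _ d]) (auto simp: split_codes_def)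
    next
      case True
      have "x \<in> hcone ?w (insert (k, 0 \<le> u \<bullet> x) c)"
        using d True by (auto simp: hcone_insert hcone_upd[OF k_notin[OF c]] normal_def)
      moreover have "insert (k, 0 \<le> u \<bullet> x) c \<in> split_codes k c D"
        by (cases "0 \<le> u \<bullet> x") (auto simp: split_codes_def)
      ultimately show ?thesis by blast
    qed
  qed
  show "\<exists>a\<in>d. flip a \<in> e" if "d \<in> split_codes k c D" "e \<in> split_codes k c D" "d \<noteq> e" for d e
  proof -
    have sepc: "\<exists>a\<in>c. flip a \<in> e" "\<exists>a\<in>e. flip a \<in> c" if "e \<in> D - {c}" for e
      using sep[OF c, of e] sep[of e c] that c by auto
    have new: "\<exists>a\<in>insert (k, b) c. flip a \<in> insert (k, \<not> b) c" for b
      by (intro bexI[of _ "(k, b)"]) (auto simp: flip_def)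
    from cases[OF that(1)] show ?thesis
    proof
      assume d: "d \<in> D - {c}"
      from cases[OF that(2)] show ?thesis
      proof
        assume "e \<in> D - {c}"
        then show ?thesis using sep[of d e] d that(3) by blast
      next
        assume "\<exists>b. e = insert (k, b) c"
        then show ?thesis using sepc(2)[OF d] by blast
      qed
    next
      assume "\<exists>b. d = insert (k, b) c"
      then obtain b where b: "d = insert (k, b) c" by blast
      from cases[OF that(2)] show ?thesis
      proof
        assume e: "e \<in> D - {c}"
        then show ?thesis using sepc(1)[OF e] b by blast
      next
        assume "\<exists>b. e = insert (k, b) c"
        then obtain b' where b': "e = insert (k, b') c" by blast
        then have "b' = (\<not> b)" using b that(3) by auto
        then show ?thesis using new[of b] b b' by simp
      qed
    qed
  qed
  show "is_segment (chord ?w (split_codes k c D) i)" if "3 \<le> i" "i < Suc k" for i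
  proof (cases "i = k")
    case True
    then show ?thesis using is_segment_cut[OF c u] by (simp only: chord_split_new[OF c])
  next
    case False
    then have "i < k" using that by simp
    then show ?thesis using seg[OF that(1)] by (simp only: chord_split_old[OF c])
  qed
  show "card (split_codes k c D) = Suc k - 1"
  proof -
    have "(k, True) \<notin> insert (k, False) c" using k_notin[OF c] by force
    then have "insert (k, True) c \<noteq> insert (k, False) c" by blast
    moreover have "insert (k, b) c \<notin> D" for b using insert_notin[OF c] by blast
    ultimately have "card (split_codes k c D) = Suc (Suc (card (D - {c})))"
      using fin by (simp add: split_codes_def)
    then show ?thesis using card_D k_ge fin c by (simp add: card_Diff_singleton)
  qed
qed

lemma len_split:
  assumes c: "c \<in> D" and u: "generic u" "u \<in> hits (cell w c)"
  shows "good.len (w(k := u)) (Suc k) (split_codes k c D) = len + emeasure (circ_measure u) (cell w c)"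
proof -
  interpret s: good "w(k := u)" "Suc k" "split_codes k c D" by (rule good_split[OF assms])
  have nu: "norm u = 1" using u by (simp add: generic_def)
  have "{3..<Suc k} = insert k {3..<k}" using k_ge by auto
  then have "s.len = emeasure (circ_measure u) (cell w c \<inter> gcirc u)
      + (\<Sum>i\<in>{3..<k}. emeasure (circ_measure ((w(k := u)) i)) (chord (w(k := u)) (split_codes k c D) i))"
    by (simp add: s.len_def chord_split_new[OF c])
  also have "(\<Sum>i\<in>{3..<k}. emeasure (circ_measure ((w(k := u)) i)) (chord (w(k := u)) (split_codes k c D) i)) = len"
    unfolding len_def using chord_split_old[OF c] by (intro sum.cong) auto
  also have "emeasure (circ_measure u) (cell w c \<inter> gcirc u) = emeasure (circ_measure u) (cell w c)"
    using AE_circ_measure_gcirc[OF nu] nu by (intro emeasure_eq_AE) (auto elim: eventually_mono)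
  finally show ?thesis by (simp only: add.commute)
qed

lemma emeasure_cell_not_hit:
  assumes "norm u = 1" "u \<notin> hits (cell w c)"
  shows "emeasure (circ_measure u) (cell w c) = 0"
proof -
  have "emeasure (circ_measure u) (cell w c) = emeasure (circ_measure u) {}"
    using AE_circ_measure_gcirc[OF assms(1)] assms
    by (intro emeasure_eq_AE) (auto simp: hits_def elim!: eventually_mono)
  then show ?thesis by simp
qed

lemma len_le: "len \<le> of_nat k"
proof -
  have "len \<le> (\<Sum>i\<in>{3..<k}. 1)" unfolding len_def
  proof (rule sum_mono)
    fix i assume "i \<in> {3..<k}"
    then have i: "norm (w i) = 1" using nrm by auto
    have "clen i (chord w D i) \<le> clen i UNIV"
      using i by (intro emeasure_mono) auto
    then show "clen i (chord w D i) \<le> 1" using prob_space_circ_measure[OF i] by simp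
  qed
  also have "\<dots> \<le> of_nat k" by simp
  finally show ?thesis .
qed

end

definition w0 :: "nat \<Rightarrow> pt" where
  "w0 = (\<lambda>i. north)(0 := axis 1 1, 1 := axis 2 1)"

definition D0 :: "(nat \<times> bool) set set" where
  "D0 = {{(2, True)}, {(2, False)}}"

lemma good_Y0: "good w0 3 D0"
proof
  show "norm (w0 i) = 1" if "i < 3" for i by (auto simp: w0_def north_def)
  show "triple (w0 i) (w0 j) (w0 l) \<noteq> 0" if h: "i < 3" "j < 3" "l < 3" "i \<noteq> j" "i \<noteq> l" "j \<noteq> l" for i j l
  proof -
    have t: "triple (w0 0) (w0 1) (w0 2) = 1" using triple_axes by (simp add: w0_def north_def)
    have t': "triple (w0 0) (w0 2) (w0 1) = -1" "triple (w0 1) (w0 0) (w0 2) = -1"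
      "triple (w0 1) (w0 2) (w0 0) = 1" "triple (w0 2) (w0 0) (w0 1) = 1" "triple (w0 2) (w0 1) (w0 0) = -1"
      using t triple_swap[of "w0 1" "w0 0" "w0 2"] triple_swap[of "w0 0" "w0 1" "w0 2"]
        triple_cyc[of "w0 1" "w0 2" "w0 0"] triple_cyc[of "w0 2" "w0 0" "w0 1"]
        triple_cyc[of "w0 2" "w0 1" "w0 0"] triple_swap[of "w0 0" "w0 2" "w0 1"] by linarith+
    have "i = 0 \<or> i = 1 \<or> i = 2" "j = 0 \<or> j = 1 \<or> j = 2" "l = 0 \<or> l = 1 \<or> l = 2" using h by auto
    then show ?thesis using h(4-6) t t' by (elim disjE) (simp_all del: One_nat_def)
  qed
  show "\<exists>q. \<forall>a\<in>c. 0 < normal w0 a \<bullet> q" if "c \<in> D0" for c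
  proof -
    have n: "normal w0 (2, True) = north" "normal w0 (2, False) = - north" by (simp_all add: normal_def w0_def)
    have "north \<bullet> north = 1" by (simp add: north_def inner_axis_axis)
    then have "\<forall>a\<in>{(2, True)}. 0 < normal w0 a \<bullet> north" "\<forall>a\<in>{(2, False)}. 0 < normal w0 a \<bullet> (- north)"
      using n by auto
    then show ?thesis using that unfolding D0_def by blast
  qed
  show "\<exists>c\<in>D0. x \<in> hcone w0 c" for x
    by (cases "0 \<le> north \<bullet> x") (auto simp: D0_def hcone_def normal_def w0_def)
  show "card D0 = 3 - 1" by (simp add: D0_def)
  show "\<exists>a\<in>c. flip a \<in> c'" if "c \<in> D0" "c' \<in> D0" "c \<noteq> c'" for c c'
    using that by (auto simp: D0_def flip_def)
qed (auto simp: w0_def D0_def)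

lemma tess_Y0: "tess w0 D0 = Y0"
proof -
  have "cell w0 {(2, True)} = hemi north" "cell w0 {(2, False)} = hemi (- north)"
    by (auto simp: cell_def hcone_def hemi_def normal_def w0_def)
  then show ?thesis by (simp add: tess_def D0_def Y0_def)
qed

lemma len_Y0: "good.len w0 3 D0 = 0"
  by (simp add: good.len_def[OF good_Y0])

section \<open>Measurability\<close>

text \<open>Projection along a compact factor is a closed map. The compact factor will be the
  sphere, and the other one the pairs of a sequence of normals and a new normal.\<close>

lemma closed_compact_projection_general:
  fixes S :: "'a::topological_space set" and T :: "('a \<times> 'b::topological_space) set"
  assumes "compact S" "closed T"
  shows "closed {y. \<exists>x\<in>S. (x, y) \<in> T}"
proof -
  let ?P = "prod_topology (top_of_set S) (euclidean :: 'b topology)"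
  have P: "?P = top_of_set (S \<times> UNIV)"
    using prod_topology_subtopology(1)[of euclidean S "euclidean :: 'b topology"]
    by (simp add: euclidean_product_topology)
  have "compact_space (top_of_set S)" using assms(1) by (simp add: compact_space_subtopology)
  then have "closed_map ?P euclidean snd" by (rule closed_map_snd)
  moreover have "closedin ?P ((S \<times> UNIV) \<inter> T)"
    unfolding P using assms(2) by (simp add: closedin_closed_Int)
  ultimately have "closedin euclidean (snd ` ((S \<times> UNIV) \<inter> T))" unfolding closed_map_def by blast
  moreover have "snd ` ((S \<times> UNIV) \<inter> T) = {y. \<exists>x\<in>S. (x, y) \<in> T}" by force
  ultimately show ?thesis by simp
qed

text \<open>Hitting a cell means the existence of a point in the compact sphere subject to closed
  conditions. Closedness is joint in \<open>w\<close> and \<open>u\<close> because the entries of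
  \<open>w\<close> are themselves integration variables of earlier splits.\<close>

lemma closed_hits_joint: "closed {(w, u). u \<in> hits (cell w c)}"
proof -
  let ?T = "(\<Inter>a\<in>c. {p :: pt \<times> (nat \<Rightarrow> pt) \<times> pt. 0 \<le> normal (fst (snd p)) a \<bullet> fst p})
    \<inter> {p. snd (snd p) \<bullet> fst p = 0}"
  have coord: "continuous_on UNIV (\<lambda>p :: pt \<times> (nat \<Rightarrow> pt) \<times> pt. (fst (snd p)) i)" for i
    by (rule continuous_on_product_then_coordinatewise) (intro continuous_on_fst continuous_on_snd continuous_on_id)
  have n: "continuous_on UNIV (\<lambda>p :: pt \<times> (nat \<Rightarrow> pt) \<times> pt. normal (fst (snd p)) a)" for a
    using coord[of "fst a"] continuous_on_minus[OF coord[of "fst a"]] by (cases "snd a") (simp_all add: normal_def)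
  have x: "continuous_on UNIV (\<lambda>p :: pt \<times> (nat \<Rightarrow> pt) \<times> pt. fst p)"
    "continuous_on UNIV (\<lambda>p :: pt \<times> (nat \<Rightarrow> pt) \<times> pt. snd (snd p))"
    by (intro continuous_on_fst continuous_on_snd continuous_on_id)+
  have "closed {p :: pt \<times> (nat \<Rightarrow> pt) \<times> pt. 0 \<le> normal (fst (snd p)) a \<bullet> fst p}" for a
    by (rule closed_Collect_le[OF continuous_on_const continuous_on_inner[OF n x(1)]])
  moreover have "closed {p :: pt \<times> (nat \<Rightarrow> pt) \<times> pt. snd (snd p) \<bullet> fst p = 0}"
    by (rule closed_Collect_eq[OF continuous_on_inner[OF x(2,1)] continuous_on_const])
  ultimately have "closed ?T" by (intro closed_Int closed_INT ballI)
  moreover have "compact S2" by (simp add: S2_def)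
  ultimately have "closed {y. \<exists>x\<in>S2. (x, y) \<in> ?T}" by (intro closed_compact_projection_general)
  moreover have "{y. \<exists>x\<in>S2. (x, y) \<in> ?T} = {(w, u). u \<in> hits (cell w c)}"
  proof (rule set_eqI)
    fix y :: "(nat \<Rightarrow> pt) \<times> pt"
    obtain w u where y: "y = (w, u)" by (cases y)
    have "(x, w, u) \<in> ?T \<longleftrightarrow> (\<forall>a\<in>c. 0 \<le> normal w a \<bullet> x) \<and> u \<bullet> x = 0" for x by simp
    moreover have "u \<in> hits (cell w c) \<longleftrightarrow> (\<exists>x\<in>S2. (\<forall>a\<in>c. 0 \<le> normal w a \<bullet> x) \<and> u \<bullet> x = 0)"
      unfolding hits_def gcirc_def cell_def hcone_def by blast
    ultimately show "y \<in> {y. \<exists>x\<in>S2. (x, y) \<in> ?T} \<longleftrightarrow> y \<in> {(w, u). u \<in> hits (cell w c)}"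
      unfolding y mem_Collect_eq prod.case by (simp only:)
  qed
  ultimately show ?thesis by simp
qed

lemma measurable_indicator_hits [measurable]:
  assumes [measurable]: "W \<in> borel_measurable M" "U \<in> borel_measurable M"
  shows "(\<lambda>z. indicator (hits (cell (W z) c)) (U z) :: ennreal) \<in> borel_measurable M"
proof -
  have "{(w, u). u \<in> hits (cell w c)} \<in> sets (borel \<Otimes>\<^sub>M borel)"
    unfolding borel_prod by (rule borel_closed[OF closed_hits_joint])
  then have "(\<lambda>z. indicator {(w, u). u \<in> hits (cell w c)} (W z, U z) :: ennreal) \<in> borel_measurable M"
    by (intro measurable_compose[OF measurable_Pair[OF assms]] borel_measurable_indicator)
  also have "(\<lambda>z. indicator {(w, u). u \<in> hits (cell w c)} (W z, U z)) = (\<lambda>z. indicator (hits (cell (W z) c)) (U z) :: ennreal)"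
    by (auto simp: indicator_def)
  finally show ?thesis .
qed

lemma borel_hits [measurable]: "hits (cell w c) \<in> sets borel"
proof -
  have "(\<lambda>u. indicator (hits (cell w c)) u :: ennreal) \<in> borel_measurable borel"
    by (rule measurable_indicator_hits) simp_all
  then show ?thesis by (simp add: borel_measurable_indicator_iff)
qed

lemma measurable_normal [measurable]:
  assumes [measurable]: "W \<in> borel_measurable M"
  shows "(\<lambda>z. normal (W z) a) \<in> borel_measurable M"
proof -
  have [measurable]: "(\<lambda>z. W z i) \<in> borel_measurable M" for i
    by (rule measurable_product_then_coordinatewise) measurable
  show ?thesis by (cases "snd a") (simp_all add: normal_def)
qed

lemma measurable_pred_cell [measurable]:
  assumes [measurable]: "W \<in> borel_measurable M" "X \<in> borel_measurable M" and c: "finite c"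
  shows "Measurable.pred M (\<lambda>z. X z \<in> cell (W z) c)"
proof -
  have "(\<lambda>z. X z \<in> cell (W z) c) = (\<lambda>z. norm (X z) = 1 \<and> (\<forall>a\<in>c. 0 \<le> normal (W z) a \<bullet> X z))"
    by (auto simp: cell_def hcone_def S2_def)
  moreover have "Measurable.pred M (\<lambda>z. norm (X z) = 1 \<and> (\<forall>a\<in>c. 0 \<le> normal (W z) a \<bullet> X z))"
    using c by (intro pred_intros_logic pred_intros_finite) measurable
  ultimately show ?thesis by simp
qed

text \<open>Written as an integral over the angle, the length is measurable in the parameter by
  Tonelli's theorem.\<close>

lemma measurable_frame_len:
  assumes [measurable]: "A \<in> borel_measurable M" "B \<in> borel_measurable M"
    and Q: "Measurable.pred (M \<Otimes>\<^sub>M borel) (\<lambda>(z, x). Q z x)"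
  shows "(\<lambda>z. frame_len (A z) (B z) {x. Q z x}) \<in> borel_measurable M"
proof -
  have c [measurable]: "(\<lambda>p. circ_pt (A (fst p)) (B (fst p)) (snd p)) \<in> borel_measurable (M \<Otimes>\<^sub>M (borel :: real measure))"
    unfolding circ_pt_def by measurable
  have P: "Measurable.pred (M \<Otimes>\<^sub>M borel) (\<lambda>p. Q (fst p) (circ_pt (A (fst p)) (B (fst p)) (snd p)))"
    using measurable_compose[OF measurable_Pair[OF measurable_fst c] Q] by simp
  have sec: "{\<theta> \<in> {0..<2*pi}. Q z (circ_pt (A z) (B z) \<theta>)} \<in> sets borel" if "z \<in> space M" for z
  proof -
    have "Measurable.pred borel (\<lambda>\<theta>. Q z (circ_pt (A z) (B z) \<theta>))"
      using measurable_compose[OF measurable_Pair1'[OF that, of borel] P] by simp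
    then have [measurable]: "{\<theta>. Q z (circ_pt (A z) (B z) \<theta>)} \<in> sets borel" by (simp add: pred_def)
    have "{\<theta> \<in> {0..<2*pi}. Q z (circ_pt (A z) (B z) \<theta>)} = {0..<2*pi} \<inter> {\<theta>. Q z (circ_pt (A z) (B z) \<theta>)}" by auto
    then show ?thesis by simp
  qed
  have "(\<lambda>z. \<integral>\<^sup>+\<theta>. indicator {0..<2*pi} \<theta> * (if Q z (circ_pt (A z) (B z) \<theta>) then 1 else 0) \<partial>lborel) \<in> borel_measurable M"
  proof (rule lborel.borel_measurable_nn_integral)
    have [measurable]: "Measurable.pred (M \<Otimes>\<^sub>M lborel) (\<lambda>p. Q (fst p) (circ_pt (A (fst p)) (B (fst p)) (snd p)))"
      using P by (simp cong: measurable_cong_sets sets_pair_measure_cong)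
    show "(\<lambda>(z, \<theta>). indicator {0..<2*pi} \<theta> * (if Q z (circ_pt (A z) (B z) \<theta>) then 1 else (0::ennreal))) \<in> borel_measurable (M \<Otimes>\<^sub>M lborel)"
      unfolding case_prod_beta by measurable
  qed
  then have "(\<lambda>z. (\<integral>\<^sup>+\<theta>. indicator {0..<2*pi} \<theta> * (if Q z (circ_pt (A z) (B z) \<theta>) then 1 else 0) \<partial>lborel) / ennreal (2*pi)) \<in> borel_measurable M"
    by measurable
  also have "?this \<longleftrightarrow> ?thesis"
  proof (rule measurable_cong)
    fix z assume z: "z \<in> space M"
    have "(\<integral>\<^sup>+\<theta>. indicator {0..<2*pi} \<theta> * (if Q z (circ_pt (A z) (B z) \<theta>) then 1 else 0) \<partial>lborel)
      = (\<integral>\<^sup>+\<theta>. indicator {\<theta> \<in> {0..<2*pi}. Q z (circ_pt (A z) (B z) \<theta>)} \<theta> \<partial>lborel)"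
      by (intro nn_integral_cong) (auto simp: indicator_def)
    also have "\<dots> = emeasure lborel {\<theta> \<in> {0..<2*pi}. Q z (circ_pt (A z) (B z) \<theta>)}"
      using sec[OF z] by simp
    finally show "(\<integral>\<^sup>+\<theta>. indicator {0..<2*pi} \<theta> * (if Q z (circ_pt (A z) (B z) \<theta>) then 1 else 0) \<partial>lborel) / ennreal (2*pi)
       = frame_len (A z) (B z) {x. Q z x}"
      by (simp add: frame_len_def)
  qed
  finally show ?thesis .
qed

lemma measurable_cross3 [measurable]:
  assumes [measurable]: "A \<in> borel_measurable M" "B \<in> borel_measurable M"
  shows "(\<lambda>z. cross3 (A z) (B z)) \<in> borel_measurable M"
proof -
  have "continuous_on UNIV (\<lambda>p. cross3 (fst p) (snd p))"
    by (intro continuous_on_cross continuous_intros)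
  then have "(\<lambda>p. cross3 (fst p) (snd p)) \<in> borel_measurable (borel \<Otimes>\<^sub>M borel)"
    unfolding borel_prod by (rule borel_measurable_continuous_onI)
  from measurable_compose[OF measurable_Pair[OF assms] this] show ?thesis by simp
qed

text \<open>Measurability is asked of a representative in the normals and the time, for each fixed
  \<open>k\<close> and \<open>D\<close>. The representative is defined everywhere and matches
  \<open>h\<close> on good codes only, so that measurability of the set of good normals never has to
  be proved.\<close>

definition codable :: "(tess \<Rightarrow> real \<Rightarrow> ennreal) \<Rightarrow> bool" where
  "codable h \<longleftrightarrow> (\<forall>k D. \<exists>H\<in>borel_measurable (borel \<Otimes>\<^sub>M borel).
     \<forall>w t. good w k D \<longrightarrow> h (tess w D) t = H (w, t))"

text \<open>If no normals are good for \<open>k\<close> and \<open>D\<close>, the zero function is a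
  representative. One good choice may therefore be assumed; it supplies finiteness of
  \<open>D\<close> and of its codes.\<close>

lemma codableI:
  assumes "\<And>k D w0. good w0 k D \<Longrightarrow> \<exists>H\<in>borel_measurable (borel \<Otimes>\<^sub>M borel).
     \<forall>w t. good w k D \<longrightarrow> h (tess w D) t = H (w, t)"
  shows "codable h"
  unfolding codable_def
proof (intro allI)
  fix k D
  show "\<exists>H\<in>borel_measurable (borel \<Otimes>\<^sub>M borel). \<forall>w t. good w k D \<longrightarrow> h (tess w D) t = H (w, t)"
  proof (cases "\<exists>w. good w k D")
    case True
    then show ?thesis using assms by blast
  next
    case False
    then show ?thesis by (intro bexI[of _ "\<lambda>_. 0"]) auto
  qed
qed

lemma codable_binop:
  assumes "codable h1" "codable h2"
    and F: "(\<lambda>p. F (fst p) (snd p)) \<in> borel_measurable (borel \<Otimes>\<^sub>M borel)"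
  shows "codable (\<lambda>T t. F (h1 T t) (h2 T t))"
  unfolding codable_def
proof (intro allI)
  fix k D
  obtain H1 where H1: "H1 \<in> borel_measurable (borel \<Otimes>\<^sub>M borel)"
    and h1: "\<forall>w t. good w k D \<longrightarrow> h1 (tess w D) t = H1 (w, t)"
    using assms(1) unfolding codable_def by blast
  obtain H2 where H2: "H2 \<in> borel_measurable (borel \<Otimes>\<^sub>M borel)"
    and h2: "\<forall>w t. good w k D \<longrightarrow> h2 (tess w D) t = H2 (w, t)"
    using assms(2) unfolding codable_def by blast
  from h1 h2 measurable_compose[OF measurable_Pair[OF H1 H2] F]
  show "\<exists>H\<in>borel_measurable (borel \<Otimes>\<^sub>M borel). \<forall>w t. good w k D \<longrightarrow> F (h1 (tess w D) t) (h2 (tess w D) t) = H (w, t)"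
    by (intro bexI[of _ "\<lambda>z. F (H1 z) (H2 z)"]) auto
qed

lemmas codable_add = codable_binop[where F = "(+)", OF _ _ borel_measurable_add[OF measurable_fst measurable_snd]]
lemmas codable_mult = codable_binop[where F = "(*)", OF _ _ borel_measurable_times_ennreal[OF measurable_fst measurable_snd]]

lemma codable_time:
  assumes [measurable]: "f \<in> borel_measurable borel"
  shows "codable (\<lambda>T. f)"
  unfolding codable_def by (auto intro!: bexI[of _ "\<lambda>z. f (snd z)"])

definition seg_len :: "tess \<Rightarrow> ennreal" where
  "seg_len T = (\<Sum>\<^sub>\<infinity>m\<in>max_segments T. sigma1 m)"

lemma seg_len_good: "good w k D \<Longrightarrow> seg_len (tess w D) = good.len w k D"
  by (simp add: seg_len_def good.sum_max_segments)

lemma codable_seg_len: "codable (\<lambda>T t. seg_len T)"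
proof (rule codableI)
  fix k D v assume v: "good v k D"
  note fin = good.fin[OF v] and finc = good.finite_code[OF v]
  define F where "F = (\<lambda>i (w :: nat \<Rightarrow> pt). frame_len (circ_base (w i)) (cross3 (w i) (circ_base (w i)))
    {x. \<exists>c\<in>{c\<in>D. i \<in> fst ` c}. x \<in> cell w c \<and> w i \<bullet> x = 0})"
  have F [measurable]: "F i \<in> borel_measurable borel" for i
    unfolding F_def
  proof (rule measurable_frame_len)
    show "(\<lambda>w. circ_base (w i)) \<in> borel_measurable (borel :: (nat \<Rightarrow> pt) measure)"
      unfolding circ_base_def by measurable
    then show "(\<lambda>w. cross3 (w i) (circ_base (w i))) \<in> borel_measurable (borel :: (nat \<Rightarrow> pt) measure)"
      by measurable
    have [measurable]: "(\<lambda>p. (fst p :: nat \<Rightarrow> pt) i) \<in> borel_measurable (borel \<Otimes>\<^sub>M (borel :: pt measure))"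
      by (rule measurable_product_then_coordinatewise) measurable
    have "Measurable.pred (borel \<Otimes>\<^sub>M borel) (\<lambda>p. \<exists>c\<in>{c\<in>D. i \<in> fst ` c}. snd p \<in> cell (fst p) c \<and> fst p i \<bullet> snd p = 0)"
    proof (rule pred_intros_finite(4))
      show "finite {c\<in>D. i \<in> fst ` c}" using fin by simp
      fix c assume "c \<in> {c\<in>D. i \<in> fst ` c}"
      then have "finite c" using finc by simp
      then show "Measurable.pred (borel \<Otimes>\<^sub>M borel) (\<lambda>p. snd p \<in> cell (fst p) c \<and> fst p i \<bullet> snd p = 0)"
        by (intro pred_intros_logic measurable_pred_cell) measurable
    qed
    then show "Measurable.pred (borel \<Otimes>\<^sub>M borel) (\<lambda>(w, x). \<exists>c\<in>{c\<in>D. i \<in> fst ` c}. x \<in> cell w c \<and> w i \<bullet> x = 0)"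
      by (simp add: case_prod_beta)
  qed
  show "\<exists>H\<in>borel_measurable (borel \<Otimes>\<^sub>M borel). \<forall>w (t::real). good w k D \<longrightarrow> seg_len (tess w D) = H (w, t)"
  proof (intro bexI[of _ "\<lambda>p. \<Sum>i\<in>{3..<k}. F i (fst p)"] allI impI)
    show "(\<lambda>p. \<Sum>i\<in>{3..<k}. F i (fst p)) \<in> borel_measurable (borel \<Otimes>\<^sub>M (borel :: real measure))" by measurable
    fix w and t :: real assume g: "good w k D"
    have "emeasure (circ_measure (w i)) (chord w D i) = F i w" if i: "i \<in> {3..<k}" for i
    proof -
      have n: "norm (w i) = 1" using good.nrm[OF g] i by auto
      \<comment> \<open>An auxiliary normal does its work here: the base point of the explicit frame
        exists because \<open>w i\<close> is not parallel to \<open>w 0\<close>.\<close>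
      have "triple (w 1) (w i) (w 0) \<noteq> 0" using i by (intro good.gp[OF g]) auto
      then have "cross3 (w i) (axis 1 1) \<noteq> 0" using good.base[OF g] by (auto simp: triple_def)
      then have f: "frame (w i) (circ_base (w i)) (cross3 (w i) (circ_base (w i)))"
        by (rule frame_circ_base[OF n])
      have b: "chord w D i \<in> sets borel" using good.closed_chord[OF g] by (rule borel_closed)
      have "chord w D i = {x. \<exists>c\<in>{c\<in>D. i \<in> fst ` c}. x \<in> cell w c \<and> w i \<bullet> x = 0}"
        by (auto simp: chord_def gcirc_def cell_def)
      then show ?thesis using circ_len_eq_emeasure[OF n b] circ_len_eq_frame_len[OF f b] by (simp add: F_def)
    qed
    then show "seg_len (tess w D) = (\<Sum>i\<in>{3..<k}. F i (fst (w, t)))"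
      using seg_len_good[OF g] by (simp add: good.len_def[OF g])
  qed
qed

interpretation sigma2: finite_measure sigma2
  by (rule finite_measureI) (simp add: prob_space_sigma2)

lemma emeasure_hits: "emeasure sigma2 (hits (cell w c)) = ennreal (tau_hit (cell w c))"
  by (simp add: tau_hit_def sigma2.emeasure_eq_measure)

lemma measurable_tau_hit [measurable]:
  assumes [measurable]: "W \<in> borel_measurable M"
  shows "(\<lambda>z. tau_hit (cell (W z) c)) \<in> borel_measurable M"
proof -
  have "(\<lambda>z. \<integral>\<^sup>+u. indicator (hits (cell (W z) c)) u \<partial>sigma2) \<in> borel_measurable M"
    by (intro sigma2.borel_measurable_nn_integral) (simp add: case_prod_beta, measurable)
  then have "(\<lambda>z. enn2real (\<integral>\<^sup>+u. indicator (hits (cell (W z) c)) u \<partial>sigma2)) \<in> borel_measurable M" by measurable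
  also have "(\<lambda>z. enn2real (\<integral>\<^sup>+u. indicator (hits (cell (W z) c)) u \<partial>sigma2)) = (\<lambda>z. tau_hit (cell (W z) c))"
    by (simp add: tau_hit_def measure_def)
  finally show ?thesis .
qed

lemma rate_good: "good w k D \<Longrightarrow> rate (tess w D) = (\<Sum>c\<in>D. tau_hit (cell w c))"
  unfolding rate_def tess_def by (rule sum.reindex[OF good.inj_cell, unfolded comp_def])

lemma codable_exp_rate: "codable (\<lambda>T t. ennreal (exp (- rate T * t)))"
proof (rule codableI)
  fix k D v assume "good v k D"
  show "\<exists>H\<in>borel_measurable (borel \<Otimes>\<^sub>M borel). \<forall>w t. good w k D \<longrightarrow> ennreal (exp (- rate (tess w D) * t)) = H (w, t)"
  proof (intro bexI allI impI)
    show "(\<lambda>p. ennreal (exp (- (\<Sum>c\<in>D. tau_hit (cell (fst p) c)) * snd p))) \<in> borel_measurable (borel \<Otimes>\<^sub>M borel)"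
      by measurable
  qed (simp add: rate_good)
qed

section \<open>The one-split operator of the Dyson series\<close>

definition step :: "(tess \<Rightarrow> real \<Rightarrow> ennreal) \<Rightarrow> tess \<Rightarrow> real \<Rightarrow> ennreal" where
  "step h T t = (\<integral>\<^sup>+ s. indicator {0..t} s * ennreal (exp (- rate T * s)) *
        (\<Sum>p\<in>T. \<integral>\<^sup>+ u. indicator (hits p) u * h (split_cell T p u) (t - s) \<partial>sigma2)
      \<partial>lborel)"

lemma jumpP_eq_step: "jumpP f n = (step ^^ n) (\<lambda>T t. ennreal (exp (- rate T * t)) * f T)"
  by (induction n) (auto simp: fun_eq_iff step_def)

lemma measurable_upd [measurable]:
  assumes [measurable]: "W \<in> borel_measurable M" "U \<in> borel_measurable M"
  shows "(\<lambda>z. (W z)(k := U z) :: nat \<Rightarrow> pt) \<in> borel_measurable M"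
proof (rule measurable_coordinatewise_then_product)
  fix i
  have [measurable]: "(\<lambda>z. W z i) \<in> borel_measurable M"
    by (rule measurable_product_then_coordinatewise) measurable
  show "(\<lambda>z. ((W z)(k := U z)) i) \<in> borel_measurable M" by (cases "i = k") simp_all
qed

lemma sum_tess:
  assumes "good w k D"
  shows "(\<Sum>p\<in>tess w D. F p) = (\<Sum>c\<in>D. F (cell w c))"
  unfolding tess_def by (rule sum.reindex[OF good.inj_cell[OF assms], unfolded comp_def])

lemma AE_split_good:
  assumes g: "good w k D" and c: "c \<in> D"
  shows "AE u in sigma2. u \<in> hits (cell w c) \<longrightarrow>
     good (w(k := u)) (Suc k) (split_codes k c D) \<and>
     split_cell (tess w D) (cell w c) u = tess (w(k := u)) (split_codes k c D)"
  using good.AE_generic_sigma2[OF g]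
  by eventually_elim (auto simp: good.good_split[OF g c] good.tess_split[OF g c])

text \<open>Almost every splitting circle is generic and leads to a good state with one more normal,
  so only the values on such states matter. Applied in both directions it gives
  \<open>step_cong\<close> without any measurability.\<close>

lemma step_mono:
  assumes g: "good w k D"
    and le: "\<And>w D s. good w (Suc k) D \<Longrightarrow> 0 \<le> s \<Longrightarrow> s \<le> t \<Longrightarrow> h (tess w D) s \<le> h' (tess w D) s"
  shows "step h (tess w D) t \<le> step h' (tess w D) t"
  unfolding step_def
proof (rule nn_integral_mono, goal_cases)
  case (1 s)
  show ?case
  proof (cases "s \<in> {0..t}")
    case True
    show ?thesis unfolding sum_tess[OF g]
    proof (intro mult_left_mono sum_mono nn_integral_mono_AE)
      fix c assume c: "c \<in> D"
      show "AE u in sigma2. indicator (hits (cell w c)) u * h (split_cell (tess w D) (cell w c) u) (t - s)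
         \<le> indicator (hits (cell w c)) u * h' (split_cell (tess w D) (cell w c) u) (t - s)"
        using AE_split_good[OF g c]
      proof eventually_elim
        case u: (elim u)
        show ?case
        proof (cases "u \<in> hits (cell w c)")
          case h: True
          have "h (tess (w(k := u)) (split_codes k c D)) (t - s) \<le> h' (tess (w(k := u)) (split_codes k c D)) (t - s)"
            using u h True by (intro le) auto
          then show ?thesis using u h by simp
        qed simp
      qed
    qed simp
  qed simp
qed

lemma step_cong:
  assumes "good w k D"
    and "\<And>w D s. good w (Suc k) D \<Longrightarrow> 0 \<le> s \<Longrightarrow> h (tess w D) s = h' (tess w D) s"
  shows "step h (tess w D) t = step h' (tess w D) t"
  using step_mono[OF assms(1), of t h h'] step_mono[OF assms(1), of t h' h] assms(2)
  by (intro antisym) auto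

lemma step_code:
  assumes g: "good w k D"
    and H: "\<And>c w t. c \<in> D \<Longrightarrow> good w (Suc k) (split_codes k c D) \<Longrightarrow> h (tess w (split_codes k c D)) t = H c (w, t)"
  shows "step h (tess w D) t = (\<integral>\<^sup>+ s. indicator {0..t} s * ennreal (exp (- (\<Sum>c\<in>D. tau_hit (cell w c)) * s)) *
        (\<Sum>c\<in>D. \<integral>\<^sup>+ u. indicator (hits (cell w c)) u * H c (w(k := u), t - s) \<partial>sigma2) \<partial>lborel)"
proof -
  have "(\<integral>\<^sup>+ u. indicator (hits (cell w c)) u * h (split_cell (tess w D) (cell w c) u) (t - s) \<partial>sigma2)
     = (\<integral>\<^sup>+ u. indicator (hits (cell w c)) u * H c (w(k := u), t - s) \<partial>sigma2)" if c: "c \<in> D" for c s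
  proof (rule nn_integral_cong_AE, goal_cases)
    case 1
    show ?case using AE_split_good[OF g c]
    proof eventually_elim
      case u: (elim u)
      show ?case
      proof (cases "u \<in> hits (cell w c)")
        case True
        then have "good (w(k := u)) (Suc k) (split_codes k c D)" using u by blast
        from H[OF c this] show ?thesis using u True by simp
      qed simp
    qed
  qed
  then have "(\<Sum>p\<in>tess w D. \<integral>\<^sup>+ u. indicator (hits p) u * h (split_cell (tess w D) p u) (t - s) \<partial>sigma2)
     = (\<Sum>c\<in>D. \<integral>\<^sup>+ u. indicator (hits (cell w c)) u * H c (w(k := u), t - s) \<partial>sigma2)" for s
    unfolding sum_tess[OF g] by (intro sum.cong) auto
  then show ?thesis unfolding step_def rate_good[OF g] by simp
qed

lemma codable_split:
  assumes "codable h"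
  obtains H where "\<forall>c. H c \<in> borel_measurable (borel \<Otimes>\<^sub>M borel)"
    "\<forall>c w t. good w (Suc k) (split_codes k c D) \<longrightarrow> h (tess w (split_codes k c D)) t = H c (w, t)"
proof -
  have "\<forall>c. \<exists>H. H \<in> borel_measurable (borel \<Otimes>\<^sub>M borel) \<and>
     (\<forall>w t. good w (Suc k) (split_codes k c D) \<longrightarrow> h (tess w (split_codes k c D)) t = H (w, t))"
    using assms unfolding codable_def by blast
  then obtain H where "\<forall>c. H c \<in> borel_measurable (borel \<Otimes>\<^sub>M borel) \<and>
     (\<forall>w t. good w (Suc k) (split_codes k c D) \<longrightarrow> h (tess w (split_codes k c D)) t = H c (w, t))"
    by (rule choice[THEN exE])
  with that[of H] show thesis by blast
qed

lemma measurable_inner [measurable]: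
  assumes [measurable]: "H \<in> borel_measurable (borel \<Otimes>\<^sub>M borel)" "W \<in> borel_measurable M" "R \<in> borel_measurable M"
  shows "(\<lambda>z. \<integral>\<^sup>+ u. indicator (hits (cell (W z) c)) u * H ((W z)(k := u), R z) \<partial>sigma2) \<in> borel_measurable M"
proof (rule sigma2.borel_measurable_nn_integral)
  show "(\<lambda>(z, u). indicator (hits (cell (W z) c)) u * H ((W z)(k := u), R z)) \<in> borel_measurable (M \<Otimes>\<^sub>M sigma2)"
    unfolding case_prod_beta by measurable
qed

lemma codable_step:
  assumes "codable h"
  shows "codable (step h)"
proof (rule codableI)
  fix k D v assume "good v k D"
  obtain H where H': "\<forall>c. H c \<in> borel_measurable (borel \<Otimes>\<^sub>M borel)"
    "\<forall>c w t. good w (Suc k) (split_codes k c D) \<longrightarrow> h (tess w (split_codes k c D)) t = H c (w, t)"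
    using codable_split[OF assms, of k D] .
  note H = H'[rule_format]
  note [measurable] = H(1)
  let ?H = "\<lambda>z. \<integral>\<^sup>+ s. indicator {0..snd z} s * ennreal (exp (- (\<Sum>c\<in>D. tau_hit (cell (fst z) c)) * s)) *
        (\<Sum>c\<in>D. \<integral>\<^sup>+ u. indicator (hits (cell (fst z) c)) u * H c ((fst z)(k := u), snd z - s) \<partial>sigma2) \<partial>lborel"
  show "\<exists>H\<in>borel_measurable (borel \<Otimes>\<^sub>M borel). \<forall>w t. good w k D \<longrightarrow> step h (tess w D) t = H (w, t)"
  proof (intro bexI[of _ ?H] allI impI)
    fix w t assume "good w k D"
    then show "step h (tess w D) t = ?H (w, t)" using step_code[where h = h and H = H, OF _ H(2)] by simp
  next
    show "?H \<in> borel_measurable (borel \<Otimes>\<^sub>M borel)"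
    proof (rule lborel.borel_measurable_nn_integral)
      have [measurable]: "(\<lambda>p. indicator {0..snd (fst p)} (snd p) :: ennreal) \<in> borel_measurable (((borel :: (nat \<Rightarrow> pt) measure) \<Otimes>\<^sub>M (borel :: real measure)) \<Otimes>\<^sub>M lborel)"
        unfolding indicator_def atLeastAtMost_iff by measurable
      show "(\<lambda>(z, s). indicator {0..snd z} s * ennreal (exp (- (\<Sum>c\<in>D. tau_hit (cell (fst z) c)) * s)) *
        (\<Sum>c\<in>D. \<integral>\<^sup>+ u. indicator (hits (cell (fst z) c)) u * H c ((fst z)(k := u), snd z - s) \<partial>sigma2))
        \<in> borel_measurable ((borel \<Otimes>\<^sub>M borel) \<Otimes>\<^sub>M lborel)"
        unfolding case_prod_beta by measurable
    qed
  qed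
qed

text \<open>The codes are needed for this: \<open>nn_integral_add\<close> requires measurable
  integrands, both in the integral over circles and in the one over the time of the split.\<close>

lemma step_add:
  assumes "codable h1" "codable h2" "good w k D"
  shows "step (\<lambda>T t. h1 T t + h2 T t) (tess w D) t = step h1 (tess w D) t + step h2 (tess w D) t"
proof -
  obtain H1 where H1': "\<forall>c. H1 c \<in> borel_measurable (borel \<Otimes>\<^sub>M borel)"
    "\<forall>c w t. good w (Suc k) (split_codes k c D) \<longrightarrow> h1 (tess w (split_codes k c D)) t = H1 c (w, t)"
    using codable_split[OF assms(1), of k D] .
  note H1 = H1'[rule_format]
  obtain H2 where H2': "\<forall>c. H2 c \<in> borel_measurable (borel \<Otimes>\<^sub>M borel)"
    "\<forall>c w t. good w (Suc k) (split_codes k c D) \<longrightarrow> h2 (tess w (split_codes k c D)) t = H2 c (w, t)"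
    using codable_split[OF assms(2), of k D] .
  note H2 = H2'[rule_format]
  note [measurable] = H1(1) H2(1)
  let ?I = "\<lambda>H c s. \<integral>\<^sup>+ u. indicator (hits (cell w c)) u * H c (w(k := u), t - s) \<partial>sigma2"
  let ?E = "\<lambda>s. indicator {0..t} s * ennreal (exp (- (\<Sum>c\<in>D. tau_hit (cell w c)) * s))"
  have "?I (\<lambda>c z. H1 c z + H2 c z) c s = ?I H1 c s + ?I H2 c s" for c s
    by (subst nn_integral_add[symmetric]) (measurable, simp add: distrib_left)
  moreover have "step (\<lambda>T t. h1 T t + h2 T t) (tess w D) t
     = (\<integral>\<^sup>+ s. ?E s * (\<Sum>c\<in>D. ?I (\<lambda>c z. H1 c z + H2 c z) c s) \<partial>lborel)"
    by (rule step_code[OF assms(3)]) (simp add: H1(2) H2(2))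
  ultimately have "step (\<lambda>T t. h1 T t + h2 T t) (tess w D) t
     = (\<integral>\<^sup>+ s. ?E s * (\<Sum>c\<in>D. ?I H1 c s) + ?E s * (\<Sum>c\<in>D. ?I H2 c s) \<partial>lborel)"
    by (simp add: sum.distrib distrib_left)
  also have "\<dots> = (\<integral>\<^sup>+ s. ?E s * (\<Sum>c\<in>D. ?I H1 c s) \<partial>lborel) + (\<integral>\<^sup>+ s. ?E s * (\<Sum>c\<in>D. ?I H2 c s) \<partial>lborel)"
    by (rule nn_integral_add) measurable
  also have "\<dots> = step h1 (tess w D) t + step h2 (tess w D) t"
    using step_code[where h = h1 and H = H1, OF assms(3) H1(2)] step_code[where h = h2 and H = H2, OF assms(3) H2(2)] by simp
  finally show ?thesis .
qed

lemma codable_step_pow: "codable h \<Longrightarrow> codable ((step ^^ n) h)"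
  by (induction n) (auto intro: codable_step)

text \<open>Every step raises \<open>k\<close>, so the bound \<open>m\<close> is preserved along the
  iteration. It allows functionals to be exchanged that agree only after the first split.\<close>

lemma step_pow_cong:
  assumes "\<And>w k D s. good w k D \<Longrightarrow> m \<le> k \<Longrightarrow> 0 \<le> s \<Longrightarrow> h (tess w D) s = h' (tess w D) s"
    "good w k D" "m \<le> k" "0 \<le> t"
  shows "(step ^^ n) h (tess w D) t = (step ^^ n) h' (tess w D) t"
  using assms(2-4)
proof (induction n arbitrary: w k D t)
  case (Suc n)
  have "step ((step ^^ n) h) (tess w D) t = step ((step ^^ n) h') (tess w D) t"
    using Suc.prems by (intro step_cong[OF Suc.prems(1)] Suc.IH[where k = "Suc k"]) auto
  then show ?case by simp
qed (auto simp: assms(1))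

lemma step_pow_add:
  assumes "codable h1" "codable h2" "good w k D"
  shows "(step ^^ n) (\<lambda>T t. h1 T t + h2 T t) (tess w D) t = (step ^^ n) h1 (tess w D) t + (step ^^ n) h2 (tess w D) t"
  using assms(3)
proof (induction n arbitrary: w k D t)
  case (Suc n)
  have "step ((step ^^ n) (\<lambda>T t. h1 T t + h2 T t)) (tess w D) t
    = step (\<lambda>T t. (step ^^ n) h1 T t + (step ^^ n) h2 T t) (tess w D) t"
    by (rule step_cong[OF Suc.prems]) (rule Suc.IH)
  then show ?case using step_add[OF codable_step_pow codable_step_pow Suc.prems] assms by simp
qed simp

section \<open>The drift of the segment length\<close>

text \<open>Length of the circle with normal \<open>u\<close> inside the cell, taken in the explicit
  frame to make it measurable in \<open>u\<close>.\<close>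

definition cell_len :: "(nat \<Rightarrow> pt) \<Rightarrow> (nat \<times> bool) set \<Rightarrow> pt \<Rightarrow> ennreal" where
  "cell_len w c u = frame_len (circ_base u) (cross3 u (circ_base u)) (cell w c)"

lemma measurable_cell_len [measurable]:
  assumes c: "finite c"
  shows "cell_len w c \<in> borel_measurable borel"
proof -
  have cb [measurable]: "circ_base \<in> borel_measurable borel" unfolding circ_base_def[abs_def] by measurable
  have "(\<lambda>u. frame_len (circ_base u) (cross3 u (circ_base u)) {x. x \<in> cell w c}) \<in> borel_measurable borel"
  proof (rule measurable_frame_len)
    show "Measurable.pred (borel \<Otimes>\<^sub>M borel) (\<lambda>(z :: pt, x). x \<in> cell w c)"
      unfolding case_prod_beta by measurable
  qed measurable
  then show ?thesis by (simp add: cell_len_def[abs_def])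
qed

lemma (in good) cell_len_eq:
  assumes u: "generic u"
  shows "cell_len w c u = emeasure (circ_measure u) (cell w c)"
proof -
  have n: "norm u = 1" using u by (simp add: generic_def)
  have "triple u (w 0) (w 1) \<noteq> 0" using u k_ge by (simp add: generic_def)
  then have "triple (w 1) u (w 0) \<noteq> 0" using triple_cyc[of u "w 0" "w 1"] triple_cyc[of "w 0" "w 1" u] by simp
  then have "cross3 u (axis 1 1) \<noteq> 0" using base by (auto simp: triple_def)
  then have f: "frame u (circ_base u) (cross3 u (circ_base u))" by (rule frame_circ_base[OF n])
  show ?thesis unfolding cell_len_def
    using circ_len_eq_emeasure[OF n, of "cell w c"] circ_len_eq_frame_len[OF f, of "cell w c"] by simp
qed

lemma sum_integral_cell_len:
  assumes g: "good w k D"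
  shows "(\<Sum>c\<in>D. \<integral>\<^sup>+u. cell_len w c u \<partial>sigma2) = 1"
proof -
  have [measurable]: "c \<in> D \<Longrightarrow> cell_len w c \<in> borel_measurable borel" for c
    using good.finite_code[OF g] by (rule measurable_cell_len)
  have "(\<Sum>c\<in>D. \<integral>\<^sup>+u. cell_len w c u \<partial>sigma2) = (\<integral>\<^sup>+u. (\<Sum>c\<in>D. cell_len w c u) \<partial>sigma2)"
    by (rule nn_integral_sum[symmetric]) simp
  also have "\<dots> = (\<integral>\<^sup>+u. 1 \<partial>sigma2)"
  proof (rule nn_integral_cong_AE, goal_cases)
    case 1
    show ?case using good.AE_generic_sigma2[OF g]
      by eventually_elim (simp add: good.cell_len_eq[OF g] good.sum_cells_circle[OF g])
  qed
  also have "\<dots> = 1" by (simp add: prob_space_sigma2)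
  finally show ?thesis .
qed

lemma tau_hit_bounds: "0 \<le> tau_hit p" "tau_hit p \<le> 1"
proof -
  show "0 \<le> tau_hit p" by (simp add: tau_hit_def)
  have "measure sigma2 (hits p) \<le> measure sigma2 (space sigma2)" by (rule sigma2.bounded_measure)
  then show "tau_hit p \<le> 1" by (simp add: tau_hit_def measure_def prob_space_sigma2)
qed

lemma rate_bounds:
  assumes "good w k D"
  shows "0 \<le> rate (tess w D)" "rate (tess w D) \<le> real (card (tess w D))"
proof -
  show "0 \<le> rate (tess w D)" unfolding rate_def using tau_hit_bounds by (intro sum_nonneg)
  show "rate (tess w D) \<le> real (card (tess w D))"
    unfolding rate_def using sum_bounded_above[of "tess w D" tau_hit 1] tau_hit_bounds by simp
qed

text \<open>The solution of the backward equation with initial value \<open>\<alpha> (L + \<gamma>)\<close>.\<close>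

definition drift :: "real \<Rightarrow> real \<Rightarrow> tess \<Rightarrow> real \<Rightarrow> ennreal" where
  "drift \<alpha> \<gamma> T t = ennreal \<alpha> * (seg_len T + ennreal (\<gamma> + t))"

lemma codable_drift: "codable (drift \<alpha> \<gamma>)"
proof -
  have "codable (\<lambda>T t. ennreal \<alpha> * (seg_len T + ennreal (\<gamma> + t)))"
    by (intro codable_mult codable_add codable_seg_len codable_time) measurable
  then show ?thesis by (simp add: drift_def[abs_def])
qed

lemma split_drift:
  assumes g: "good w k D" and c: "c \<in> D" and "0 \<le> \<gamma>" "0 \<le> r" "0 \<le> \<alpha>"
  shows "(\<integral>\<^sup>+u. indicator (hits (cell w c)) u * drift \<alpha> \<gamma> (split_cell (tess w D) (cell w c) u) r \<partial>sigma2)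
    = drift \<alpha> \<gamma> (tess w D) r * ennreal (tau_hit (cell w c)) + ennreal \<alpha> * (\<integral>\<^sup>+u. cell_len w c u \<partial>sigma2)"
proof -
  have [measurable]: "cell_len w c \<in> borel_measurable borel"
    using good.finite_code[OF g c] by (rule measurable_cell_len)
  have "(\<integral>\<^sup>+u. indicator (hits (cell w c)) u * drift \<alpha> \<gamma> (split_cell (tess w D) (cell w c) u) r \<partial>sigma2)
    = (\<integral>\<^sup>+u. drift \<alpha> \<gamma> (tess w D) r * indicator (hits (cell w c)) u + ennreal \<alpha> * cell_len w c u \<partial>sigma2)"
  proof (rule nn_integral_cong_AE, goal_cases)
    case 1
    show ?case using good.AE_generic_sigma2[OF g]
    proof eventually_elim
      case u: (elim u)
      show ?case
      proof (cases "u \<in> hits (cell w c)")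
        case True
        note g' = good.good_split[OF g c u True]
        have "seg_len (split_cell (tess w D) (cell w c) u) = seg_len (tess w D) + cell_len w c u"
          using good.len_split[OF g c u True] seg_len_good[OF g'] seg_len_good[OF g]
            good.tess_split[OF g c, of u] good.cell_len_eq[OF g u] by simp
        then show ?thesis using True by (simp add: drift_def algebra_simps distrib_left)
      next
        case False
        have "norm u = 1" using u good.generic_def[OF g] by simp
        then have "cell_len w c u = 0"
          using good.cell_len_eq[OF g u] good.emeasure_cell_not_hit[OF g _ False] by simp
        then show ?thesis using False by simp
      qed
    qed
  qed
  also have "\<dots> = (\<integral>\<^sup>+u. drift \<alpha> \<gamma> (tess w D) r * indicator (hits (cell w c)) u \<partial>sigma2)
      + (\<integral>\<^sup>+u. ennreal \<alpha> * cell_len w c u \<partial>sigma2)"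
    by (rule nn_integral_add) measurable
  also have "(\<integral>\<^sup>+u. drift \<alpha> \<gamma> (tess w D) r * indicator (hits (cell w c)) u \<partial>sigma2)
      = drift \<alpha> \<gamma> (tess w D) r * ennreal (tau_hit (cell w c))"
    by (simp add: nn_integral_cmult_indicator emeasure_hits)
  also have "(\<integral>\<^sup>+u. ennreal \<alpha> * cell_len w c u \<partial>sigma2) = ennreal \<alpha> * (\<integral>\<^sup>+u. cell_len w c u \<partial>sigma2)"
    by (rule nn_integral_cmult) measurable
  finally show ?thesis .
qed

lemma sum_split_drift:
  assumes g: "good w k D" and "0 \<le> \<gamma>" "0 \<le> r" "0 \<le> \<alpha>"
  shows "(\<Sum>p\<in>tess w D. \<integral>\<^sup>+u. indicator (hits p) u * drift \<alpha> \<gamma> (split_cell (tess w D) p u) r \<partial>sigma2)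
    = drift \<alpha> \<gamma> (tess w D) r * ennreal (rate (tess w D)) + ennreal \<alpha>"
proof -
  have "(\<Sum>p\<in>tess w D. \<integral>\<^sup>+u. indicator (hits p) u * drift \<alpha> \<gamma> (split_cell (tess w D) p u) r \<partial>sigma2)
    = (\<Sum>c\<in>D. drift \<alpha> \<gamma> (tess w D) r * ennreal (tau_hit (cell w c)) + ennreal \<alpha> * (\<integral>\<^sup>+u. cell_len w c u \<partial>sigma2))"
    unfolding sum_tess[OF g] using split_drift[OF g _ assms(2-4)] by (intro sum.cong) auto
  also have "\<dots> = drift \<alpha> \<gamma> (tess w D) r * ennreal (rate (tess w D)) + ennreal \<alpha> * 1"
    unfolding sum.distrib sum_distrib_left[symmetric] sum_integral_cell_len[OF g] rate_good[OF g]
    using tau_hit_bounds by (simp add: sum_ennreal)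
  finally show ?thesis by simp
qed

text \<open>Duhamel's formula at the first split. By \<open>sum_split_drift\<close> the integrand is
  the derivative of \<open>F\<close>, and the value of \<open>F\<close> at \<open>t\<close> cancels
  against the term without a split.\<close>

lemma step_drift:
  assumes g: "good w k D" and nn: "0 \<le> \<gamma>" "0 \<le> t" "0 \<le> \<alpha>"
  shows "drift \<alpha> \<gamma> (tess w D) t = ennreal (exp (- rate (tess w D) * t)) * (ennreal \<alpha> * (seg_len (tess w D) + ennreal \<gamma>))
      + step (drift \<alpha> \<gamma>) (tess w D) t"
proof -
  let ?T = "tess w D"
  define R where "R = rate ?T"
  have R: "0 \<le> R" using rate_bounds[OF g] by (simp add: R_def)
  \<comment> \<open>Finiteness of the length moves the computation from \<open>ennreal\<close> to
    real calculus.\<close>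
  have "seg_len ?T < top"
    using le_less_trans[OF good.len_le[OF g] of_nat_less_top] seg_len_good[OF g] by simp
  then obtain l where l: "0 \<le> l" "seg_len ?T = ennreal l" by (cases "seg_len ?T") auto
  have dr: "drift \<alpha> \<gamma> ?T r = ennreal (\<alpha> * (l + \<gamma> + r))" if "0 \<le> r" for r
    using that nn l by (simp add: drift_def ennreal_plus[symmetric] ennreal_mult[symmetric] add.assoc del: ennreal_plus)
  define f where "f s = exp (- R * s) * (\<alpha> * (l + \<gamma> + (t - s)) * R + \<alpha>)" for s
  define F where "F s = - exp (- R * s) * (\<alpha> * (l + \<gamma> + (t - s)))" for s
  have "step (drift \<alpha> \<gamma>) ?T t = (\<integral>\<^sup>+s. ennreal (f s) * indicator {0..t} s \<partial>lborel)"
    unfolding step_def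
  proof (rule nn_integral_cong, goal_cases)
    case (1 s)
    show ?case
    proof (cases "s \<in> {0..t}")
      case True
      then have r: "0 \<le> t - s" by simp
      have nnl: "0 \<le> \<alpha> * (l + \<gamma> + (t - s))" using r nn l by simp
      have "(\<Sum>p\<in>?T. \<integral>\<^sup>+ u. indicator (hits p) u * drift \<alpha> \<gamma> (split_cell ?T p u) (t - s) \<partial>sigma2)
        = ennreal (\<alpha> * (l + \<gamma> + (t - s)) * R + \<alpha>)"
        unfolding sum_split_drift[OF g nn(1) r nn(3)] dr[OF r] R_def[symmetric]
        using nnl R nn by (simp add: ennreal_mult)
      then show ?thesis using True nnl R nn by (simp add: f_def R_def[symmetric] ennreal_mult')
    qed simp
  qed
  also have "\<dots> = ennreal (F t - F 0)"
  proof (rule nn_integral_FTC_Icc)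
    show "f \<in> borel_measurable borel" unfolding f_def by measurable
    show "(F has_real_derivative f s) (at s)" if "s \<in> {0..t}" for s
      unfolding F_def f_def by (auto intro!: derivative_eq_intros simp: algebra_simps)
    show "0 \<le> f s" if "s \<in> {0..t}" for s using that nn l R by (simp add: f_def)
  qed (use nn in auto)
  finally have st: "step (drift \<alpha> \<gamma>) ?T t = ennreal (F t - F 0)" .
  have e: "exp (- R * t) \<le> 1" using R nn by simp
  have "exp (- R * t) * (\<alpha> * (l + \<gamma>)) \<le> 1 * (\<alpha> * (l + \<gamma>))" using e nn l by (intro mult_right_mono) auto
  moreover have "0 \<le> \<alpha> * t" using nn by simp
  ultimately have nnF: "0 \<le> F t - F 0" by (simp add: F_def algebra_simps)
  have "ennreal (exp (- R * t)) * (ennreal \<alpha> * (seg_len ?T + ennreal \<gamma>)) = ennreal (exp (- R * t) * (\<alpha> * (l + \<gamma>)))"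
    using nn l by (simp add: ennreal_plus[symmetric] ennreal_mult[symmetric] del: ennreal_plus)
  then have "ennreal (exp (- R * t)) * (ennreal \<alpha> * (seg_len ?T + ennreal \<gamma>)) + step (drift \<alpha> \<gamma>) ?T t
     = ennreal (exp (- R * t) * (\<alpha> * (l + \<gamma>)) + (F t - F 0))"
    unfolding st using nnF nn l by (simp add: ennreal_plus)
  also have "exp (- R * t) * (\<alpha> * (l + \<gamma>)) + (F t - F 0) = \<alpha> * (l + \<gamma> + t)" by (simp add: F_def)
  finally show ?thesis using dr[OF nn(2)] by (simp add: R_def)
qed

section \<open>Vanishing of the remainder by comparison with a Yule process\<close>

text \<open>Since \<open>damp - damp' = 1 + eps\<close>, one step of the process contracts \<open>damp ^ (- card T)\<close> by the
  factor \<open>1 / (1 + eps)\<close>.\<close>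

definition damp :: "real \<Rightarrow> real \<Rightarrow> real" where
  "damp eps s = 1 + eps - 2 * eps * exp s"

text \<open>The function \<open>- F\<close> decreases at a speed \<open>f\<close> that dominates the
  integrand, so the integral is at most its value at \<open>s = 0\<close>.\<close>

lemma damp_integral:
  fixes R C eps t :: real and m :: nat
  assumes R: "0 \<le> R" "R \<le> real m" and C: "0 \<le> C" and e: "0 < eps" and t: "0 \<le> t"
    and pos: "\<And>s. 0 \<le> s \<Longrightarrow> s \<le> t \<Longrightarrow> 0 < damp eps s"
  shows "(\<integral>\<^sup>+s. ennreal (exp (- R * s) * (R * (C * (1 / damp eps (t - s)) ^ Suc m))) * indicator {0..t} s \<partial>lborel)
    \<le> ennreal (C / (1 + eps) * (1 / damp eps t) ^ m)"
proof -
  define d where "d s = damp eps (t - s)" for s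
  define f where "f s = C / (1 + eps) * (exp (- R * s) * (1 / d s) ^ Suc m * (R * d s + real m * (2 * eps * exp (t - s))))" for s
  define F where "F s = - (C / (1 + eps)) * (exp (- R * s) * (1 / d s) ^ m)" for s
  have dpos: "0 < d s" if "s \<in> {0..t}" for s using pos[of "t - s"] that by (simp add: d_def)
  have "(\<integral>\<^sup>+s. ennreal (exp (- R * s) * (R * (C * (1 / damp eps (t - s)) ^ Suc m))) * indicator {0..t} s \<partial>lborel)
      \<le> (\<integral>\<^sup>+s. ennreal (f s) * indicator {0..t} s \<partial>lborel)"
  proof (rule nn_integral_mono, goal_cases)
    case (1 s)
    show ?case
    proof (cases "s \<in> {0..t}")
      case True
      \<comment> \<open>Here the rate is compared with the number of cells. With \<open>R\<close> in
        place of \<open>m\<close>, the bracket in \<open>f\<close> would be exactly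
        \<open>R * (1 + eps)\<close>.\<close>
      have "R * (2 * eps * exp (t - s)) \<le> real m * (2 * eps * exp (t - s))" using R e by (intro mult_right_mono) auto
      then have "R * (1 + eps) \<le> R * d s + real m * (2 * eps * exp (t - s))"
        by (simp add: d_def damp_def algebra_simps)
      then have "C / (1 + eps) * (exp (- R * s) * (1 / d s) ^ Suc m * (R * (1 + eps))) \<le> f s"
        unfolding f_def using C e dpos[OF True] by (intro mult_left_mono) auto
      also have "C / (1 + eps) * (exp (- R * s) * (1 / d s) ^ Suc m * (R * (1 + eps)))
          = exp (- R * s) * (R * (C * (1 / d s) ^ Suc m))" using e by (simp del: power_Suc)
      finally show ?thesis using True by (simp add: d_def ennreal_leI del: power_Suc)
    qed simp
  qed
  also have "\<dots> = ennreal (F t - F 0)"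
  proof (rule nn_integral_FTC_Icc)
    show "f \<in> borel_measurable borel" unfolding f_def d_def damp_def by measurable
    show "(F has_real_derivative f s) (at s)" if "s \<in> {0..t}" for s
    proof -
      have dd: "(d has_real_derivative (2 * eps * exp (t - s))) (at s)"
        unfolding d_def damp_def by (auto intro!: derivative_eq_intros)
      have "((\<lambda>s. 1 / d s) has_real_derivative - (2 * eps * exp (t - s)) * (1 / d s) ^ 2) (at s)"
        using dpos[OF that] by (auto intro!: derivative_eq_intros dd simp: power2_eq_square field_simps)
      note DERIV_power[OF this, of m]
      then have p: "((\<lambda>s. (1 / d s) ^ m) has_real_derivative - real m * (2 * eps * exp (t - s)) * (1 / d s) ^ Suc m) (at s)"
        by (rule DERIV_cong) (cases m; use dpos[OF that] in \<open>simp add: power2_eq_square field_simps\<close>)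
      have "(1 / d s) ^ m = d s * (1 / d s) ^ Suc m" using dpos[OF that] by simp
      moreover have "((\<lambda>s. exp (- R * s)) has_real_derivative - R * exp (- R * s)) (at s)"
        by (auto intro!: derivative_eq_intros)
      from DERIV_cmult[OF DERIV_mult[OF this p], of "- (C / (1 + eps))"]
      have "(F has_real_derivative - (C / (1 + eps)) * ((- R * exp (- R * s)) * (1 / d s) ^ m
          + (- real m * (2 * eps * exp (t - s)) * (1 / d s) ^ Suc m) * exp (- R * s))) (at s)"
        unfolding F_def .
      moreover have "- K * ((- R * E) * (x * P) + (- real m * X * P) * E) = K * (E * P * (R * x + real m * X))"
        for K E P x X :: real by (simp add: algebra_simps)
      ultimately show ?thesis unfolding f_def by (simp only:)
    qed
    show "0 \<le> f s" if "s \<in> {0..t}" for s using dpos[OF that] C e R by (simp add: f_def)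
  qed (use t in auto)
  also have "\<dots> \<le> ennreal (C / (1 + eps) * (1 / damp eps t) ^ m)"
  proof (rule ennreal_leI)
    have "0 \<le> C / (1 + eps) * (exp (- R * t) * (1 / d t) ^ m)" using C e dpos[of t] t by simp
    then show "F t - F 0 \<le> C / (1 + eps) * (1 / damp eps t) ^ m" by (simp add: F_def d_def)
  qed
  finally show ?thesis .
qed

definition damped :: "real \<Rightarrow> real \<Rightarrow> real \<Rightarrow> (tess \<Rightarrow> real \<Rightarrow> ennreal) \<Rightarrow> bool" where
  "damped eps u C h \<longleftrightarrow> (\<forall>w k D s. good w k D \<longrightarrow> 0 \<le> s \<longrightarrow> s \<le> u \<longrightarrow>
     h (tess w D) s \<le> ennreal (C * (1 / damp eps s) ^ card (tess w D)))"

text \<open>A split turns \<open>m\<close> cells into \<open>Suc m\<close>, so the integrand carries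
  one more power of \<open>1 / damp\<close> than the result; \<open>damp_integral\<close> trades
  this power for the factor \<open>1 / (1 + eps)\<close>.\<close>

lemma damped_step:
  assumes C: "0 \<le> C" and e: "0 < eps" and pos: "\<And>s. 0 \<le> s \<Longrightarrow> s \<le> u \<Longrightarrow> 0 < damp eps s"
    and h: "damped eps u C h"
  shows "damped eps u (C / (1 + eps)) (step h)"
  unfolding damped_def
proof (intro allI impI)
  fix w k D t assume g: "good w k D" and t: "0 \<le> t" "t \<le> u"
  let ?T = "tess w D"
  define R m where "R = rate ?T" and "m = card ?T"
  have m: "m = k - 1" using good.card_tess[OF g] by (simp add: m_def)
  have R: "0 \<le> R" "R \<le> real m" using rate_bounds[OF g] by (auto simp: R_def m_def)
  have k: "Suc m = k" using m good.k_ge[OF g] by simp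
  have "step h ?T t \<le> (\<integral>\<^sup>+s. ennreal (exp (- R * s) * (R * (C * (1 / damp eps (t - s)) ^ Suc m))) * indicator {0..t} s \<partial>lborel)"
    unfolding step_def
  proof (rule nn_integral_mono, goal_cases)
    case (1 s)
    show ?case
    proof (cases "s \<in> {0..t}")
      case True
      then have r: "0 \<le> t - s" "t - s \<le> u" using t by auto
      let ?b = "C * (1 / damp eps (t - s)) ^ Suc m"
      have b: "0 \<le> ?b" using C pos[OF r] by simp
      have "(\<integral>\<^sup>+ u. indicator (hits (cell w c)) u * h (split_cell ?T (cell w c) u) (t - s) \<partial>sigma2)
          \<le> ennreal ?b * ennreal (tau_hit (cell w c))" if c: "c \<in> D" for c
      proof -
        have "(\<integral>\<^sup>+ u. indicator (hits (cell w c)) u * h (split_cell ?T (cell w c) u) (t - s) \<partial>sigma2)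
          \<le> (\<integral>\<^sup>+ u. ennreal ?b * indicator (hits (cell w c)) u \<partial>sigma2)"
        proof (rule nn_integral_mono_AE, goal_cases)
          case 1
          show ?case using AE_split_good[OF g c]
          proof eventually_elim
            case v: (elim v)
            show ?case
            proof (cases "v \<in> hits (cell w c)")
              case hit: True
              then have g': "good (w(k := v)) (Suc k) (split_codes k c D)" using v by blast
              have "card (tess (w(k := v)) (split_codes k c D)) = Suc m"
                using good.card_tess[OF g'] k by simp
              then have "h (tess (w(k := v)) (split_codes k c D)) (t - s) \<le> ennreal ?b"
                using h[unfolded damped_def] g' r by metis
              then show ?thesis using v hit by simp
            qed simp
          qed
        qed
        also have "\<dots> = ennreal ?b * ennreal (tau_hit (cell w c))"
          by (simp add: nn_integral_cmult_indicator emeasure_hits)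
        finally show ?thesis .
      qed
      then have "(\<Sum>p\<in>?T. \<integral>\<^sup>+ u. indicator (hits p) u * h (split_cell ?T p u) (t - s) \<partial>sigma2)
          \<le> (\<Sum>c\<in>D. ennreal ?b * ennreal (tau_hit (cell w c)))"
        unfolding sum_tess[OF g] by (rule sum_mono)
      also have "\<dots> = ennreal ?b * ennreal R"
        unfolding sum_distrib_left[symmetric] R_def rate_good[OF g] using tau_hit_bounds by (simp add: sum_ennreal)
      also have "\<dots> = ennreal (R * ?b)" using b R by (simp only: ennreal_mult[symmetric] mult.commute)
      finally have "ennreal (exp (- R * s)) * (\<Sum>p\<in>?T. \<integral>\<^sup>+ u. indicator (hits p) u * h (split_cell ?T p u) (t - s) \<partial>sigma2)
          \<le> ennreal (exp (- R * s)) * ennreal (R * ?b)" by (intro mult_left_mono) auto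
      also have "\<dots> = ennreal (exp (- R * s) * (R * ?b))" by (rule ennreal_mult'[symmetric]) simp
      finally show ?thesis using True by (simp add: R_def[symmetric] del: power_Suc)
    qed simp
  qed
  also have "\<dots> \<le> ennreal (C / (1 + eps) * (1 / damp eps t) ^ m)"
    by (rule damp_integral[OF R C e t(1)]) (use pos t in auto)
  finally show "step h ?T t \<le> ennreal (C / (1 + eps) * (1 / damp eps t) ^ card ?T)" by (simp add: m_def)
qed

lemma damped_step_pow:
  assumes "0 \<le> C" "0 < eps" "\<And>s. 0 \<le> s \<Longrightarrow> s \<le> u \<Longrightarrow> 0 < damp eps s" "damped eps u C h"
  shows "damped eps u (C / (1 + eps) ^ n) ((step ^^ n) h)"
proof (induction n)
  case (Suc n)
  have "damped eps u (C / (1 + eps) ^ n / (1 + eps)) (step ((step ^^ n) h))"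
    using assms by (intro damped_step Suc) auto
  then show ?case by (simp add: divide_divide_eq_left mult.commute)
qed (simp add: assms)

lemma drift_bound:
  assumes nn: "0 \<le> \<alpha>" "0 \<le> \<gamma>" "0 \<le> u"
  obtains C eps where "0 \<le> C" "0 < eps" "\<forall>s. 0 \<le> s \<longrightarrow> s \<le> u \<longrightarrow> 0 < damp eps s"
    "damped eps u C (drift \<alpha> \<gamma>)"
proof -
  \<comment> \<open>This choice gives \<open>2 * eps * exp u = 1\<close>, hence
    \<open>damp eps u = eps\<close>: the decreasing function \<open>damp\<close> stays positive up
    to time \<open>u\<close>.\<close>
  define eps where "eps = exp (- u) / 2"
  \<comment> \<open>The drift grows linearly in the number \<open>m\<close> of cells, whereas
    \<open>(1 / damp) ^ m\<close> is at least \<open>(1 + eps) ^ m\<close>, which Bernoulli's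
    inequality bounds below by \<open>1 + m * eps\<close>; the division by \<open>eps\<close> makes
    up for the small slope.\<close>
  define C where "C = \<alpha> * ((2 + \<gamma> + u) / eps)"
  have e: "0 < eps" "eps \<le> 1/2" using nn by (auto simp: eps_def)
  have d: "eps \<le> damp eps s" "damp eps s \<le> 1 - eps" if "0 \<le> s" "s \<le> u" for s
  proof -
    have "2 * eps * exp s \<le> 2 * eps * exp u" using e that by (intro mult_left_mono) auto
    also have "\<dots> = 1" by (simp add: eps_def exp_minus)
    finally show "eps \<le> damp eps s" by (simp add: damp_def)
    have "2 * eps * 1 \<le> 2 * eps * exp s" using e that by (intro mult_left_mono) auto
    then show "damp eps s \<le> 1 - eps" by (simp add: damp_def)
  qed
  have bound: "drift \<alpha> \<gamma> (tess w D) s \<le> ennreal (C * (1 / damp eps s) ^ card (tess w D))"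
    if g: "good w k D" and s: "0 \<le> s" "s \<le> u" for w k D s
  proof -
    let ?m = "card (tess w D)"
    have k: "k = Suc ?m" using good.card_tess[OF g] good.k_ge[OF g] by simp
    have "seg_len (tess w D) \<le> of_nat k" using good.len_le[OF g] seg_len_good[OF g] by simp
    then have "drift \<alpha> \<gamma> (tess w D) s \<le> ennreal \<alpha> * (of_nat k + ennreal (\<gamma> + s))"
      unfolding drift_def by (intro mult_left_mono add_mono) auto
    also have "\<dots> = ennreal (\<alpha> * (real k + (\<gamma> + s)))"
      using nn s by (simp add: ennreal_of_nat_eq_real_of_nat ennreal_plus[symmetric] ennreal_mult[symmetric] del: ennreal_plus)
    also have "\<dots> \<le> ennreal (C * (1 / damp eps s) ^ ?m)"
    proof (rule ennreal_leI)
      have "real k + (\<gamma> + s) \<le> (2 + \<gamma> + u) + real ?m * (2 + \<gamma> + u)"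
      proof -
        have "real ?m * 1 \<le> real ?m * (2 + \<gamma> + u)" using nn by (intro mult_left_mono) auto
        then show ?thesis using k s by simp
      qed
      also have "\<dots> \<le> (2 + \<gamma> + u) / eps + real ?m * (2 + \<gamma> + u)"
      proof -
        have "(2 + \<gamma> + u) * eps \<le> (2 + \<gamma> + u) * 1" using nn e by (intro mult_left_mono) auto
        then show ?thesis using e by (simp add: pos_le_divide_eq)
      qed
      also have "\<dots> = (2 + \<gamma> + u) / eps * (1 + real ?m * eps)" using e by (simp add: field_simps)
      also have "\<dots> \<le> (2 + \<gamma> + u) / eps * (1 / damp eps s) ^ ?m"
      proof (rule mult_left_mono)
        have "1 + real ?m * eps \<le> (1 + eps) ^ ?m" using Bernoulli_inequality[of eps ?m] e by simp
        also have "\<dots> \<le> (1 / damp eps s) ^ ?m"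
        proof (rule power_mono)
          have "(1 + eps) * damp eps s \<le> (1 + eps) * (1 - eps)" using d(2)[OF s] e by (intro mult_left_mono) auto
          also have "\<dots> \<le> 1" using e by (simp add: algebra_simps)
          finally show "1 + eps \<le> 1 / damp eps s" using d(1)[OF s] e by (simp add: pos_le_divide_eq)
        qed (use e in auto)
        finally show "1 + real ?m * eps \<le> (1 / damp eps s) ^ ?m" .
      qed (use nn e in auto)
      finally have "\<alpha> * (real k + (\<gamma> + s)) \<le> \<alpha> * ((2 + \<gamma> + u) / eps * (1 / damp eps s) ^ ?m)"
        using nn by (intro mult_left_mono) auto
      then show "\<alpha> * (real k + (\<gamma> + s)) \<le> C * (1 / damp eps s) ^ ?m" by (simp add: C_def mult.assoc)
    qed
    finally show ?thesis .
  qed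
  show thesis
  proof (rule that)
    show "0 \<le> C" using nn e by (simp add: C_def)
    show "0 < eps" by (rule e)
    show "\<forall>s. 0 \<le> s \<longrightarrow> s \<le> u \<longrightarrow> 0 < damp eps s" using less_le_trans[OF e(1) d(1)] by blast
    show "damped eps u C (drift \<alpha> \<gamma>)" using bound by (simp add: damped_def)
  qed
qed

lemma step_pow_drift_tendsto_0:
  assumes nn: "0 \<le> \<alpha>" "0 \<le> \<gamma>" "0 \<le> t" and g: "good w k D"
  shows "(\<lambda>n. (step ^^ n) (drift \<alpha> \<gamma>) (tess w D) t) \<longlonglongrightarrow> 0"
proof -
  obtain C eps where C: "0 \<le> C" "0 < eps" "\<forall>s. 0 \<le> s \<longrightarrow> s \<le> t \<longrightarrow> 0 < damp eps s"
    "damped eps t C (drift \<alpha> \<gamma>)"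
    using drift_bound[OF nn] .
  let ?K = "C * (1 / damp eps t) ^ card (tess w D)"
  have "(step ^^ n) (drift \<alpha> \<gamma>) (tess w D) t \<le> ennreal (?K * (1 / (1 + eps)) ^ n)" for n
  proof -
    have "(step ^^ n) (drift \<alpha> \<gamma>) (tess w D) t \<le> ennreal (C / (1 + eps) ^ n * (1 / damp eps t) ^ card (tess w D))"
      using damped_step_pow[OF C(1,2) C(3)[rule_format] C(4)] g nn(3) by (auto simp: damped_def)
    also have "C / (1 + eps) ^ n * (1 / damp eps t) ^ card (tess w D) = ?K * (1 / (1 + eps)) ^ n"
      by (simp add: power_one_over)
    finally show ?thesis .
  qed
  then have le: "\<forall>\<^sub>F n in sequentially. (step ^^ n) (drift \<alpha> \<gamma>) (tess w D) t \<le> ennreal (?K * (1 / (1 + eps)) ^ n)"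
    by (intro always_eventually allI)
  have "(\<lambda>n. ennreal (?K * (1 / (1 + eps)) ^ n)) \<longlonglongrightarrow> ennreal (?K * 0)"
    using C(2) by (intro tendsto_ennrealI tendsto_mult tendsto_const LIMSEQ_power_zero) auto
  then have lim: "(\<lambda>n. ennreal (?K * (1 / (1 + eps)) ^ n)) \<longlonglongrightarrow> 0" by simp
  show ?thesis by (rule tendsto_sandwich[OF always_eventually le tendsto_const lim]) simp
qed

text \<open>Iterating the backward equation expresses the solution as the first \<open>n\<close>
  terms of the series plus a remainder that tends to 0. The identity is kept additive throughout,
  since subtraction in \<open>ennreal\<close> is truncated.\<close>

theorem suminf_jumpP_drift:
  assumes nn: "0 \<le> \<alpha>" "0 \<le> \<gamma>" "0 \<le> t" and g: "good w k D"
    and f: "\<And>w k D. good w k D \<Longrightarrow> f (tess w D) = ennreal \<alpha> * (seg_len (tess w D) + ennreal \<gamma>)"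
  shows "(\<Sum>n. jumpP f n (tess w D) t) = drift \<alpha> \<gamma> (tess w D) t"
proof -
  define h0 :: "tess \<Rightarrow> real \<Rightarrow> ennreal" where
    "h0 T t = ennreal (exp (- rate T * t)) * (ennreal \<alpha> * (seg_len T + ennreal \<gamma>))" for T t
  have ch0: "codable h0"
  proof -
    have "codable (\<lambda>T t. ennreal (exp (- rate T * t)) * (ennreal \<alpha> * (seg_len T + ennreal \<gamma>)))"
      by (intro codable_mult codable_add codable_seg_len codable_exp_rate codable_time) measurable
    then show ?thesis by (simp add: h0_def[abs_def])
  qed
  let ?G = "drift \<alpha> \<gamma>"
  have J: "jumpP f n (tess w D) t = (step ^^ n) h0 (tess w D) t" for n
    unfolding jumpP_eq_step by (rule step_pow_cong[OF _ g, where m = 0]) (auto simp: h0_def f nn)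
  have rec: "(step ^^ n) ?G (tess w D) t = (step ^^ n) h0 (tess w D) t + (step ^^ Suc n) ?G (tess w D) t" for n
  proof -
    have "(step ^^ n) ?G (tess w D) t = (step ^^ n) (\<lambda>T t. h0 T t + step ?G T t) (tess w D) t"
    proof (rule step_pow_cong[OF _ g, where m = 0])
      show "?G (tess w D) s = h0 (tess w D) s + step ?G (tess w D) s" if "good w k D" "0 \<le> s" for w k D s
        unfolding h0_def by (rule step_drift[OF that(1) nn(2) that(2) nn(1)])
    qed (simp_all add: nn)
    also have "\<dots> = (step ^^ n) h0 (tess w D) t + (step ^^ n) (step ?G) (tess w D) t"
      by (rule step_pow_add[OF ch0 codable_step[OF codable_drift] g])
    finally show ?thesis by (simp add: funpow_swap1)
  qed
  have part: "?G (tess w D) t = (\<Sum>j<n. jumpP f j (tess w D) t) + (step ^^ n) ?G (tess w D) t" for n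
  proof (induction n)
    case (Suc n)
    then show ?case using rec[of n] J by (simp add: add.assoc)
  qed simp
  have "(\<lambda>n. (\<Sum>j<n. jumpP f j (tess w D) t) + (step ^^ n) ?G (tess w D) t)
      \<longlonglongrightarrow> (\<Sum>n. jumpP f n (tess w D) t) + 0"
    by (intro tendsto_add summable_LIMSEQ step_pow_drift_tendsto_0[OF nn g]) auto
  then have "(\<lambda>n. ?G (tess w D) t) \<longlonglongrightarrow> (\<Sum>n. jumpP f n (tess w D) t)"
    using part by simp
  then show ?thesis using LIMSEQ_unique tendsto_const by blast
qed

text \<open>The initial tessellation has no segments, so only \<gamma> and the drift remain. The
  pair \<alpha>, \<gamma> is \<open>2 * pi\<close>, \<open>0\<close> for segments,
  \<open>2 * pi\<close>, \<open>1\<close> for the functional compared with the edges, and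
  \<open>4 * pi\<close>, \<open>1\<close> for boundaries.\<close>

corollary Exp_Y_affine:
  assumes nn: "0 \<le> \<alpha>" "0 \<le> \<gamma>" "0 \<le> t"
    and f: "\<And>w k D. good w k D \<Longrightarrow> f (tess w D) = ennreal \<alpha> * (seg_len (tess w D) + ennreal \<gamma>)"
  shows "Exp_Y t f = ennreal (\<alpha> * (\<gamma> + t))"
proof -
  have "Exp_Y t f = drift \<alpha> \<gamma> Y0 t"
    using suminf_jumpP_drift[OF nn good_Y0 f] by (simp add: Exp_Y_def tess_Y0)
  also have "seg_len Y0 = 0" using seg_len_good[OF good_Y0] by (simp add: tess_Y0 len_Y0)
  then have "drift \<alpha> \<gamma> Y0 t = ennreal (\<alpha> * (\<gamma> + t))" using nn by (simp add: drift_def ennreal_mult)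
  finally show ?thesis .
qed

text \<open>Of two antipodal points one lies in any given closed hemisphere, so every great circle
  hits both initial cells. This is the 2 in \<open>exp (-2*t)\<close>.\<close>

lemma rate_Y0: "rate Y0 = 2"
proof -
  have one: "tau_hit (hemi v) = 1" for v
  proof -
    have m: "hits (hemi v) \<in> sets borel"
    proof -
      have "hemi v = cell (\<lambda>_. v) {(0, True)}" by (auto simp: hemi_def cell_def hcone_def normal_def)
      then show ?thesis by simp
    qed
    have "u \<in> hits (hemi v)" if "norm u = 1" for u
    proof -
      obtain a b where "frame u a b" using frame_exists[OF \<open>norm u = 1\<close>] .
      then have "norm a = 1" "u \<bullet> a = 0" by (auto simp: frame_def orthonormal2_def)
      then have "a \<in> gcirc u \<inter> hemi v \<or> - a \<in> gcirc u \<inter> hemi v" by (auto simp: gcirc_def hemi_def S2_def)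
      then show ?thesis by (auto simp: hits_def)
    qed
    then have "AE u in sigma2. u \<in> hits (hemi v) \<longleftrightarrow> u \<in> UNIV" using AE_sigma2_norm by (auto elim: eventually_mono)
    then have "emeasure sigma2 (hits (hemi v)) = emeasure sigma2 UNIV" by (intro emeasure_eq_AE) (auto simp: m)
    then show ?thesis by (simp add: tau_hit_def measure_def prob_space_sigma2)
  qed
  have "rate Y0 = (\<Sum>c\<in>D0. tau_hit (cell w0 c))" using rate_good[OF good_Y0] by (simp add: tess_Y0)
  also have "\<dots> = (\<Sum>c\<in>D0. 1)"
  proof (rule sum.cong)
    fix c assume "c \<in> D0"
    then have "cell w0 c \<in> Y0" using tess_Y0 by (auto simp: tess_def)
    then show "tau_hit (cell w0 c) = 1" using one by (auto simp: Y0_def)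
  qed simp
  also have "\<dots> = 2" by (simp add: D0_def)
  finally show ?thesis .
qed

theorem theorem1:
  fixes t :: real
  assumes "t \<ge> 0"
  shows "Exp_Y t (\<lambda>T. ennreal (2*pi) * (\<Sum>\<^sub>\<infinity>e\<in>edges T. sigma1 e))
           = ennreal (2*pi*(1 + t - exp (-2*t)))
       \<and> Exp_Y t (\<lambda>T. ennreal (2*pi) * (\<Sum>\<^sub>\<infinity>m\<in>max_segments T. sigma1 m))
           = ennreal (2*pi*t)
       \<and> Exp_Y t (\<lambda>T. ennreal (2*pi) * (\<Sum>\<^sub>\<infinity>p\<in>T. sigma1 (sph_boundary p)))
           = ennreal (4*pi*(t+1))"
proof (intro conjI)
  let ?E = "\<lambda>T. ennreal (2*pi) * (\<Sum>\<^sub>\<infinity>e\<in>edges T. sigma1 e)"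
  \<comment> \<open>Agrees with the edge functional as soon as one split has happened, so that the
    two series differ only in the term without splits.\<close>
  let ?L = "\<lambda>T. ennreal (2*pi) * (seg_len T + ennreal 1)"
  have L: "Exp_Y t ?L = ennreal (2*pi*(1 + t))" using assms by (intro Exp_Y_affine) auto
  have EL: "?E (tess w D) = ?L (tess w D)" if "good w k D" "4 \<le> k" for w k D
    using good.sum_edges[OF that(1)] seg_len_good[OF that(1)] that(2) by (simp add: add.commute)
  have later: "jumpP ?E (Suc n) Y0 t = jumpP ?L (Suc n) Y0 t" for n
  proof -
    \<comment> \<open>The state after the first split has four normals, hence
      \<open>k = Suc 3\<close> and the threshold \<open>m = 4\<close>.\<close>
    have "step (jumpP ?E n) (tess w0 D0) t = step (jumpP ?L n) (tess w0 D0) t"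
      unfolding jumpP_eq_step
      by (intro step_cong[OF good_Y0] step_pow_cong[where m = 4 and k = "Suc 3"]) (auto simp: EL)
    then show ?thesis by (simp add: jumpP_eq_step tess_Y0)
  qed
  have "edges Y0 = {}" using good.edges_empty[OF good_Y0] by (simp add: tess_Y0)
  then have E0: "jumpP ?E 0 Y0 t = 0" by simp
  have "seg_len Y0 = 0" using seg_len_good[OF good_Y0] by (simp add: tess_Y0 len_Y0)
  then have L0: "jumpP ?L 0 Y0 t = ennreal (2*pi*exp (-2*t))"
    by (simp add: rate_Y0 ennreal_mult[symmetric] mult.commute)
  have "Exp_Y t ?L = (\<Sum>n. jumpP ?L (Suc n) Y0 t) + jumpP ?L 0 Y0 t"
    unfolding Exp_Y_def using suminf_offset[of "\<lambda>n. jumpP ?L n Y0 t" 1] by (simp del: jumpP.simps)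
  moreover have "Exp_Y t ?E = (\<Sum>n. jumpP ?E (Suc n) Y0 t)"
    unfolding Exp_Y_def using suminf_offset[of "\<lambda>n. jumpP ?E n Y0 t" 1] E0 by (simp del: jumpP.simps)
  \<comment> \<open>Stated as a sum first; the finite term can then be cancelled in
    \<open>ennreal\<close>.\<close>
  ultimately have "ennreal (2*pi*(1 + t)) = Exp_Y t ?E + ennreal (2*pi*exp (-2*t))"
    using L L0 later by (simp del: jumpP.simps)
  then have "Exp_Y t ?E = ennreal (2*pi*(1 + t)) - ennreal (2*pi*exp (-2*t))"
    by (simp add: ennreal_add_diff_cancel_right)
  also have "\<dots> = ennreal (2*pi*(1 + t) - 2*pi*exp (-2*t))" by (rule ennreal_minus) simp
  also have "2*pi*(1 + t) - 2*pi*exp (-2*t) = 2*pi*(1 + t - exp (-2*t))" by (simp add: algebra_simps)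
  finally show "Exp_Y t ?E = ennreal (2*pi*(1 + t - exp (-2*t)))" .
next
  have "Exp_Y t (\<lambda>T. ennreal (2*pi) * (\<Sum>\<^sub>\<infinity>m\<in>max_segments T. sigma1 m)) = ennreal (2*pi*(0 + t))"
    using assms by (intro Exp_Y_affine) (auto simp: seg_len_def)
  then show "Exp_Y t (\<lambda>T. ennreal (2*pi) * (\<Sum>\<^sub>\<infinity>m\<in>max_segments T. sigma1 m)) = ennreal (2*pi*t)" by simp
next
  have "Exp_Y t (\<lambda>T. ennreal (2*pi) * (\<Sum>\<^sub>\<infinity>p\<in>T. sigma1 (sph_boundary p))) = ennreal (4*pi*(1 + t))"
  proof (rule Exp_Y_affine)
    fix w k D assume g: "good w k D"
    have "ennreal (2*pi) * 2 = ennreal (4*pi)"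
      using ennreal_mult[of "2*pi" 2] by simp
    then have "ennreal (2*pi) * (2 * x) = ennreal (4*pi) * x" for x by (metis mult.assoc)
    then show "ennreal (2*pi) * (\<Sum>\<^sub>\<infinity>p\<in>tess w D. sigma1 (sph_boundary p)) = ennreal (4*pi) * (seg_len (tess w D) + ennreal 1)"
      unfolding good.sum_boundary[OF g] seg_len_good[OF g] by (simp only: add.commute ennreal_1)
  qed (use assms in auto)
  then show "Exp_Y t (\<lambda>T. ennreal (2*pi) * (\<Sum>\<^sub>\<infinity>p\<in>T. sigma1 (sph_boundary p))) = ennreal (4*pi*(t+1))"
    by (simp add: add.commute)
qed

end
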